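(* Let $\phi=(f_1,\ldots,f_n)\in\mathbb{Q}(x_1,\ldots,x_m)^n$ and $X=\overline{\mathrm{im}(\phi)}\subseteq\mathbb{C}^n$. On input $\phi$, the deterministic Algorithm 3 described in the context computes a basis for the symmetry algebra $\mathfrak{g}_X$ of $X$.
   Context: Closures are Zariski closures; $\phi$ is regarded as a rational map $\mathbb{C}^m\dashrightarrow\mathbb{C}^n$, given by explicit fractions of polynomials (standard encoding). $\mathfrak{g}_X\subseteq\mathfrak{gl}_n(\mathbb{C})$ is the Lie algebra of $G_X=\{g\in\mathrm{GL}_n(\mathbb{C})\mid gX=X\}$; since $\phi$ is defined over $\mathbb{Q}$, it is the $\mathbb{C}$-span of $\mathfrak{g}_{X,\mathbb{Q}}=\mathfrak{g}_X\cap\mathfrak{gl}_n(\mathbb{Q})$, and the algorithm's output is a basis of $\mathfrak{g}_{X,\mathbb{Q}}$. Algorithm 3 (symbolic computations). (1) Let $p=(x_1,\ldots,x_m)$, where the $x_i$ are variables, and $q=\phi(p)$. (2) Let $J=\left(\frac{\partial f_i}{\partial x_j}(p)\right)_{ij}\in\mathbb{Q}(x_1,\ldots,x_m)^{n\times m}$ and let $k$ be the rank of $J$ over $\mathbb{Q}(x_1,\ldots,x_m)$. (3) Let $A=(a_{ij})_{i,j}$ be an $n\times n$ matrix of variables. (4) Let $E$ be the set of all $(k+1)\times(k+1)$ subdeterminants of the $n\times(m+1)$ matrix $(J\,|\,A.q)$ that involve the last column. Each element of $E$ is a linear form in the $a_{ij}$ with coefficients in $\mathbb{Q}(x_1,\ldots,x_m)$;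 write it as $\frac1h\tilde e$ with $h\in\mathbb{Q}[x_1,\ldots,x_m]$ nonzero and $\tilde e$ (its numerator) a linear form in the $a_{ij}$ with coefficients in $\mathbb{Q}[x_1,\ldots,x_m]$. (5) Let $F$ be the set of all coefficients of all monomials in $x_1,\ldots,x_m$ in the numerators $\tilde e$ of the elements of $E$; these are linear forms in the $a_{ij}$ over $\mathbb{Q}$. (6) Return a basis $\mathcal{B}$ of the common zero set of the linear forms in $F$ in $\mathfrak{gl}_n(\mathbb{Q})$. *)

theory Defs
  imports
    Complex_Main
    "HOL-Library.Poly_Mapping"
    "HOL-Computational_Algebra.Fraction_Field"
    "Jordan_Normal_Form.DL_Rank"
    "Jordan_Normal_Form.DL_Submatrix"
begin

section \<open>Multivariate polynomials and rational functions\<close>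

text \<open>
  A polynomial with coefficients in \<open>'a\<close> and variables indexed by \<open>'v\<close> is a finitely supported
  map from exponent vectors to coefficients; its product is the convolution product of
  \<^theory>\<open>HOL-Library.Poly_Mapping\<close>.
\<close>

type_synonym ('v, 'a) mpoly = "('v \<Rightarrow>\<^sub>0 nat) \<Rightarrow>\<^sub>0 'a"

definition mp_const :: "'a::zero \<Rightarrow> ('v, 'a) mpoly" where
  "mp_const c = Poly_Mapping.single 0 c"

definition mp_var :: "'v \<Rightarrow> ('v, 'a::zero_neq_one) mpoly" where
  "mp_var v = Poly_Mapping.single (Poly_Mapping.single v 1) 1"

definition mp_vars :: "('v, 'a::zero) mpoly \<Rightarrow> 'v set" where
  "mp_vars p = (\<Union>\<mu>\<in>Poly_Mapping.keys p. Poly_Mapping.keys \<mu>)"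

text \<open>Evaluation at the point \<open>\<alpha>\<close>, with coefficients mapped into the target ring by \<open>\<iota>\<close>.\<close>

definition mp_eval ::
    "('a::zero \<Rightarrow> 'b::comm_semiring_1) \<Rightarrow> ('v \<Rightarrow> 'b) \<Rightarrow> ('v, 'a) mpoly \<Rightarrow> 'b" where
  "mp_eval \<iota> \<alpha> p = (\<Sum>\<mu>\<in>Poly_Mapping.keys p. \<iota> (Poly_Mapping.lookup p \<mu>) *
      (\<Prod>v\<in>Poly_Mapping.keys \<mu>. \<alpha> v ^ Poly_Mapping.lookup \<mu> v))"

text \<open>
  In \<open>mp_pderiv\<close> the truncated subtraction \<open>\<mu> - single v 1\<close> matters only when \<open>v\<close> does not occur
  in \<open>\<mu>\<close>, and then the coefficient is \<open>0\<close>.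
\<close>

definition mp_pderiv :: "'v \<Rightarrow> ('v, 'a::comm_semiring_1) mpoly \<Rightarrow> ('v, 'a) mpoly" where
  "mp_pderiv v p = (\<Sum>\<mu>\<in>Poly_Mapping.keys p.
      Poly_Mapping.single (\<mu> - Poly_Mapping.single v 1)
        (of_nat (Poly_Mapping.lookup \<mu> v) * Poly_Mapping.lookup p \<mu>))"

lemma mp_pderiv_superset:
  assumes "finite S" "Poly_Mapping.keys p \<subseteq> S"
  shows "mp_pderiv v p = (\<Sum>\<mu>\<in>S. Poly_Mapping.single (\<mu> - Poly_Mapping.single v 1)
        (of_nat (Poly_Mapping.lookup \<mu> v) * Poly_Mapping.lookup p \<mu>))"
  unfolding mp_pderiv_def
  by (rule sum.mono_neutral_left) (use assms in \<open>auto simp: in_keys_iff\<close>)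

lemma mp_pderiv_add: "mp_pderiv v (p + q) = mp_pderiv v p + mp_pderiv v q"
proof -
  let ?S = "Poly_Mapping.keys p \<union> Poly_Mapping.keys q"
  have "finite ?S" "Poly_Mapping.keys (p + q) \<subseteq> ?S"
    by (simp_all add: Poly_Mapping.keys_add)
  then show ?thesis
    by (simp add: mp_pderiv_superset[of ?S] lookup_add distrib_left single_add sum.distrib)
qed

lemma mp_pderiv_single:
  "mp_pderiv v (Poly_Mapping.single \<mu> c) =
     Poly_Mapping.single (\<mu> - Poly_Mapping.single v 1) (of_nat (Poly_Mapping.lookup \<mu> v) * c)"
  by (subst mp_pderiv_superset[of "{\<mu>}"]) auto

lemma mp_pderiv_mult_single:
  "mp_pderiv v (Poly_Mapping.single \<mu> c * Poly_Mapping.single \<nu> d) =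
     mp_pderiv v (Poly_Mapping.single \<mu> c) * Poly_Mapping.single \<nu> d +
     Poly_Mapping.single \<mu> c * mp_pderiv v (Poly_Mapping.single \<nu> d)"
proof -
  let ?e = "Poly_Mapping.single v 1 :: 'a \<Rightarrow>\<^sub>0 nat"
  have left: "\<mu> - ?e + \<nu> = \<mu> + \<nu> - ?e" if "Poly_Mapping.lookup \<mu> v \<noteq> 0"
    using that by (intro poly_mapping_eqI) (auto simp: lookup_add lookup_minus lookup_single when_def)
  have right: "\<mu> + (\<nu> - ?e) = \<mu> + \<nu> - ?e" if "Poly_Mapping.lookup \<nu> v \<noteq> 0"
    using that by (intro poly_mapping_eqI) (auto simp: lookup_add lookup_minus lookup_single when_def)
  have l: "Poly_Mapping.single (\<mu> - ?e + \<nu>) (of_nat (Poly_Mapping.lookup \<mu> v) * c * d)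
      = Poly_Mapping.single (\<mu> + \<nu> - ?e) (of_nat (Poly_Mapping.lookup \<mu> v) * c * d)"
    using left by (cases "Poly_Mapping.lookup \<mu> v = 0") auto
  have r: "Poly_Mapping.single (\<mu> + (\<nu> - ?e)) (c * (of_nat (Poly_Mapping.lookup \<nu> v) * d))
      = Poly_Mapping.single (\<mu> + \<nu> - ?e) (c * (of_nat (Poly_Mapping.lookup \<nu> v) * d))"
    using right by (cases "Poly_Mapping.lookup \<nu> v = 0") auto
  show ?thesis
    unfolding mp_pderiv_single mult_single l r
    by (simp add: lookup_add algebra_simps flip: single_add)
qed

lemma mp_induct [case_names zero single add]:
  fixes p :: "('v, 'a::comm_monoid_add) mpoly"
  assumes "P 0" "\<And>\<mu> c. P (Poly_Mapping.single \<mu> c)" "\<And>p q. P p \<Longrightarrow> P q \<Longrightarrow> P (p + q)"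
  shows "P p"
proof (induction p rule: Poly_Mapping.update_induct)
  case const
  show ?case by (fact assms(1))
next
  case (update f a b)
  have "Poly_Mapping.update a b f = f + Poly_Mapping.single a b"
    using update(1) by (intro poly_mapping_eqI)
      (auto simp: lookup_update lookup_add lookup_single when_def in_keys_iff)
  then show ?case
    using assms(2,3) update by simp
qed

lemma mp_pderiv_mult: "mp_pderiv v (p * q) = mp_pderiv v p * q + p * mp_pderiv v q"
proof (induction p rule: mp_induct)
  case zero
  show ?case by (simp add: mp_pderiv_def)
next
  case (single \<mu> c)
  show ?case
  proof (induction q rule: mp_induct)
    case zero
    show ?case by (simp add: mp_pderiv_def)
  next
    case (single \<nu> d)
    show ?case by (rule mp_pderiv_mult_single)
  next
    case (add q1 q2)
    then show ?case by (simp add: mp_pderiv_add algebra_simps)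
  qed
next
  case (add p1 p2)
  then show ?case by (simp add: mp_pderiv_add algebra_simps)
qed

text \<open>
  Rational functions over \<open>\<rat>\<close> live in the fraction field of the polynomial ring in countably many
  variables \<open>x\<^sub>0, x\<^sub>1, \<dots>\<close>; \<open>rat_functions m\<close> is its subfield \<open>\<rat>(x\<^sub>0, \<dots>, x\<^bsub>m-1\<^esub>)\<close>.
\<close>

type_synonym ratfun = "(nat, rat) mpoly fract"

definition polys_in :: "nat \<Rightarrow> (nat, rat) mpoly set" where
  "polys_in m = {p. mp_vars p \<subseteq> {..<m}}"

definition rat_functions :: "nat \<Rightarrow> ratfun set" where
  "rat_functions m = {Fract a b | a b. a \<in> polys_in m \<and> b \<in> polys_in m \<and> b \<noteq> 0}"

text \<open>
  The formal partial derivative, by the quotient rule; \<open>rf_pderiv_Fract\<close> shows that it does not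
  depend on the fraction.
\<close>

definition rf_pderiv :: "nat \<Rightarrow> ratfun \<Rightarrow> ratfun" where
  "rf_pderiv j f = (THE g. \<exists>a b. b \<noteq> 0 \<and> f = Fract a b \<and>
     g = Fract (mp_pderiv j a * b - a * mp_pderiv j b) (b * b))"

lemma quotient_rule_cong:
  fixes a b a' b' da db da' db' :: "'a::idom"
  assumes "a * b' = a' * b" "da * b' + a * db' = da' * b + a' * db"
  shows "(da * b - a * db) * (b' * b') = (da' * b' - a' * db') * (b * b)"
proof -
  have D: "da * b' = da' * b + a' * db - a * db'"
    using assms(2) by (simp add: eq_diff_eq)
  have "(da * b - a * db) * (b' * b') = (da * b') * (b * b') - (a * b') * (b' * db)"
    by (simp add: algebra_simps)
  also have "\<dots> = da' * b * (b * b') - (a * b') * (b * db')"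
    unfolding D assms(1) by (simp add: algebra_simps) (simp add: assms(1))
  also have "\<dots> = (da' * b' - a' * db') * (b * b)"
    unfolding assms(1) by (simp add: algebra_simps)
  finally show ?thesis .
qed

lemma rf_pderiv_Fract:
  assumes "b \<noteq> 0"
  shows "rf_pderiv j (Fract a b) = Fract (mp_pderiv j a * b - a * mp_pderiv j b) (b * b)"
proof -
  let ?D = "mp_pderiv j"
  have wd: "Fract (?D a' * b' - a' * ?D b') (b' * b') = Fract (?D a * b - a * ?D b) (b * b)"
    if nz: "b' \<noteq> 0" and Fr: "Fract a b = Fract a' b'" for a' b'
  proof -
    have eq: "a * b' = a' * b"
      using Fr nz assms by (simp add: eq_fract(1))
    have "?D (a * b') = ?D (a' * b)"
      by (simp only: eq)
    then have "?D a * b' + a * ?D b' = ?D a' * b + a' * ?D b"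
      by (simp only: mp_pderiv_mult)
    with eq have "(?D a * b - a * ?D b) * (b' * b') = (?D a' * b' - a' * ?D b') * (b * b)"
      by (rule quotient_rule_cong)
    then show ?thesis
      using nz assms by (simp add: eq_fract(1))
  qed
  show ?thesis
    unfolding rf_pderiv_def
  proof (rule the_equality)
    show "\<exists>a' b'. b' \<noteq> 0 \<and> Fract a b = Fract a' b' \<and>
        Fract (?D a * b - a * ?D b) (b * b) = Fract (?D a' * b' - a' * ?D b') (b' * b')"
      using assms by blast
  next
    fix g
    assume "\<exists>a' b'. b' \<noteq> 0 \<and> Fract a b = Fract a' b' \<and>
        g = Fract (?D a' * b' - a' * ?D b') (b' * b')"
    then show "g = Fract (?D a * b - a * ?D b) (b * b)"
      using wd by blast
  qed
qed

section \<open>The closed image of a rational map and its symmetry algebra\<close>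

text \<open>
  \<open>f\<close> is regular at \<open>x\<close> with value \<open>y\<close> if some fraction representing \<open>f\<close> has a denominator that
  does not vanish at \<open>x\<close>; the value does not depend on the fraction.
\<close>

definition rf_value :: "nat \<Rightarrow> ratfun \<Rightarrow> complex vec \<Rightarrow> complex \<Rightarrow> bool" where
  "rf_value m f x y \<longleftrightarrow> (\<exists>a\<in>polys_in m. \<exists>b\<in>polys_in m. f = Fract a b \<and>
      mp_eval of_rat (($) x) b \<noteq> 0 \<and>
      y = mp_eval of_rat (($) x) a / mp_eval of_rat (($) x) b)"

definition rat_map_image :: "nat \<Rightarrow> nat \<Rightarrow> ratfun vec \<Rightarrow> complex vec set" where
  "rat_map_image m n \<phi> =
     {y \<in> carrier_vec n. \<exists>x\<in>carrier_vec m. \<forall>i<n. rf_value m (\<phi> $ i) x (y $ i)}"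

definition zariski_closure :: "nat \<Rightarrow> complex vec set \<Rightarrow> complex vec set" where
  "zariski_closure n S = {y \<in> carrier_vec n.
     \<forall>P :: (nat, complex) mpoly. mp_vars P \<subseteq> {..<n} \<longrightarrow>
       (\<forall>x\<in>S. mp_eval (\<lambda>c. c) (($) x) P = 0) \<longrightarrow> mp_eval (\<lambda>c. c) (($) y) P = 0}"

definition symmetry_group :: "nat \<Rightarrow> complex vec set \<Rightarrow> complex mat set" where
  "symmetry_group n X =
     {g \<in> carrier_mat n n. invertible_mat g \<and> (\<lambda>x. g *\<^sub>v x) ` X = X}"

text \<open>
  The Lie algebra of a linear algebraic group \<open>G\<close> in \<open>GL\<^sub>n(\<complex>)\<close>, as a subspace of the space of
  \<open>n \<times> n\<close> matrices: the Zariski tangent space of \<open>G\<close> at the identity, cut out by the differentials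
  at \<open>1\<close> of all polynomials in the matrix entries that vanish on \<open>G\<close>.  Allowing the inverse of the
  determinant as a further coordinate function would add no condition, since a function
  \<open>P / det\<^sup>k\<close> that vanishes on \<open>G\<close> has the same differential at \<open>1\<close> as \<open>P\<close>.
\<close>

definition lie_algebra :: "nat \<Rightarrow> complex mat set \<Rightarrow> complex mat set" where
  "lie_algebra n G = {M \<in> carrier_mat n n.
     \<forall>P :: (nat \<times> nat, complex) mpoly. mp_vars P \<subseteq> {..<n} \<times> {..<n} \<longrightarrow>
       (\<forall>g\<in>G. mp_eval (\<lambda>c. c) (($$) g) P = 0) \<longrightarrow>
       (\<Sum>ij\<in>{..<n} \<times> {..<n}. mp_eval (\<lambda>c. c) (($$) (1\<^sub>m n)) (mp_pderiv ij P) * M $$ ij) = 0}"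

definition symmetry_algebra :: "nat \<Rightarrow> complex vec set \<Rightarrow> complex mat set" where
  "symmetry_algebra n X = lie_algebra n (symmetry_group n X)"

definition rational_symmetry_algebra :: "nat \<Rightarrow> complex vec set \<Rightarrow> rat mat set" where
  "rational_symmetry_algebra n X =
     {M \<in> carrier_mat n n. map_mat of_rat M \<in> symmetry_algebra n X}"

text \<open>\<open>W\<close> is a linear subspace of the \<open>n \<times> n\<close> matrices over the field \<open>'a\<close>, with basis \<open>B\<close>.\<close>

definition is_basis_of :: "nat \<Rightarrow> 'a::field mat set \<Rightarrow> 'a mat set \<Rightarrow> bool" where
  "is_basis_of n W B \<longleftrightarrow>
     VectorSpace.subspace class_ring W (module_mat TYPE('a) n n) \<and>
     vectorspace.basis class_ring ((module_mat TYPE('a) n n)\<lparr>carrier := W\<rparr>) B"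

section \<open>The symbolic algorithm\<close>

definition jacobian :: "nat \<Rightarrow> nat \<Rightarrow> ratfun vec \<Rightarrow> ratfun mat" where
  "jacobian m n \<phi> = mat n m (\<lambda>(i, j). rf_pderiv j (\<phi> $ i))"

text \<open>
  The rank is computed over the field of rational functions in all the \<open>x\<^sub>i\<close>; it equals the rank
  over \<open>\<rat>(x\<^sub>0, \<dots>, x\<^bsub>m-1\<^esub>)\<close>, which contains the entries.
\<close>

definition jacobian_rank :: "nat \<Rightarrow> nat \<Rightarrow> ratfun vec \<Rightarrow> nat" where
  "jacobian_rank m n \<phi> = vec_space.rank n (jacobian m n \<phi>)"

text \<open>
  The matrix \<open>(J | A.q)\<close>, where \<open>q = \<phi>(x\<^sub>0, \<dots>, x\<^bsub>m-1\<^esub>)\<close> is \<open>\<phi>\<close> itself.  Its entries are polynomials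
  in the variables \<open>a\<^bsub>ij\<^esub>\<close>, which are indexed by pairs, over the field of rational functions.
\<close>

definition variable_matrix :: "nat \<Rightarrow> (nat \<times> nat, ratfun) mpoly mat" where
  "variable_matrix n = mat n n mp_var"

definition augmented_jacobian ::
    "nat \<Rightarrow> nat \<Rightarrow> ratfun vec \<Rightarrow> (nat \<times> nat, ratfun) mpoly mat" where
  "augmented_jacobian m n \<phi> = mat n (m + 1) (\<lambda>(i, j).
     if j < m then mp_const (jacobian m n \<phi> $$ (i, j))
     else (variable_matrix n *\<^sub>v map_vec mp_const \<phi>) $ i)"

definition alg_minors :: "nat \<Rightarrow> nat \<Rightarrow> ratfun vec \<Rightarrow> (nat \<times> nat, ratfun) mpoly set" where
  "alg_minors m n \<phi> = (let k = jacobian_rank m n \<phi> in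
     {det (submatrix (augmented_jacobian m n \<phi>) I (insert m S)) | I S.
        I \<subseteq> {..<n} \<and> card I = k + 1 \<and> S \<subseteq> {..<m} \<and> card S = k})"

text \<open>\<open>e = (1/h) e'\<close>, where \<open>h\<close> and the coefficients of \<open>e'\<close> are polynomials in \<open>x\<^sub>0, \<dots>, x\<^bsub>m-1\<^esub>\<close>.\<close>

definition is_numerator ::
    "nat \<Rightarrow> (nat \<times> nat, ratfun) mpoly \<Rightarrow> (nat \<times> nat, (nat, rat) mpoly) mpoly \<Rightarrow> bool" where
  "is_numerator m e e' \<longleftrightarrow> (\<exists>h\<in>polys_in m. h \<noteq> 0 \<and>
     (\<forall>\<nu>. Poly_Mapping.lookup e' \<nu> \<in> polys_in m \<and>
          Poly_Mapping.lookup e \<nu> = Fract (Poly_Mapping.lookup e' \<nu>) h))"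

text \<open>
  The coefficient of the monomial \<open>x\<^sup>\<mu>\<close> in \<open>e'\<close>, read as a polynomial in the \<open>x\<^sub>i\<close> over
  \<open>\<rat>[a\<^bsub>ij\<^esub>]\<close>.
\<close>

definition x_coeff ::
    "(nat \<Rightarrow>\<^sub>0 nat) \<Rightarrow> (nat \<times> nat, (nat, rat) mpoly) mpoly \<Rightarrow> (nat \<times> nat, rat) mpoly" where
  "x_coeff \<mu> e' = Poly_Mapping.map (\<lambda>c. Poly_Mapping.lookup c \<mu>) e'"

definition common_zeros :: "nat \<Rightarrow> (nat \<times> nat, rat) mpoly set \<Rightarrow> rat mat set" where
  "common_zeros n F = {M \<in> carrier_mat n n. \<forall>f\<in>F. mp_eval (\<lambda>c. c) (($$) M) f = 0}"

text \<open>
  \<open>symbolic_algorithm_returns m n \<phi> B\<close>: on input \<open>\<phi>\<close> the algorithm returns \<open>B\<close>, for some way of making the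
  two choices that the description of the algorithm leaves to the implementation, namely the
  numerator \<open>num e\<close> of each minor \<open>e\<close> and the basis of the common zero set.
\<close>

definition symbolic_algorithm_returns :: "nat \<Rightarrow> nat \<Rightarrow> ratfun vec \<Rightarrow> rat mat set \<Rightarrow> bool" where
  "symbolic_algorithm_returns m n \<phi> B \<longleftrightarrow> (\<exists>num.
     (\<forall>e\<in>alg_minors m n \<phi>. is_numerator m e (num e)) \<and>
     is_basis_of n (common_zeros n {x_coeff \<mu> (num e) | \<mu> e. e \<in> alg_minors m n \<phi>}) B)"

end

theory Submission
  imports Defs "Jordan_Normal_Form.DL_Rank_Submatrix"
begin

text \<open>
  Let \<open>I\<close> be the ideal of the polynomials \<open>P\<close> in \<open>\<rat>[y\<^sub>0, \<dots>, y\<^bsub>n-1\<^esub>]\<close> with \<open>P(\<phi>) = 0\<close>.  A matrix \<open>M\<close>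
  acts on polynomials by the derivation \<open>D\<^sub>M P = (\<Sum>i j. M\<^bsub>ij\<^esub> y\<^sub>j \<partial>P/\<partial>y\<^sub>i)\<close>, the derivative of \<open>P\<close> along the
  linear vector field \<open>y \<mapsto> M y\<close>.  The proof compares three conditions on \<open>M\<close>: it is tangent to the
  symmetry group of \<open>X\<close> at the identity, \<open>D\<^sub>M\<close> preserves the polynomials that vanish on \<open>X\<close>, and
  \<open>M \<phi>\<close> lies in the column space of the Jacobian \<open>J\<close>.

  The first two conditions agree for complex \<open>M\<close>.  For \<open>P\<close> vanishing on \<open>X\<close> and \<open>x \<in> X\<close>, the polynomial
  \<open>g \<mapsto> P(g x)\<close> vanishes on the group, and its differential at \<open>1\<close> in direction \<open>M\<close> is \<open>(D\<^sub>M P)(x)\<close>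
  (\<open>symmetry_algebra_imp_lie_deriv_vanishing\<close>).  Conversely, if \<open>D\<^sub>M\<close> preserves the vanishing ideal,
  then the \<open>k\<close>-th derivative of the entire function \<open>t \<mapsto> P(exp(t M) x)\<close> at \<open>0\<close> is \<open>(D\<^sub>M\<^sup>k P)(x) = 0\<close>, so
  the function is zero and \<open>exp(t M)\<close> maps \<open>X\<close> to itself; the curve \<open>t \<mapsto> exp(t M)\<close> in the group has the
  tangent \<open>M\<close> (\<open>lie_deriv_vanishing_imp_symmetry_algebra\<close>).

  For rational \<open>M\<close>, the derivation \<open>D\<^sub>M\<close> maps \<open>I\<close> to itself if and only if \<open>M \<phi>\<close> lies in the column space
  of \<open>J\<close>.  One direction is the chain rule.  In the other, \<open>P(\<phi>) \<mapsto> (D\<^sub>M P)(\<phi>)\<close> is a well-defined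
  derivation on \<open>\<rat>[\<phi>]\<close>; in characteristic zero it extends to a ring that contains all \<open>x\<^sub>j\<close>, where it
  has to be a combination of the partial derivatives, and its value \<open>M \<phi>\<close> on \<open>\<phi>\<close> is the same
  combination of the columns of \<open>J\<close> (\<open>jacobian_image_iff_annihilates_relations\<close>).

  Membership in the column space is what the minors of \<open>(J | M \<phi>)\<close> test
  (\<open>augmented_minors_zero_iff\<close>), and by comparing coefficients their vanishing is the vanishing of the
  linear forms of the algorithm at \<open>M\<close> (\<open>common_zeros_eq_tangent\<close>).

  Rational and complex matrices are compared through the coordinates of \<open>\<complex>\<close> with respect to a basis
  over \<open>\<rat>\<close>.  A nonzero rational function does not vanish at some rational point, so a relation between
  values at rational points can be split into coordinates.  Hence the coordinates of a complex
  symmetry are rational symmetries, and a basis over \<open>\<rat>\<close> remains a basis over \<open>\<complex>\<close>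
  (\<open>coordinates_of_symmetry_preserve_relations\<close>, \<open>preserves_relations_imp_symmetry\<close>,
  \<open>is_basis_of_extension_of_scalars\<close>).
\<close>

section \<open>Evaluation and differentiation of polynomials\<close>

definition mp_monom :: "('v \<Rightarrow> 'b::comm_semiring_1) \<Rightarrow> ('v \<Rightarrow>\<^sub>0 nat) \<Rightarrow> 'b" where
  "mp_monom \<alpha> \<mu> = (\<Prod>v\<in>Poly_Mapping.keys \<mu>. \<alpha> v ^ Poly_Mapping.lookup \<mu> v)"

lemma mp_monom_superset:
  assumes "finite S" "Poly_Mapping.keys \<mu> \<subseteq> S"
  shows "mp_monom \<alpha> \<mu> = (\<Prod>v\<in>S. \<alpha> v ^ Poly_Mapping.lookup \<mu> v)"
  unfolding mp_monom_def
  by (rule prod.mono_neutral_left) (use assms in \<open>auto simp: in_keys_iff\<close>)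

lemma mp_monom_add: "mp_monom \<alpha> (\<mu> + \<nu>) = mp_monom \<alpha> \<mu> * mp_monom \<alpha> \<nu>"
proof -
  let ?S = "Poly_Mapping.keys \<mu> \<union> Poly_Mapping.keys \<nu>"
  have "finite ?S" "Poly_Mapping.keys (\<mu> + \<nu>) \<subseteq> ?S"
    by (simp_all add: Poly_Mapping.keys_add)
  then show ?thesis
    by (simp add: mp_monom_superset[of ?S] lookup_add power_add prod.distrib)
qed

lemma mp_eval_superset:
  assumes "\<iota> 0 = 0" "finite S" "Poly_Mapping.keys p \<subseteq> S"
  shows "mp_eval \<iota> \<alpha> p = (\<Sum>\<mu>\<in>S. \<iota> (Poly_Mapping.lookup p \<mu>) * mp_monom \<alpha> \<mu>)"
  unfolding mp_eval_def mp_monom_def[symmetric]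
  by (rule sum.mono_neutral_left) (use assms in \<open>auto simp: in_keys_iff\<close>)

lemma mp_eval_zero [simp]: "mp_eval \<iota> \<alpha> 0 = 0"
  by (simp add: mp_eval_def)

lemma mp_eval_single:
  assumes "\<iota> 0 = 0"
  shows "mp_eval \<iota> \<alpha> (Poly_Mapping.single \<mu> c) = \<iota> c * mp_monom \<alpha> \<mu>"
  by (subst mp_eval_superset[of _ "{\<mu>}"]) (use assms in auto)

lemma mp_const_0 [simp]: "mp_const 0 = 0"
  by (simp add: mp_const_def)

lemma mp_const_1 [simp]: "mp_const 1 = 1"
  by (simp add: mp_const_def)

lemma mp_const_add: "mp_const (a + b) = mp_const a + mp_const b"
  by (simp add: mp_const_def single_add)

lemma mp_const_mult: "mp_const (a * b) = mp_const a * mp_const b"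
  by (simp add: mp_const_def mult_single)

lemma mp_const_hom: "comm_semiring_hom mp_const"
  by unfold_locales (simp_all add: mp_const_add mp_const_mult)

lemma mp_eval_const: "\<iota> 0 = 0 \<Longrightarrow> mp_eval \<iota> \<alpha> (mp_const c) = \<iota> c"
  by (simp add: mp_const_def mp_eval_single mp_monom_def)

lemma mp_eval_var: "\<iota> 0 = 0 \<Longrightarrow> \<iota> 1 = 1 \<Longrightarrow> mp_eval \<iota> \<alpha> (mp_var v) = \<alpha> v"
  by (simp add: mp_var_def mp_eval_single mp_monom_def)

lemma ident_hom: "comm_semiring_hom (\<lambda>c. c)"
  by unfold_locales simp_all

lemma of_rat_semiring_hom: "comm_semiring_hom (of_rat :: rat \<Rightarrow> 'a::field_char_0)"
  by unfold_locales (simp_all add: of_rat_add of_rat_mult)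

abbreviation mp_value :: "('v \<Rightarrow> 'a::comm_semiring_1) \<Rightarrow> ('v, 'a) mpoly \<Rightarrow> 'a" where
  "mp_value \<equiv> mp_eval (\<lambda>c. c)"

context comm_semiring_hom
begin

lemma mp_eval_add: "mp_eval hom \<alpha> (p + q) = mp_eval hom \<alpha> p + mp_eval hom \<alpha> q"
proof -
  let ?S = "Poly_Mapping.keys p \<union> Poly_Mapping.keys q"
  have "finite ?S" "Poly_Mapping.keys (p + q) \<subseteq> ?S"
    by (simp_all add: Poly_Mapping.keys_add)
  then show ?thesis
    by (simp add: mp_eval_superset[of _ ?S] lookup_add hom_add distrib_right sum.distrib)
qed

lemma mp_eval_mult: "mp_eval hom \<alpha> (p * q) = mp_eval hom \<alpha> p * mp_eval hom \<alpha> q"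
proof (induction p rule: mp_induct)
  case (single \<mu> c)
  show ?case
  proof (induction q rule: mp_induct)
    case (single \<nu> d)
    show ?case
      by (simp add: mult_single mp_eval_single mp_monom_add hom_mult mult_ac)
  qed (simp_all add: mp_eval_add distrib_left)
qed (simp_all add: mp_eval_add distrib_right)

lemma mp_eval_hom: "comm_semiring_hom (mp_eval hom \<alpha>)"
proof
  show "mp_eval hom \<alpha> 1 = 1"
    using mp_eval_const[of hom \<alpha> 1] by simp
qed (simp_all add: mp_eval_add mp_eval_mult)

lemma mp_eval_sum: "mp_eval hom \<alpha> (\<Sum>i\<in>I. p i) = (\<Sum>i\<in>I. mp_eval hom \<alpha> (p i))"
  by (induction I rule: infinite_finite_induct) (simp_all add: mp_eval_add)

end

lemma mp_eval_uminus:
  assumes "comm_semiring_hom \<iota>"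
  shows "mp_eval \<iota> \<alpha> (- p) = - mp_eval \<iota> (\<alpha> :: 'v \<Rightarrow> 'b::comm_ring_1) (p :: ('v, 'a::comm_ring_1) mpoly)"
proof -
  interpret comm_semiring_hom \<iota> by fact
  have "mp_eval \<iota> \<alpha> (p + - p) = 0" by simp
  then show ?thesis
    unfolding mp_eval_add by (metis add_eq_0_iff)
qed

lemma mp_vars_const [simp]: "mp_vars (mp_const c) = {}"
  by (auto simp: mp_vars_def mp_const_def)

lemma mp_vars_0 [simp]: "mp_vars 0 = {}"
  by (auto simp: mp_vars_def)

lemma mp_vars_1 [simp]: "mp_vars (1 :: ('v, 'a::comm_semiring_1) mpoly) = {}"
  using mp_vars_const[of "1 :: 'a"] by simp

lemma mp_vars_var [simp]: "mp_vars (mp_var v) = {v}"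
  by (auto simp: mp_vars_def mp_var_def)

lemma mp_vars_add: "mp_vars p \<subseteq> V \<Longrightarrow> mp_vars q \<subseteq> V \<Longrightarrow> mp_vars (p + q) \<subseteq> V"
  using Poly_Mapping.keys_add[of p q] unfolding mp_vars_def by blast

lemma mp_vars_uminus [simp]: "mp_vars (- p) = mp_vars (p :: ('v, 'a::ab_group_add) mpoly)"
  by (simp add: mp_vars_def)

lemma mp_vars_mult:
  assumes "mp_vars p \<subseteq> V" "mp_vars (q :: ('v, 'a::comm_semiring_1) mpoly) \<subseteq> V"
  shows "mp_vars (p * q) \<subseteq> V"
proof -
  have "Poly_Mapping.keys \<mu> \<subseteq> V" if \<mu>: "\<mu> \<in> Poly_Mapping.keys (p * q)" for \<mu>
  proof -
    obtain a b where "\<mu> = a + b" "a \<in> Poly_Mapping.keys p" "b \<in> Poly_Mapping.keys q"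
      using subsetD[OF Poly_Mapping.keys_mult \<mu>] by blast
    moreover from this have "Poly_Mapping.keys a \<subseteq> V" "Poly_Mapping.keys b \<subseteq> V"
      using assms by (auto simp: mp_vars_def)
    ultimately show ?thesis
      using Poly_Mapping.keys_add[of a b] by blast
  qed
  then show ?thesis by (auto simp: mp_vars_def)
qed

lemma mp_vars_sum:
  assumes "\<And>i. i \<in> I \<Longrightarrow> mp_vars (p i) \<subseteq> V"
  shows "mp_vars (\<Sum>i\<in>I. p i) \<subseteq> V"
  using assms
proof (induction I rule: infinite_finite_induct)
  case (insert i I)
  have "mp_vars (p i) \<subseteq> V" "mp_vars (\<Sum>i\<in>I. p i) \<subseteq> V"
    using insert by blast+
  then show ?case
    unfolding sum.insert[OF insert.hyps] by (rule mp_vars_add)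
qed simp_all

lemma mp_vars_prod:
  assumes "\<And>i. i \<in> I \<Longrightarrow> mp_vars (p i :: ('v, 'a::comm_semiring_1) mpoly) \<subseteq> V"
  shows "mp_vars (\<Prod>i\<in>I. p i) \<subseteq> V"
  using assms
proof (induction I rule: infinite_finite_induct)
  case (insert i I)
  have "mp_vars (p i) \<subseteq> V" "mp_vars (\<Prod>i\<in>I. p i) \<subseteq> V"
    using insert by blast+
  then show ?case
    unfolding prod.insert[OF insert.hyps] by (rule mp_vars_mult)
qed simp_all

lemma mp_vars_pderiv:
  fixes p :: "('v, 'a::comm_semiring_1) mpoly"
  assumes "mp_vars p \<subseteq> V"
  shows "mp_vars (mp_pderiv v p) \<subseteq> V"
  unfolding mp_pderiv_def
proof (rule mp_vars_sum)
  fix \<mu> assume "\<mu> \<in> Poly_Mapping.keys p"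
  then have "Poly_Mapping.keys \<mu> \<subseteq> V"
    using assms by (auto simp: mp_vars_def)
  moreover have "Poly_Mapping.keys (\<mu> - Poly_Mapping.single v 1) \<subseteq> Poly_Mapping.keys \<mu>"
    by (auto simp: in_keys_iff lookup_minus)
  ultimately show "mp_vars (Poly_Mapping.single (\<mu> - Poly_Mapping.single v 1)
      (of_nat (Poly_Mapping.lookup \<mu> v) * Poly_Mapping.lookup p \<mu>)) \<subseteq> V"
    by (auto simp: mp_vars_def)
qed

lemma mp_sum_monomials:
  "p = (\<Sum>\<mu>\<in>Poly_Mapping.keys p. Poly_Mapping.single \<mu> (Poly_Mapping.lookup p \<mu>))"
  by (intro poly_mapping_eqI) (auto simp: lookup_sum lookup_single when_def in_keys_iff)

text \<open>
  A polynomial in the variables \<open>V\<close> is built from constants and these variables by sums and products.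
  Identities between ring homomorphisms or derivations are checked on these generators.
\<close>

lemma mp_vars_induct [consumes 1, case_names const var add mult]:
  fixes p :: "('v, 'a::comm_semiring_1) mpoly"
  assumes "mp_vars p \<subseteq> V"
    and const: "\<And>c. P (mp_const c)"
    and var: "\<And>v. v \<in> V \<Longrightarrow> P (mp_var v)"
    and add: "\<And>p q. mp_vars p \<subseteq> V \<Longrightarrow> mp_vars q \<subseteq> V \<Longrightarrow> P p \<Longrightarrow> P q \<Longrightarrow> P (p + q)"
    and mult: "\<And>p q. mp_vars p \<subseteq> V \<Longrightarrow> mp_vars q \<subseteq> V \<Longrightarrow> P p \<Longrightarrow> P q \<Longrightarrow> P (p * q)"
  shows "P p"
proof -
  let ?Q = "\<lambda>p. mp_vars p \<subseteq> V \<and> P p"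
  have one: "?Q 1" using const[of 1] by simp
  have zero: "?Q 0" using const[of 0] by simp
  have pow: "?Q (mp_var v ^ k)" if "v \<in> V" for v k
    using that one by (induction k) (simp_all add: mult mp_vars_mult var)
  have singl: "?Q (Poly_Mapping.single \<mu> c)" if "Poly_Mapping.keys \<mu> \<subseteq> V" for \<mu> c
  proof -
    have single_pow: "Poly_Mapping.single (Poly_Mapping.single v k) 1 = (mp_var v ^ k :: ('v, 'a) mpoly)"
      for v k
    proof (induction k)
      case (Suc k)
      have "Poly_Mapping.single (Poly_Mapping.single v (Suc k)) (1::'a) =
          mp_var v * Poly_Mapping.single (Poly_Mapping.single v k) 1"
        by (simp add: mp_var_def mult_single flip: single_add)
      then show ?case by (simp add: Suc.IH)
    qed simp
    have "?Q (Poly_Mapping.single \<mu> 1)"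
      using that
    proof (induction \<mu> rule: Poly_Mapping.update_induct)
      case const
      then show ?case using one by simp
    next
      case (update f a b)
      have eq: "Poly_Mapping.update a b f = f + Poly_Mapping.single a b"
        using update(1) by (intro poly_mapping_eqI)
          (auto simp: lookup_update lookup_add lookup_single when_def in_keys_iff)
      have "Poly_Mapping.keys f \<subseteq> Poly_Mapping.keys (Poly_Mapping.update a b f)"
        using update(1) unfolding eq by (auto simp: in_keys_iff lookup_add)
      moreover have "a \<in> Poly_Mapping.keys (Poly_Mapping.update a b f)"
        using update(2) by (simp add: in_keys_iff lookup_update)
      ultimately have "?Q (Poly_Mapping.single f 1)" "a \<in> V"
        using update by auto
      then have "?Q (Poly_Mapping.single f 1 * mp_var a ^ b)"
        using pow[of a b] mult mp_vars_mult by (simp add: mult mp_vars_mult)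
      also have "Poly_Mapping.single f 1 * mp_var a ^ b = Poly_Mapping.single (Poly_Mapping.update a b f) (1::'a)"
        unfolding eq single_pow[symmetric] by (simp add: mult_single)
      finally show ?case .
    qed
    then have "?Q (mp_const c * Poly_Mapping.single \<mu> 1)"
      using const[of c] mult mp_vars_mult by (simp add: mult mp_vars_mult)
    then show ?thesis by (simp add: mp_const_def mult_single)
  qed
  have "?Q (\<Sum>\<mu>\<in>K. Poly_Mapping.single \<mu> (Poly_Mapping.lookup p \<mu>))"
    if "finite K" "K \<subseteq> Poly_Mapping.keys p" for K
    using that
  proof induction
    case empty
    show ?case using zero by simp
  next
    case (insert \<mu> K)
    have "Poly_Mapping.keys \<mu> \<subseteq> V"
      using insert.prems assms(1) by (auto simp: mp_vars_def)
    then show ?case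
      using insert singl[of \<mu> "Poly_Mapping.lookup p \<mu>"] by (simp add: add mp_vars_add)
  qed
  from this[OF finite_keys subset_refl] show ?thesis
    by (simp flip: mp_sum_monomials)
qed

lemma mp_eval_cong:
  assumes "\<And>v. v \<in> mp_vars p \<Longrightarrow> \<alpha> v = \<beta> v"
  shows "mp_eval \<iota> \<alpha> p = mp_eval \<iota> \<beta> p"
  unfolding mp_eval_def
proof (rule sum.cong[OF refl])
  fix \<mu> assume "\<mu> \<in> Poly_Mapping.keys p"
  then have "(\<Prod>v\<in>Poly_Mapping.keys \<mu>. \<alpha> v ^ Poly_Mapping.lookup \<mu> v) =
      (\<Prod>v\<in>Poly_Mapping.keys \<mu>. \<beta> v ^ Poly_Mapping.lookup \<mu> v)"
    by (intro prod.cong refl) (metis UN_I assms mp_vars_def)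
  then show "\<iota> (Poly_Mapping.lookup p \<mu>) * (\<Prod>v\<in>Poly_Mapping.keys \<mu>. \<alpha> v ^ Poly_Mapping.lookup \<mu> v) =
      \<iota> (Poly_Mapping.lookup p \<mu>) * (\<Prod>v\<in>Poly_Mapping.keys \<mu>. \<beta> v ^ Poly_Mapping.lookup \<mu> v)"
    by (rule arg_cong)
qed

lemma mp_pderiv_const [simp]: "mp_pderiv v (mp_const c) = 0"
  by (simp add: mp_const_def mp_pderiv_single)

lemma mp_pderiv_var: "mp_pderiv v (mp_var w) = (if v = w then 1 else 0)"
  by (auto simp: mp_var_def mp_pderiv_single lookup_single when_def single_one)

definition subring_set :: "'a::comm_ring_1 set \<Rightarrow> bool" where
  "subring_set R \<longleftrightarrow> 1 \<in> R \<and> (\<forall>x\<in>R. \<forall>y\<in>R. x + y \<in> R \<and> x * y \<in> R) \<and> (\<forall>x\<in>R. - x \<in> R)"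

text \<open>
  The values of \<open>D\<close> are not confined to \<open>R\<close>: in the applications \<open>R\<close> is a subring of a field, and \<open>D\<close>
  takes its values in that field.
\<close>

definition derivation_on :: "'a::comm_ring_1 set \<Rightarrow> ('a \<Rightarrow> 'a) \<Rightarrow> bool" where
  "derivation_on R D \<longleftrightarrow>
     (\<forall>x\<in>R. \<forall>y\<in>R. D (x + y) = D x + D y \<and> D (x * y) = D x * y + x * D y)"

lemma subring_setD:
  assumes "subring_set R"
  shows "1 \<in> R" "x \<in> R \<Longrightarrow> y \<in> R \<Longrightarrow> x + y \<in> R" "x \<in> R \<Longrightarrow> y \<in> R \<Longrightarrow> x * y \<in> R"
    "x \<in> R \<Longrightarrow> - x \<in> R"
  using assms by (simp_all add: subring_set_def)

lemma derivation_onD: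
  assumes "derivation_on R D" "x \<in> R" "y \<in> R"
  shows "D (x + y) = D x + D y" "D (x * y) = D x * y + x * D y"
  using assms by (simp_all add: derivation_on_def)

lemma mp_eval_in_subring:
  assumes "comm_semiring_hom \<iota>" "subring_set R" "mp_vars p \<subseteq> V"
    and "\<And>c. \<iota> c \<in> R" "\<And>v. v \<in> V \<Longrightarrow> \<alpha> v \<in> R"
  shows "mp_eval \<iota> \<alpha> p \<in> R"
proof -
  interpret comm_semiring_hom \<iota> by fact
  from assms(3) show ?thesis
    by (induction p rule: mp_vars_induct)
       (simp_all add: mp_eval_const mp_eval_var mp_eval_add mp_eval_mult subring_setD[OF assms(2)] assms(4,5))
qed

text \<open>
  The chain rule.  It is stated for derivations on a subring because the derivation that is applied
  to \<open>\<rat>[\<phi>]\<close> below is extended one generator at a time.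
\<close>

lemma derivation_mp_eval:
  assumes "comm_semiring_hom \<iota>" "subring_set R" "derivation_on R D" "mp_vars p \<subseteq> V" "finite V"
    and \<iota>: "\<And>c. \<iota> c \<in> R" "\<And>c. D (\<iota> c) = 0" and \<alpha>: "\<And>v. v \<in> V \<Longrightarrow> \<alpha> v \<in> R"
  shows "D (mp_eval \<iota> \<alpha> p) = (\<Sum>v\<in>V. mp_eval \<iota> \<alpha> (mp_pderiv v p) * D (\<alpha> v))"
proof -
  interpret comm_semiring_hom \<iota> by fact
  have R: "mp_eval \<iota> \<alpha> p \<in> R" if "mp_vars p \<subseteq> V" for p
    by (rule mp_eval_in_subring[OF assms(1,2) that \<iota>(1) \<alpha>])
  from assms(4) show ?thesis
  proof (induction p rule: mp_vars_induct)
    case (const c)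
    then show ?case by (simp add: mp_eval_const \<iota>)
  next
    case (var v)
    have "(\<Sum>w\<in>V. mp_eval \<iota> \<alpha> (mp_pderiv w (mp_var v)) * D (\<alpha> w))
        = (\<Sum>w\<in>V. if w = v then D (\<alpha> w) else 0)"
      using mp_eval_const[of \<iota> \<alpha> 1] by (intro sum.cong) (auto simp: mp_pderiv_var)
    then show ?case
      using var assms(5) by (simp add: mp_eval_var)
  next
    case (add p q)
    then show ?case
      by (simp add: derivation_onD[OF assms(3)] R mp_eval_add mp_pderiv_add distrib_right sum.distrib)
  next
    case (mult p q)
    have "D (mp_eval \<iota> \<alpha> (p * q)) = D (mp_eval \<iota> \<alpha> p) * mp_eval \<iota> \<alpha> q + mp_eval \<iota> \<alpha> p * D (mp_eval \<iota> \<alpha> q)"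
      using mult.hyps by (simp add: derivation_onD[OF assms(3)] R mp_eval_mult)
    also have "\<dots> = (\<Sum>v\<in>V. mp_eval \<iota> \<alpha> (mp_pderiv v (p * q)) * D (\<alpha> v))"
      unfolding mult.IH
      by (simp add: mp_pderiv_mult mp_eval_add mp_eval_mult distrib_right sum.distrib
          sum_distrib_left sum_distrib_right mult_ac distrib_left)
    finally show ?case .
  qed
qed

text \<open>
  Evaluation commutes with ring homomorphisms.  Instances are substitution followed by evaluation,
  evaluation of a rational polynomial over \<open>\<complex>\<close>, and specialisation of the variables \<open>a\<^bsub>ij\<^esub>\<close>.
\<close>

lemma mp_eval_mp_eval:
  assumes "comm_semiring_hom \<iota>" "comm_semiring_hom \<kappa>" "comm_semiring_hom h" "mp_vars p \<subseteq> V"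
    "\<And>c. h (\<iota> c) = \<kappa> c" "\<And>v. v \<in> V \<Longrightarrow> h (\<beta> v) = \<gamma> v"
  shows "h (mp_eval \<iota> \<beta> p) = mp_eval \<kappa> \<gamma> p"
proof -
  interpret i: comm_semiring_hom \<iota> by fact
  interpret k: comm_semiring_hom \<kappa> by fact
  interpret h: comm_semiring_hom h by fact
  from assms(4) show ?thesis
  proof (induction p rule: mp_vars_induct)
    case (const c)
    show ?case by (simp add: mp_eval_const assms(5))
  next
    case (var v)
    then show ?case by (simp add: mp_eval_var assms(6))
  next
    case (add p q)
    then show ?case by (simp add: i.mp_eval_add k.mp_eval_add h.hom_add)
  next
    case (mult p q)
    then show ?case by (simp add: i.mp_eval_mult k.mp_eval_mult h.hom_mult)
  qed
qed
lemmas mp_eval_id_add = comm_semiring_hom.mp_eval_add[OF ident_hom]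
lemmas mp_eval_id_mult = comm_semiring_hom.mp_eval_mult[OF ident_hom]
lemmas mp_eval_id_sum = comm_semiring_hom.mp_eval_sum[OF ident_hom]

section \<open>Extension of derivations in characteristic zero\<close>

text \<open>
  A map \<open>\<delta>\<close> that satisfies the Leibniz rule relative to \<open>e\<close> and vanishes on the kernel of \<open>e\<close> factors
  through the image of \<open>e\<close>.  This produces derivations both on rings \<open>\<rat>[q]\<close> and on ring extensions
  \<open>R[a]\<close>, which are images of polynomial rings.
\<close>

lemma derivation_descends:
  fixes e \<delta> :: "'t::comm_ring_1 \<Rightarrow> 'a::comm_ring_1"
  assumes S: "subring_set S"
    and e: "\<And>x y. x \<in> S \<Longrightarrow> y \<in> S \<Longrightarrow> e (x + y) = e x + e y"
      "\<And>x y. x \<in> S \<Longrightarrow> y \<in> S \<Longrightarrow> e (x * y) = e x * e y"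
    and \<delta>: "\<And>x y. x \<in> S \<Longrightarrow> y \<in> S \<Longrightarrow> \<delta> (x + y) = \<delta> x + \<delta> y"
      "\<And>x y. x \<in> S \<Longrightarrow> y \<in> S \<Longrightarrow> \<delta> (x * y) = \<delta> x * e y + e x * \<delta> y"
    and ker: "\<And>x. x \<in> S \<Longrightarrow> e x = 0 \<Longrightarrow> \<delta> x = 0"
  shows "\<exists>D. derivation_on (e ` S) D \<and> (\<forall>x\<in>S. D (e x) = \<delta> x)"
proof -
  define D where "D z = \<delta> (SOME x. x \<in> S \<and> e x = z)" for z
  have zero: "0 \<in> S"
    using subring_setD(1,2,4)[OF S] by (metis add.right_inverse)
  have neg: "e (- y) = - e y" "\<delta> (- y) = - \<delta> y" if "y \<in> S" for y
  proof -
    have "e 0 = 0" "\<delta> 0 = 0"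
      using e(1)[OF zero zero] \<delta>(1)[OF zero zero] by simp_all
    then show "e (- y) = - e y" "\<delta> (- y) = - \<delta> y"
      using e(1)[of y "- y"] \<delta>(1)[of y "- y"] that subring_setD(4)[OF S that]
      by (simp_all add: eq_neg_iff_add_eq_0 add.commute)
  qed
  have D: "D (e x) = \<delta> x" if x: "x \<in> S" for x
  proof -
    define y where "y = (SOME y. y \<in> S \<and> e y = e x)"
    have y: "y \<in> S" "e y = e x"
      using someI_ex[of "\<lambda>y. y \<in> S \<and> e y = e x"] x unfolding y_def by blast+
    have "\<delta> (y + - x) = 0"
      using x y by (intro ker) (simp_all add: subring_setD[OF S] e neg del: add_uminus_conv_diff)
    then have "\<delta> y = \<delta> x"
      unfolding \<delta>(1)[OF y(1) subring_setD(4)[OF S x]] neg(2)[OF x] by simp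
    then show ?thesis
      by (simp add: D_def y_def[symmetric])
  qed
  have "derivation_on (e ` S) D"
    unfolding derivation_on_def
  proof (intro ballI)
    fix z w assume "z \<in> e ` S" "w \<in> e ` S"
    then obtain x y where xy: "x \<in> S" "y \<in> S" "z = e x" "w = e y"
      by (metis imageE)
    then have "D (z + w) = \<delta> (x + y)" "D (z * w) = \<delta> (x * y)"
      using D[OF subring_setD(2)[OF S xy(1,2)]] D[OF subring_setD(3)[OF S xy(1,2)]]
      by (simp_all only: e)
    then show "D (z + w) = D z + D w \<and> D (z * w) = D z * w + z * D w"
      unfolding xy(3,4) D[OF xy(1)] D[OF xy(2)] using \<delta>[OF xy(1,2)] by simp
  qed
  with D show ?thesis by blast
qed

lemma derivation_on_0: "subring_set R \<Longrightarrow> derivation_on R D \<Longrightarrow> D 0 = 0"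
  using derivation_onD(1)[of R D 0 0] subring_setD[of R] by (metis add.right_inverse add_cancel_left_left)

definition polys_over :: "'a::comm_ring_1 set \<Rightarrow> 'a poly set" where
  "polys_over R = {p. \<forall>i. coeff p i \<in> R}"

lemma subring_set_0: "subring_set R \<Longrightarrow> 0 \<in> R"
  using subring_setD(1,2,4)[of R] by (metis add.right_inverse)

lemma subring_set_sum: "subring_set R \<Longrightarrow> (\<And>i. i \<in> I \<Longrightarrow> f i \<in> R) \<Longrightarrow> (\<Sum>i\<in>I. f i) \<in> R"
  by (induction I rule: infinite_finite_induct) (auto simp: subring_set_0 subring_setD(2))

lemma subring_set_of_nat: "subring_set R \<Longrightarrow> of_nat k \<in> R"
  by (induction k) (simp_all add: subring_set_0 subring_setD(1,2))

lemma subring_set_polys_over: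
  assumes "subring_set R"
  shows "subring_set (polys_over R)"
  unfolding subring_set_def
proof (intro conjI ballI)
  show "1 \<in> polys_over R"
    using assms by (simp add: polys_over_def coeff_1 subring_setD(1) subring_set_0)
  fix p q assume "p \<in> polys_over R" "q \<in> polys_over R"
  then show "p + q \<in> polys_over R" "p * q \<in> polys_over R"
    using assms by (auto simp: polys_over_def coeff_mult intro!: subring_set_sum subring_setD(2,3))
next
  fix p assume "p \<in> polys_over R"
  then show "- p \<in> polys_over R"
    using assms by (auto simp: polys_over_def intro!: subring_setD(4))
qed

lemma derivation_on_sum:
  assumes "subring_set R" "derivation_on R D" "\<And>i. i \<in> I \<Longrightarrow> f i \<in> R"
  shows "D (\<Sum>i\<in>I. f i) = (\<Sum>i\<in>I. D (f i))"
  using assms(3)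
proof (induction I rule: infinite_finite_induct)
  case (insert i I)
  have "D (f i + sum f I) = D (f i) + D (sum f I)"
    by (rule derivation_onD[OF assms(2)]) (use insert.prems assms(1) in \<open>auto intro!: subring_set_sum\<close>)
  then show ?case
    using insert by simp
qed (simp_all add: derivation_on_0[OF assms(1,2)])

lemma map_poly_derivation:
  assumes "subring_set R" "derivation_on R D" "p \<in> polys_over R" "q \<in> polys_over R"
  shows "map_poly D (p + q) = map_poly D p + map_poly D q"
    "map_poly D (p * q) = map_poly D p * q + p * map_poly D q"
proof -
  have pq: "coeff p i \<in> R" "coeff q i \<in> R" for i
    using assms by (simp_all add: polys_over_def)
  show "map_poly D (p + q) = map_poly D p + map_poly D q"
    by (rule poly_eqI)
       (simp add: coeff_map_poly derivation_on_0[OF assms(1,2)] derivation_onD[OF assms(2)] pq)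
  show "map_poly D (p * q) = map_poly D p * q + p * map_poly D q"
    by (rule poly_eqI)
       (simp add: coeff_map_poly derivation_on_0[OF assms(1,2)] derivation_onD[OF assms(2)] pq
        coeff_mult derivation_on_sum[OF assms(1,2)] subring_setD(3)[OF assms(1)] sum.distrib)
qed

text \<open>
  Division with remainder that stays over the subring \<open>R\<close>; the powers of the leading coefficient
  avoid the passage to the fraction field of \<open>R\<close>.
\<close>

lemma pseudo_division_over_subring:
  fixes f g :: "'a::idom poly"
  assumes R: "subring_set R" and f: "f \<in> polys_over R" "f \<noteq> 0" and "g \<in> polys_over R"
  shows "\<exists>k h r. h \<in> polys_over R \<and> r \<in> polys_over R \<and>
    Polynomial.smult (lead_coeff f ^ k) g = f * h + r \<and> (r = 0 \<or> degree r < degree f)"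
  using assms(4)
proof (induction "degree g" arbitrary: g rule: less_induct)
  case less
  note S = subring_setD[OF subring_set_polys_over[OF R]]
  have const: "[:c:] \<in> polys_over R" if "c \<in> R" for c
    using that R by (auto simp: polys_over_def coeff_pCons subring_set_0 split: nat.splits)
  have zero: "0 \<in> polys_over R"
    using R by (simp add: polys_over_def subring_set_0)
  have lcR: "lead_coeff f \<in> R"
    using f by (simp add: polys_over_def)
  show ?case
  proof (cases "g = 0 \<or> degree g < degree f")
    case True
    then show ?thesis
      using less.prems zero by (intro exI[of _ 0] exI[of _ 0] exI[of _ g]) auto
  next
    case False
    \<comment> \<open>Subtracting \<open>f M\<close> from a multiple of \<open>g\<close> cancels the leading term.\<close>
    define M where "M = monom (lead_coeff g) (degree g - degree f)"
    define g1 where "g1 = Polynomial.smult (lead_coeff f) g - f * M"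
    have M: "M \<in> polys_over R"
      using less.prems R by (auto simp: M_def polys_over_def subring_set_0)
    have sm: "Polynomial.smult c p \<in> polys_over R" if "c \<in> R" "p \<in> polys_over R" for c p
      using S(3)[OF const that(2)] that by simp
    have g1R: "g1 \<in> polys_over R"
      using S(2)[OF sm[OF lcR less.prems] S(4)[OF S(3)[OF f(1) M]]] by (simp add: g1_def)
    have dM: "degree M = degree g - degree f" "lead_coeff M = lead_coeff g"
      using False by (auto simp: M_def degree_monom_eq)
    have "M \<noteq> 0"
      using False by (simp add: M_def)
    then have "degree (f * M) = degree g"
      using False f dM by (simp add: degree_mult_eq)
    moreover have "lead_coeff (f * M) = lead_coeff f * lead_coeff g"
      by (simp only: lead_coeff_mult dM(2))
    ultimately have top: "coeff g1 (degree g) = 0" "degree g1 \<le> degree g"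
      unfolding g1_def by (simp, intro degree_diff_le degree_smult_le, simp)
    have "\<exists>k h r. h \<in> polys_over R \<and> r \<in> polys_over R \<and>
      Polynomial.smult (lead_coeff f ^ k) g1 = f * h + r \<and> (r = 0 \<or> degree r < degree f)"
    proof (cases "g1 = 0")
      case True
      then show ?thesis
        using zero by (intro exI[of _ 0] exI[of _ 0]) auto
    next
      case nz: False
      have "degree g1 < degree g"
        using top nz by (metis leading_coeff_0_iff order_le_imp_less_or_eq)
      then show ?thesis
        using less.hyps g1R by blast
    qed
    then obtain k h r where IH: "h \<in> polys_over R" "r \<in> polys_over R"
      "Polynomial.smult (lead_coeff f ^ k) g1 = f * h + r" "r = 0 \<or> degree r < degree f" by blast
    have ck: "lead_coeff f ^ k \<in> R"
      by (induction k) (simp_all add: subring_setD[OF R] lcR)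
    have "Polynomial.smult (lead_coeff f ^ Suc k) g = f * (h + Polynomial.smult (lead_coeff f ^ k) M) + r"
      using IH(3) by (simp add: g1_def smult_diff_right algebra_simps)
    moreover have "h + Polynomial.smult (lead_coeff f ^ k) M \<in> polys_over R"
      using S(2)[OF IH(1) sm[OF ck M]] .
    ultimately show ?thesis
      using IH by blast
  qed
qed

text \<open>
  On \<open>R[a]\<close> the extension has to send \<open>p(a)\<close> to \<open>p\<^sup>D(a) + p'(a) b\<close>, where \<open>p\<^sup>D\<close> has the coefficients \<open>D c\<close>
  and \<open>b\<close> is the value at \<open>a\<close>.  This is well defined if it vanishes whenever \<open>p(a) = 0\<close>.  If \<open>a\<close> is
  transcendental, every \<open>b\<close> will do.  If \<open>a\<close> is algebraic, let \<open>f \<noteq> 0\<close> over \<open>R\<close> have least degree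
  among those with root \<open>a\<close>; then \<open>f'(a) \<noteq> 0\<close> in characteristic zero, the condition for \<open>f\<close> determines \<open>b\<close>, and it
  implies the condition for all \<open>p\<close> with root \<open>a\<close>, as \<open>f\<close> divides a multiple of \<open>p\<close> by a nonzero constant.
\<close>

lemma extend_derivation_one:
  fixes a :: "'a::field"
  assumes char0: "\<And>k. k > 0 \<Longrightarrow> of_nat k \<noteq> (0 :: 'a)"
    and R: "subring_set R" and D: "derivation_on R D"
  shows "\<exists>R' D'. subring_set R' \<and> derivation_on R' D' \<and> R \<subseteq> R' \<and> a \<in> R' \<and> (\<forall>x\<in>R. D' x = D x)"
proof -
  let ?S = "polys_over R"
  note S = subring_setD[OF subring_set_polys_over[OF R]]
  define \<delta> where "\<delta> b p = poly (map_poly D p) a + poly (pderiv p) a * b" for b p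
  have \<delta>_add: "\<delta> b (p + q) = \<delta> b p + \<delta> b q" if "p \<in> ?S" "q \<in> ?S" for b p q
    using that by (simp add: \<delta>_def map_poly_derivation[OF R D] pderiv_add algebra_simps)
  have \<delta>_mult: "\<delta> b (p * q) = \<delta> b p * poly q a + poly p a * \<delta> b q" if "p \<in> ?S" "q \<in> ?S" for b p q
    using that by (simp add: \<delta>_def map_poly_derivation[OF R D] pderiv_mult algebra_simps)
  have const: "[:c:] \<in> ?S" if "c \<in> R" for c
    using that R by (auto simp: polys_over_def coeff_pCons subring_set_0 split: nat.splits)
  have "\<exists>b. \<forall>p\<in>?S. poly p a = 0 \<longrightarrow> \<delta> b p = 0"
  proof (cases "\<exists>p\<in>?S. p \<noteq> 0 \<and> poly p a = 0")
    case False
    then show ?thesis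
      by (intro exI[of _ 0]) (auto simp: \<delta>_def)
  next
    case True
    then obtain f where f: "f \<in> ?S" "f \<noteq> 0" "poly f a = 0"
      and min: "\<And>p. p \<in> ?S \<Longrightarrow> p \<noteq> 0 \<Longrightarrow> poly p a = 0 \<Longrightarrow> degree f \<le> degree p"
      using ex_has_least_nat[of "\<lambda>p. p \<in> ?S \<and> p \<noteq> 0 \<and> poly p a = 0" _ degree] by blast
    have df: "degree f > 0"
      using f by (metis degree_eq_zeroE gr0I pCons_0_0 poly_pCons poly_0 add.right_neutral mult_zero_right)
    have "coeff (pderiv f) (degree f - 1) = of_nat (degree f) * lead_coeff f"
      using df by (simp add: coeff_pderiv)
    then have nz: "pderiv f \<noteq> 0"
      using char0[OF df] f(2) by (metis coeff_0 leading_coeff_0_iff mult_eq_0_iff)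
    have "pderiv f \<in> ?S"
      using f(1) R
      by (auto simp: polys_over_def coeff_pderiv intro!: subring_setD(3) subring_set_of_nat simp del: of_nat_Suc)
    moreover have "degree (pderiv f) < degree f"
      using df le_less_trans[OF degree_le[of "degree f - 1" "pderiv f"]]
      by (auto simp: coeff_pderiv coeff_eq_0)
    ultimately have d0: "poly (pderiv f) a \<noteq> 0"
      using min nz by (meson not_le)
    define b where "b = - poly (map_poly D f) a / poly (pderiv f) a"
    have \<delta>f: "\<delta> b f = 0"
      using d0 by (simp add: \<delta>_def b_def)
    have "\<delta> b g = 0" if g: "g \<in> ?S" "poly g a = 0" for g
    proof -
      obtain k h r where hr: "h \<in> ?S" "r \<in> ?S" "Polynomial.smult (lead_coeff f ^ k) g = f * h + r"
        "r = 0 \<or> degree r < degree f"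
        using pseudo_division_over_subring[OF R f(1,2) g(1)] by blast
      have "poly (Polynomial.smult (lead_coeff f ^ k) g) a = poly (f * h + r) a"
        by (simp only: hr(3))
      then have "poly r a = 0"
        using g f(3) by simp
      then have "r = 0"
        using min[OF hr(2)] hr(4) by fastforce
      then have eq: "[:lead_coeff f ^ k:] * g = f * h"
        using hr(3) by simp
      have lc: "lead_coeff f ^ k \<in> R"
        using f(1) by (induction k) (simp_all add: subring_setD[OF R] polys_over_def)
      have "\<delta> b ([:lead_coeff f ^ k:] * g) = \<delta> b (f * h)"
        by (simp only: eq)
      then have "lead_coeff f ^ k * \<delta> b g = 0"
        using \<delta>_mult[OF const[OF lc] g(1)] \<delta>_mult[OF f(1) hr(1)] g(2) f(3) \<delta>f by simp
      then show ?thesis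
        using f(2) by simp
    qed
    then show ?thesis by blast
  qed
  then obtain b where b: "\<And>p. p \<in> ?S \<Longrightarrow> poly p a = 0 \<Longrightarrow> \<delta> b p = 0" by blast
  obtain D' where D': "derivation_on ((\<lambda>p. poly p a) ` ?S) D'"
    "\<And>p. p \<in> ?S \<Longrightarrow> D' (poly p a) = \<delta> b p"
    using derivation_descends[OF subring_set_polys_over[OF R], of "\<lambda>p. poly p a" "\<delta> b"]
      \<delta>_add \<delta>_mult b by (auto simp: poly_mult)
  have "subring_set ((\<lambda>p. poly p a) ` ?S)"
    unfolding subring_set_def
  proof (intro conjI ballI)
    show "1 \<in> (\<lambda>p. poly p a) ` ?S"
      using S(1) by (intro image_eqI[of _ _ 1]) auto
    fix x y assume "x \<in> (\<lambda>p. poly p a) ` ?S" "y \<in> (\<lambda>p. poly p a) ` ?S"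
    then obtain p q where pq: "x = poly p a" "y = poly q a" "p \<in> ?S" "q \<in> ?S" by blast
    show "x + y \<in> (\<lambda>p. poly p a) ` ?S"
      using pq S(2) by (intro image_eqI[of _ _ "p + q"]) auto
    show "x * y \<in> (\<lambda>p. poly p a) ` ?S"
      using pq S(3) by (intro image_eqI[of _ _ "p * q"]) auto
  next
    fix x assume "x \<in> (\<lambda>p. poly p a) ` ?S"
    then obtain p where "x = poly p a" "p \<in> ?S" by blast
    then show "- x \<in> (\<lambda>p. poly p a) ` ?S"
      using S(4) by (intro image_eqI[of _ _ "- p"]) auto
  qed
  moreover have "R \<subseteq> (\<lambda>p. poly p a) ` ?S"
    using const by (force intro: image_eqI[where x = "[:c:]" for c])
  moreover have "a \<in> (\<lambda>p. poly p a) ` ?S"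
    using R by (intro image_eqI[of _ _ "[:0, 1:]"])
      (auto simp: polys_over_def coeff_pCons subring_set_0 subring_setD(1) split: nat.splits)
  moreover have "D' x = D x" if "x \<in> R" for x
    using D'(2)[OF const[OF that]] by (simp add: \<delta>_def map_poly_pCons derivation_on_0[OF R D])
  ultimately show ?thesis
    using D'(1) by blast
qed

lemma extend_derivation:
  fixes A :: "'a::field set"
  assumes char0: "\<And>k. k > 0 \<Longrightarrow> of_nat k \<noteq> (0 :: 'a)"
    and "subring_set R" "derivation_on R D" "finite A"
  shows "\<exists>R' D'. subring_set R' \<and> derivation_on R' D' \<and> R \<subseteq> R' \<and> A \<subseteq> R' \<and> (\<forall>x\<in>R. D' x = D x)"
  using assms(4)
proof induction
  case empty
  then show ?case using assms by blast
next
  case (insert a A)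
  then obtain R1 D1 where 1: "subring_set R1" "derivation_on R1 D1" "R \<subseteq> R1" "A \<subseteq> R1" "\<forall>x\<in>R. D1 x = D x"
    by blast
  obtain R2 D2 where 2: "subring_set R2" "derivation_on R2 D2" "R1 \<subseteq> R2" "a \<in> R2" "\<forall>x\<in>R1. D2 x = D1 x"
    using extend_derivation_one[OF char0 1(1,2)] by blast
  have "\<forall>x\<in>R. D2 x = D x"
    using 1 2 by (simp add: subset_iff)
  then show ?case
    using 1 2 by (intro exI[of _ R2] exI[of _ D2]) auto
qed

section \<open>Polynomial relations and the image of the Jacobian\<close>

definition rf_const :: "rat \<Rightarrow> ratfun" where
  "rf_const c = Fract (mp_const c) 1"

abbreviation rf_eval :: "('v \<Rightarrow> ratfun) \<Rightarrow> ('v, rat) mpoly \<Rightarrow> ratfun" where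
  "rf_eval \<equiv> mp_eval rf_const"

lemma Fract_1_hom: "comm_semiring_hom (\<lambda>p. Fract p 1 :: 'a::idom fract)"
  by unfold_locales (simp_all add: fract_collapse)

lemma rf_const_hom: "comm_semiring_hom rf_const"
  by unfold_locales (simp_all add: rf_const_def fract_collapse mp_const_add mp_const_mult)

interpretation rf: comm_semiring_hom rf_const
  by (rule rf_const_hom)

lemma mp_eval_generic: "mp_eval mp_const mp_var p = p"
proof -
  interpret comm_semiring_hom mp_const by (rule mp_const_hom)
  have "mp_vars p \<subseteq> UNIV" by simp
  then show ?thesis
    by (induction p rule: mp_vars_induct) (simp_all add: mp_eval_const mp_eval_var mp_eval_add mp_eval_mult)
qed

lemma rf_eval_generic: "rf_eval (\<lambda>j. Fract (mp_var j) 1) p = Fract p 1"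
  using mp_eval_mp_eval[OF mp_const_hom rf_const_hom Fract_1_hom, of p UNIV mp_var "\<lambda>j. Fract (mp_var j) 1"]
  by (simp add: mp_eval_generic rf_const_def)

lemma fract_char_0: "k > 0 \<Longrightarrow> of_nat k \<noteq> (0 :: ratfun)"
proof -
  assume k: "k > 0"
  have "of_nat k = (mp_const (of_nat k) :: (nat, rat) mpoly)"
    by (induction k) (simp_all add: mp_const_add)
  then have "of_nat k \<noteq> (0 :: (nat, rat) mpoly)"
    using k by (simp add: mp_const_def)
  then show ?thesis
    by (simp add: of_nat_fract Zero_fract_def eq_fract)
qed

text \<open>
  A derivation that is zero on the constants is determined by its values on the variables: by the
  chain rule on polynomials, and by applying it to \<open>b f = a\<close> on a fraction \<open>f = a / b\<close>.
\<close>

lemma rf_derivation_chain_rule: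
  assumes R: "subring_set R" "derivation_on R D"
    and c: "\<And>c. rf_const c \<in> R" "\<And>c. D (rf_const c) = 0"
    and x: "\<And>j. j < m \<Longrightarrow> Fract (mp_var j) 1 \<in> R"
    and f: "f \<in> rat_functions m" "f \<in> R"
  shows "D f = (\<Sum>j<m. rf_pderiv j f * D (Fract (mp_var j) 1))"
proof -
  let ?x = "\<lambda>j. Fract (mp_var j) 1 :: ratfun"
  obtain a b where ab: "f = Fract a b" "a \<in> polys_in m" "b \<in> polys_in m" "b \<noteq> 0"
    using f(1) by (auto simp: rat_functions_def)
  have poly: "Fract p 1 \<in> R" "D (Fract p 1) = (\<Sum>j<m. Fract (mp_pderiv j p) 1 * D (?x j))"
    if "p \<in> polys_in m" for p
  proof -
    have p: "mp_vars p \<subseteq> {..<m}" using that by (simp add: polys_in_def)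
    show "Fract p 1 \<in> R"
      using mp_eval_in_subring[OF rf_const_hom R(1) p c(1), of ?x] x by (simp add: rf_eval_generic)
    show "D (Fract p 1) = (\<Sum>j<m. Fract (mp_pderiv j p) 1 * D (?x j))"
      using derivation_mp_eval[OF rf_const_hom R p finite_lessThan c, of ?x] x
      by (simp add: rf_eval_generic)
  qed
  define A B where "A = (Fract a 1 :: ratfun)" and "B = (Fract b 1 :: ratfun)"
  define A' B' where "A' j = (Fract (mp_pderiv j a) 1 :: ratfun)" and "B' j = (Fract (mp_pderiv j b) 1 :: ratfun)" for j
  have B: "B \<noteq> 0"
    using ab(4) by (simp add: B_def Zero_fract_def eq_fract)
  have AB: "A = B * f"
    using ab(4) by (simp add: A_def B_def ab(1) eq_fract)
  have pd: "rf_pderiv j f = (A' j * B - A * B' j) / (B * B)" for j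
    unfolding ab(1) rf_pderiv_Fract[OF ab(4)] A_def B_def A'_def B'_def by simp
  have "D A = D B * f + B * D f"
    unfolding AB by (rule derivation_onD(2)[OF R(2)]) (simp_all add: B_def poly(1) ab(3) f(2))
  then have "D f = (D A - D B * f) / B"
    using B by (simp add: eq_divide_eq algebra_simps)
  also have "\<dots> = (\<Sum>j<m. (A' j * D (?x j) - B' j * D (?x j) * f) / B)"
    using ab by (simp add: A_def B_def A'_def B'_def poly sum_subtractf sum_distrib_right flip: sum_divide_distrib)
  also have "\<dots> = (\<Sum>j<m. rf_pderiv j f * D (?x j))"
    unfolding pd AB using B by (intro sum.cong refl) (simp add: field_simps)
  finally show ?thesis .
qed

lemma rf_pderiv_derivation: "derivation_on UNIV (rf_pderiv j)"
proof -
  have "rf_pderiv j (x + y) = rf_pderiv j x + rf_pderiv j y \<and>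
      rf_pderiv j (x * y) = rf_pderiv j x * y + x * rf_pderiv j y" for x y
  proof -
    obtain a b c d where x: "x = Fract a b" "b \<noteq> 0" and y: "y = Fract c d" "d \<noteq> 0"
      by (metis Fract_cases)
    show ?thesis
      using x y by (simp add: rf_pderiv_Fract mp_pderiv_add mp_pderiv_mult eq_fract algebra_simps)
  qed
  then show ?thesis by (simp add: derivation_on_def)
qed

lemma rf_pderiv_const: "rf_pderiv j (rf_const c) = 0"
  unfolding rf_const_def using mp_pderiv_const[of j "1 :: rat"]
  by (subst rf_pderiv_Fract) (simp_all add: fract_collapse)

text \<open>
  The tangent space of the closed image at its generic point \<open>q\<close> is the image of the Jacobian.  The
  vector \<open>v\<close> is tangent if it annihilates the differentials of all relations \<open>P(q) = 0\<close>, that is, if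
  \<open>q\<^sub>i \<mapsto> v\<^sub>i\<close> defines a derivation on \<open>\<rat>[q]\<close>; its extension to the variables \<open>x\<^sub>j\<close> provides the
  coefficients \<open>w\<^sub>j\<close>.
\<close>

theorem jacobian_image_iff_annihilates_relations:
  fixes q v :: "nat \<Rightarrow> ratfun"
  assumes q: "\<And>i. i < n \<Longrightarrow> q i \<in> rat_functions m"
  shows "(\<exists>w. \<forall>i<n. v i = (\<Sum>j<m. rf_pderiv j (q i) * w j)) \<longleftrightarrow>
    (\<forall>P. mp_vars P \<subseteq> {..<n} \<longrightarrow> rf_eval q P = 0 \<longrightarrow>
       (\<Sum>i<n. rf_eval q (mp_pderiv i P) * v i) = 0)"
proof (intro iffI allI impI)
  fix P :: "(nat, rat) mpoly"
  assume "\<exists>w. \<forall>i<n. v i = (\<Sum>j<m. rf_pderiv j (q i) * w j)"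
  then obtain w where w: "\<And>i. i < n \<Longrightarrow> v i = (\<Sum>j<m. rf_pderiv j (q i) * w j)" by blast
  assume P: "mp_vars P \<subseteq> {..<n}" "rf_eval q P = 0"
  have zero: "(\<Sum>i<n. rf_eval q (mp_pderiv i P) * rf_pderiv j (q i)) = 0" for j
    using derivation_mp_eval[OF rf_const_hom _ rf_pderiv_derivation P(1) finite_lessThan, of j q]
      P(2) derivation_on_0[OF _ rf_pderiv_derivation]
    by (simp add: rf_pderiv_const subring_set_def)
  have "(\<Sum>i<n. rf_eval q (mp_pderiv i P) * v i)
      = (\<Sum>i<n. \<Sum>j<m. rf_eval q (mp_pderiv i P) * rf_pderiv j (q i) * w j)"
    by (intro sum.cong refl) (simp add: w sum_distrib_left mult_ac)
  also have "\<dots> = (\<Sum>j<m. (\<Sum>i<n. rf_eval q (mp_pderiv i P) * rf_pderiv j (q i)) * w j)"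
    by (subst sum.swap) (simp add: sum_distrib_right)
  finally show "(\<Sum>i<n. rf_eval q (mp_pderiv i P) * v i) = 0"
    by (simp add: zero)
next
  assume ann: "\<forall>P. mp_vars P \<subseteq> {..<n} \<longrightarrow> rf_eval q P = 0 \<longrightarrow>
       (\<Sum>i<n. rf_eval q (mp_pderiv i P) * v i) = 0"
  let ?S = "{P :: (nat, rat) mpoly. mp_vars P \<subseteq> {..<n}}"
  define \<delta> where "\<delta> P = (\<Sum>i<n. rf_eval q (mp_pderiv i P) * v i)" for P
  have S: "subring_set ?S"
    by (simp add: subring_set_def mp_vars_add mp_vars_mult)
  obtain D where D: "derivation_on (rf_eval q ` ?S) D" "\<And>P. P \<in> ?S \<Longrightarrow> D (rf_eval q P) = \<delta> P"
  proof -
    have "\<exists>D. derivation_on (rf_eval q ` ?S) D \<and> (\<forall>P\<in>?S. D (rf_eval q P) = \<delta> P)"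
    proof (rule derivation_descends[OF S])
      show "\<delta> (P * Q) = \<delta> P * rf_eval q Q + rf_eval q P * \<delta> Q" for P Q
        by (simp add: \<delta>_def mp_pderiv_mult rf.mp_eval_add rf.mp_eval_mult distrib_right distrib_left
            sum.distrib sum_distrib_left sum_distrib_right mult_ac)
      show "\<delta> (P + Q) = \<delta> P + \<delta> Q" for P Q
        by (simp add: \<delta>_def mp_pderiv_add rf.mp_eval_add distrib_right sum.distrib)
      show "\<delta> P = 0" if "P \<in> ?S" "rf_eval q P = 0" for P
        using ann that by (simp add: \<delta>_def)
    qed (simp_all add: rf.mp_eval_add rf.mp_eval_mult)
    then show ?thesis using that by blast
  qed
  have R: "subring_set (rf_eval q ` ?S)"
    unfolding subring_set_def
  proof (intro conjI ballI)
    show "1 \<in> rf_eval q ` ?S"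
      using mp_eval_const[of rf_const q 1] by (intro image_eqI[of _ _ 1]) auto
    fix x y assume "x \<in> rf_eval q ` ?S" "y \<in> rf_eval q ` ?S"
    then obtain P Q where PQ: "x = rf_eval q P" "y = rf_eval q Q" "P \<in> ?S" "Q \<in> ?S" by blast
    show "x + y \<in> rf_eval q ` ?S"
      using PQ subring_setD(2)[OF S] by (intro image_eqI[of _ _ "P + Q"]) (simp_all add: rf.mp_eval_add)
    show "x * y \<in> rf_eval q ` ?S"
      using PQ subring_setD(3)[OF S] by (intro image_eqI[of _ _ "P * Q"]) (simp_all add: rf.mp_eval_mult)
  next
    fix x assume "x \<in> rf_eval q ` ?S"
    then obtain P where "x = rf_eval q P" "P \<in> ?S" by blast
    then show "- x \<in> rf_eval q ` ?S"
      using subring_setD(4)[OF S]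
      by (intro image_eqI[of _ _ "- P"]) (simp_all add: mp_eval_uminus[OF rf_const_hom])
  qed
  obtain R' D' where R': "subring_set R'" "derivation_on R' D'" "rf_eval q ` ?S \<subseteq> R'"
    "(\<lambda>j. Fract (mp_var j) 1) ` {..<m} \<subseteq> R'" "\<forall>x\<in>rf_eval q ` ?S. D' x = D x"
    using extend_derivation[OF fract_char_0 R D(1), of "(\<lambda>j. Fract (mp_var j) 1) ` {..<m}"] by blast
  have on: "rf_eval q P \<in> R'" "D' (rf_eval q P) = \<delta> P" if "mp_vars P \<subseteq> {..<n}" for P
    using R'(3,5) D(2) that by auto
  have const: "rf_const c \<in> R'" "D' (rf_const c) = 0" for c
    using on[of "mp_const c"] by (simp_all add: mp_eval_const \<delta>_def)
  have "v i = (\<Sum>j<m. rf_pderiv j (q i) * D' (Fract (mp_var j) 1))" if i: "i < n" for i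
  proof -
    have qi: "q i \<in> R'" "D' (q i) = \<delta> (mp_var i)"
      using on[of "mp_var i"] i by (simp_all add: mp_eval_var)
    have "\<delta> (mp_var i) = (\<Sum>k<n. if k = i then v k else 0)"
      unfolding \<delta>_def using mp_eval_const[of rf_const q 1]
      by (intro sum.cong) (auto simp: mp_pderiv_var)
    then have "v i = D' (q i)"
      using i by (simp add: qi)
    also have "\<dots> = (\<Sum>j<m. rf_pderiv j (q i) * D' (Fract (mp_var j) 1))"
      using R'(4) by (intro rf_derivation_chain_rule[OF R'(1,2) const _ q[OF i] qi(1)]) auto
    finally show ?thesis .
  qed
  then show "\<exists>w. \<forall>i<n. v i = (\<Sum>j<m. rf_pderiv j (q i) * w j)"
    by (intro exI[of _ "\<lambda>j. D' (Fract (mp_var j) 1)"]) simp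
qed

section \<open>Values of rational functions at rational points\<close>

text \<open>
  Splitting off one variable reduces statements on zeros to univariate polynomials.
\<close>

lemma as_univariate_poly:
  fixes p :: "(nat, 'a::idom) mpoly"
  assumes "mp_vars p \<subseteq> insert v V"
  shows "\<exists>P. p = poly P (mp_var v) \<and> (\<forall>k. mp_vars (coeff P k) \<subseteq> V)"
  using assms
proof (induction p rule: mp_vars_induct)
  case (const c)
  show ?case
    by (rule exI[of _ "[:mp_const c:]"]) (auto simp: coeff_pCons split: nat.splits)
next
  case (var w)
  show ?case
  proof (cases "w = v")
    case True
    then show ?thesis
      by (intro exI[of _ "[:0, 1:]"]) (auto simp: coeff_pCons split: nat.splits)
  next
    case False
    then show ?thesis
      using var by (intro exI[of _ "[:mp_var w:]"]) (auto simp: coeff_pCons split: nat.splits)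
  qed
next
  case (add p q)
  then obtain P Q where "p = poly P (mp_var v)" "\<forall>k. mp_vars (coeff P k) \<subseteq> V"
    "q = poly Q (mp_var v)" "\<forall>k. mp_vars (coeff Q k) \<subseteq> V" by blast
  then show ?case
    by (intro exI[of _ "P + Q"]) (simp add: mp_vars_add)
next
  case (mult p q)
  then obtain P Q where PQ: "p = poly P (mp_var v)" "\<forall>k. mp_vars (coeff P k) \<subseteq> V"
    "q = poly Q (mp_var v)" "\<forall>k. mp_vars (coeff Q k) \<subseteq> V" by blast
  have "mp_vars (coeff (P * Q) k) \<subseteq> V" for k
    unfolding coeff_mult by (intro mp_vars_sum mp_vars_mult) (use PQ in auto)
  then show ?case
    using PQ by (intro exI[of _ "P * Q"]) simp
qed

lemma hom_poly:
  assumes "comm_semiring_hom h"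
  shows "h (poly P x) = poly (map_poly h P) (h x)"
proof -
  interpret comm_semiring_hom h by fact
  show ?thesis
    by (induction P) (simp_all add: map_poly_pCons hom_add hom_mult)
qed

lemma nonzero_mpoly_nonvanishing_point:
  fixes p :: "(nat, 'a::field_char_0) mpoly"
  assumes "finite V" "mp_vars p \<subseteq> V" "p \<noteq> 0"
  shows "\<exists>\<alpha>. mp_value \<alpha> p \<noteq> 0"
  using assms
proof (induction V arbitrary: p rule: finite_induct)
  case empty
  have "\<exists>c. p = mp_const c"
    using empty.prems(1)
  proof (induction p rule: mp_vars_induct)
    case (add p q)
    then show ?case by (metis mp_const_add)
  next
    case (mult p q)
    then show ?case by (metis mp_const_mult)
  qed auto
  then show ?case
    using empty.prems(2) by (auto simp: mp_eval_const)
next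
  case (insert v V)
  obtain P where P: "p = poly P (mp_var v)" "\<And>k. mp_vars (coeff P k) \<subseteq> V"
    using as_univariate_poly[OF insert.prems(1)] by blast
  have "lead_coeff P \<noteq> 0"
    using insert.prems(2) P(1) by auto
  then obtain \<alpha> where \<alpha>: "mp_value \<alpha> (lead_coeff P) \<noteq> 0"
    using insert.IH P(2) by blast
  let ?R = "map_poly (mp_value \<alpha>) P"
  have R: "?R \<noteq> 0"
    using \<alpha> by (auto simp: poly_eq_iff coeff_map_poly)
  obtain t where t: "poly ?R t \<noteq> 0"
    using poly_roots_finite[OF R] ex_new_if_finite[OF infinite_UNIV_char_0] by blast
  define \<alpha>' where "\<alpha>' = \<alpha>(v := t)"
  have "map_poly (mp_value \<alpha>') P = ?R"
  proof (rule poly_eqI)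
    fix k
    have "v \<notin> mp_vars (coeff P k)" using P(2) insert.hyps by blast
    then show "coeff (map_poly (mp_value \<alpha>') P) k = coeff ?R k"
      unfolding \<alpha>'_def by (simp add: coeff_map_poly) (intro mp_eval_cong, auto)
  qed
  then have "mp_value \<alpha>' p = poly ?R t"
    unfolding P(1) hom_poly[OF comm_semiring_hom.mp_eval_hom[OF ident_hom]]
    by (simp add: mp_eval_var \<alpha>'_def)
  then show ?case using t by (intro exI[of _ \<alpha>']) simp
qed

lemma polys_in_closed:
  "mp_const c \<in> polys_in m" "0 \<in> polys_in m" "1 \<in> polys_in m"
  "p \<in> polys_in m \<Longrightarrow> q \<in> polys_in m \<Longrightarrow> p + q \<in> polys_in m"
  "p \<in> polys_in m \<Longrightarrow> q \<in> polys_in m \<Longrightarrow> p * q \<in> polys_in m"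
  "p \<in> polys_in m \<Longrightarrow> - p \<in> polys_in m"
  "p \<in> polys_in m \<Longrightarrow> mp_pderiv v p \<in> polys_in m"
  by (simp_all add: polys_in_def mp_vars_add mp_vars_mult mp_vars_pderiv)

lemma rat_functionsI: "a \<in> polys_in m \<Longrightarrow> b \<in> polys_in m \<Longrightarrow> b \<noteq> 0 \<Longrightarrow> Fract a b \<in> rat_functions m"
  by (auto simp: rat_functions_def)

lemma rat_functionsE:
  assumes "f \<in> rat_functions m"
  obtains a b where "f = Fract a b" "a \<in> polys_in m" "b \<in> polys_in m" "b \<noteq> 0"
  using assms by (auto simp: rat_functions_def)

lemma subring_rat_functions: "subring_set (rat_functions m)"
  unfolding subring_set_def
proof (intro conjI ballI)
  show "1 \<in> rat_functions m"
    by (simp add: One_fract_def rat_functionsI polys_in_closed)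
  fix f g assume "f \<in> rat_functions m" "g \<in> rat_functions m"
  then obtain a b c d where "f = Fract a b" "a \<in> polys_in m" "b \<in> polys_in m" "b \<noteq> 0"
    "g = Fract c d" "c \<in> polys_in m" "d \<in> polys_in m" "d \<noteq> 0"
    by (elim rat_functionsE)
  then show "f + g \<in> rat_functions m" "f * g \<in> rat_functions m"
    by (simp_all add: rat_functionsI polys_in_closed)
next
  fix f assume "f \<in> rat_functions m"
  then obtain a b where "f = Fract a b" "a \<in> polys_in m" "b \<in> polys_in m" "b \<noteq> 0"
    by (elim rat_functionsE)
  then show "- f \<in> rat_functions m"
    by (simp add: rat_functionsI polys_in_closed)
qed

lemma rf_const_in: "rf_const c \<in> rat_functions m"
  by (simp add: rf_const_def rat_functionsI polys_in_closed)

lemma rf_pderiv_in: "f \<in> rat_functions m \<Longrightarrow> rf_pderiv j f \<in> rat_functions m"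
proof (elim rat_functionsE)
  fix a b assume "f = Fract a b" "a \<in> polys_in m" "b \<in> polys_in m" "b \<noteq> 0"
  then show "rf_pderiv j f \<in> rat_functions m"
    unfolding diff_conv_add_uminus
    by (simp add: rf_pderiv_Fract diff_conv_add_uminus rat_functionsI polys_in_closed del: add_uminus_conv_diff)
qed

lemma mp_eval_of_rat_add: "mp_eval of_rat \<alpha> (p + q) = mp_eval of_rat \<alpha> p + (mp_eval of_rat \<alpha> q :: complex)"
  by (rule comm_semiring_hom.mp_eval_add[OF of_rat_semiring_hom])

lemma mp_eval_of_rat_mult: "mp_eval of_rat \<alpha> (p * q) = mp_eval of_rat \<alpha> p * (mp_eval of_rat \<alpha> q :: complex)"
  by (rule comm_semiring_hom.mp_eval_mult[OF of_rat_semiring_hom])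

lemma rf_value_const: "rf_value m (rf_const c) x (of_rat c)"
  unfolding rf_value_def rf_const_def
  using mp_eval_const[of "of_rat :: rat \<Rightarrow> complex" "($) x" 1]
  by (intro bexI[of _ "mp_const c"] bexI[of _ 1]) (simp_all add: polys_in_closed mp_eval_const)

lemma rf_value_add:
  assumes "rf_value m f x y" "rf_value m g x z"
  shows "rf_value m (f + g) x (y + z)"
proof -
  obtain a b c d where f: "f = Fract a b" "a \<in> polys_in m" "b \<in> polys_in m" "mp_eval of_rat (($) x) b \<noteq> 0"
      "y = mp_eval of_rat (($) x) a / mp_eval of_rat (($) x) b"
    and g: "g = Fract c d" "c \<in> polys_in m" "d \<in> polys_in m" "mp_eval of_rat (($) x) d \<noteq> 0"
      "z = mp_eval of_rat (($) x) c / mp_eval of_rat (($) x) d"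
    using assms by (auto simp: rf_value_def)
  have "b \<noteq> 0" "d \<noteq> 0" using f(4) g(4) by auto
  then show ?thesis
    unfolding rf_value_def using f g
    by (intro bexI[of _ "a * d + c * b"] bexI[of _ "b * d"])
      (simp_all add: polys_in_closed mp_eval_of_rat_add mp_eval_of_rat_mult add_frac_eq)
qed

lemma rf_value_mult:
  assumes "rf_value m f x y" "rf_value m g x z"
  shows "rf_value m (f * g) x (y * z)"
proof -
  obtain a b c d where f: "f = Fract a b" "a \<in> polys_in m" "b \<in> polys_in m" "mp_eval of_rat (($) x) b \<noteq> 0"
      "y = mp_eval of_rat (($) x) a / mp_eval of_rat (($) x) b"
    and g: "g = Fract c d" "c \<in> polys_in m" "d \<in> polys_in m" "mp_eval of_rat (($) x) d \<noteq> 0"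
      "z = mp_eval of_rat (($) x) c / mp_eval of_rat (($) x) d"
    using assms by (auto simp: rf_value_def)
  then show ?thesis
    unfolding rf_value_def
    by (intro bexI[of _ "a * c"] bexI[of _ "b * d"])
      (simp_all add: polys_in_closed mp_eval_of_rat_mult)
qed

lemma rf_value_0: "rf_value m 0 x y \<Longrightarrow> y = 0"
proof -
  assume "rf_value m 0 x y"
  then obtain a b where ab: "0 = Fract a b" "mp_eval of_rat (($) x) b \<noteq> 0"
    "y = mp_eval of_rat (($) x) a / mp_eval of_rat (($) x) b"
    by (auto simp: rf_value_def)
  have "b \<noteq> 0" using ab(2) by auto
  then have "a = 0" using ab(1) by (simp add: Zero_fract_def eq_fract)
  then show "y = 0" using ab(3) by simp
qed

text \<open>
  Different fractions for \<open>f\<close> could a priori give different values at \<open>x\<close>; the difference is a value of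
  the zero function.
\<close>

lemma rf_value_unique:
  assumes "rf_value m f x y" "rf_value m f x z"
  shows "y = z"
proof -
  have "rf_value m (f + rf_const (- 1) * f) x (y + of_rat (- 1) * z)"
    by (intro rf_value_add rf_value_mult rf_value_const assms)
  moreover have "1 + rf_const (- 1) = rf_const (1 + - 1)"
    using rf.hom_add[of 1 "- 1"] by simp
  then have "1 + rf_const (- 1) = 0" by simp
  then have "(1 + rf_const (- 1)) * f = 0" by simp
  then have "f + rf_const (- 1) * f = 0" by (simp add: distrib_right)
  ultimately show ?thesis
    using rf_value_0 by (fastforce simp: of_rat_minus)
qed

lemma rf_value_rf_eval:
  assumes "\<And>i. i \<in> V \<Longrightarrow> rf_value m (q i) x (y i)" "mp_vars P \<subseteq> V"
  shows "rf_value m (rf_eval q P) x (mp_eval of_rat y P)"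
  using assms(2)
proof (induction P rule: mp_vars_induct)
  case (const c)
  show ?case by (simp add: mp_eval_const rf_value_const)
next
  case (var v)
  then show ?case by (simp add: mp_eval_var assms(1))
next
  case (add P Q)
  then show ?case by (simp add: rf.mp_eval_add mp_eval_of_rat_add rf_value_add)
next
  case (mult P Q)
  then show ?case by (simp add: rf.mp_eval_mult mp_eval_of_rat_mult rf_value_mult)
qed

lemma relation_vanishes_on_image:
  assumes "rf_eval (($) \<phi>) P = 0" "mp_vars P \<subseteq> {..<n}" "y \<in> rat_map_image m n \<phi>"
  shows "mp_eval of_rat (($) y) P = 0"
proof -
  obtain x where "\<And>i. i < n \<Longrightarrow> rf_value m (\<phi> $ i) x (y $ i)"
    using assms(3) by (auto simp: rat_map_image_def)
  then have "rf_value m (rf_eval (($) \<phi>) P) x (mp_eval of_rat (($) y) P)"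
    by (intro rf_value_rf_eval[OF _ assms(2)]) auto
  then show ?thesis using assms(1) rf_value_0 by simp
qed

text \<open>
  The point is the image of a rational point at which neither the numerator of \<open>P(\<phi>)\<close> nor any of the
  denominators vanishes; it exists because the product of these polynomials is not zero.
\<close>

lemma nonrelation_nonzero_at_rational_point:
  assumes \<phi>: "\<And>i. i < n \<Longrightarrow> \<phi> $ i \<in> rat_functions m"
    and P: "rf_eval (($) \<phi>) P \<noteq> 0" "mp_vars P \<subseteq> {..<n}"
  shows "\<exists>y. vec n (\<lambda>i. of_rat (y i)) \<in> rat_map_image m n \<phi> \<and> mp_value y P \<noteq> 0"
proof -
  have "\<forall>i\<in>{..<n}. \<exists>a b. \<phi> $ i = Fract a b \<and> a \<in> polys_in m \<and> b \<in> polys_in m \<and> b \<noteq> 0"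
    using \<phi> by (auto simp: rat_functions_def)
  then obtain a b where ab: "\<And>i. i < n \<Longrightarrow> \<phi> $ i = Fract (a i) (b i)" "\<And>i. i < n \<Longrightarrow> a i \<in> polys_in m"
    "\<And>i. i < n \<Longrightarrow> b i \<in> polys_in m" "\<And>i. i < n \<Longrightarrow> b i \<noteq> 0"
    by (metis lessThan_iff)
  have "rf_eval (($) \<phi>) P \<in> rat_functions m"
    using mp_eval_in_subring[OF rf_const_hom subring_rat_functions P(2) rf_const_in] \<phi> by auto
  then obtain c d where cd: "rf_eval (($) \<phi>) P = Fract c d" "c \<in> polys_in m" "d \<in> polys_in m" "d \<noteq> 0"
    by (elim rat_functionsE)
  define h where "h = c * d * (\<Prod>i<n. b i)"
  have "c \<noteq> 0" using P(1) cd by (auto simp: Zero_fract_def eq_fract)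
  then have "h \<noteq> 0" using cd ab(4) by (simp add: h_def)
  moreover have "mp_vars h \<subseteq> {..<m}"
    unfolding h_def by (intro mp_vars_mult mp_vars_prod) (use cd ab in \<open>auto simp: polys_in_def\<close>)
  ultimately obtain \<alpha> where \<alpha>: "mp_value \<alpha> h \<noteq> 0"
    using nonzero_mpoly_nonvanishing_point[of "{..<m}" h] by blast
  define x where "x = vec m (\<lambda>j. of_rat (\<alpha> j) :: complex)"
  have ev: "mp_eval of_rat (($) x) p = of_rat (mp_value \<alpha> p)" if "p \<in> polys_in m" for p
    by (rule mp_eval_mp_eval[OF ident_hom of_rat_semiring_hom of_rat_semiring_hom,
          symmetric, of p "{..<m}"]) (use that in \<open>auto simp: x_def polys_in_def\<close>)
  have nz: "mp_value \<alpha> c \<noteq> 0" "mp_value \<alpha> d \<noteq> 0" "(\<And>i. i < n \<Longrightarrow> mp_value \<alpha> (b i) \<noteq> 0)"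
  proof -
    have "mp_value \<alpha> h = mp_value \<alpha> c * mp_value \<alpha> d * mp_value \<alpha> (\<Prod>i<n. b i)"
      by (simp only: h_def mp_eval_id_mult)
    with \<alpha> show "mp_value \<alpha> c \<noteq> 0" "mp_value \<alpha> d \<noteq> 0" by auto
    fix i assume "i < n"
    then have "(\<Prod>i<n. b i) = b i * (\<Prod>i\<in>{..<n} - {i}. b i)"
      by (intro prod.remove) auto
    then have "mp_value \<alpha> h = mp_value \<alpha> (c * d * (\<Prod>i\<in>{..<n} - {i}. b i)) * mp_value \<alpha> (b i)"
      unfolding h_def by (simp add: mp_eval_id_mult[symmetric] mult_ac)
    with \<alpha> show "mp_value \<alpha> (b i) \<noteq> 0" by auto
  qed
  define y where "y i = mp_value \<alpha> (a i) / mp_value \<alpha> (b i)" for i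
  have val: "rf_value m (\<phi> $ i) x (of_rat (y i))" if "i < n" for i
    unfolding rf_value_def using ab that nz(3)
    by (intro bexI[of _ "a i"] bexI[of _ "b i"]) (simp_all add: ev y_def of_rat_divide)
  have "rf_value m (rf_eval (($) \<phi>) P) x (mp_eval of_rat (\<lambda>i. of_rat (y i)) P)"
    by (intro rf_value_rf_eval[OF _ P(2)]) (use val in auto)
  moreover have "rf_value m (rf_eval (($) \<phi>) P) x (of_rat (mp_value \<alpha> c / mp_value \<alpha> d))"
    unfolding rf_value_def using cd nz
    by (intro bexI[of _ c] bexI[of _ d]) (simp_all add: ev of_rat_divide)
  moreover have "mp_eval of_rat (\<lambda>i. of_rat (y i) :: complex) P = of_rat (mp_value y P)"
    by (rule mp_eval_mp_eval[OF ident_hom of_rat_semiring_hom of_rat_semiring_hom,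
          symmetric, of P UNIV]) auto
  ultimately have "(of_rat (mp_value y P) :: complex) = of_rat (mp_value \<alpha> c / mp_value \<alpha> d)"
    using rf_value_unique by metis
  then have "mp_value y P \<noteq> 0"
    using nz by simp
  moreover have "vec n (\<lambda>i. of_rat (y i)) \<in> rat_map_image m n \<phi>"
    unfolding rat_map_image_def using val by (auto simp: x_def intro!: bexI[of _ x])
  ultimately show ?thesis by blast
qed

section \<open>Bordered minors and column spaces\<close>

lemma bij_betw_pick:
  assumes "finite S"
  shows "bij_betw (pick S) {..<card S} S"
proof -
  have "pick S ` {..<card S} = S"
  proof
    show "pick S ` {..<card S} \<subseteq> S"
      using pick_in_set_le by auto
    show "S \<subseteq> pick S ` {..<card S}"
    proof
      fix i assume i: "i \<in> S"
      have "card {a\<in>S. a < i} < card S"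
        using assms i by (intro psubset_card_mono) auto
      then show "i \<in> pick S ` {..<card S}"
        using pick_card_in_set[OF i] by (intro image_eqI[of _ _ "card {a\<in>S. a < i}"]) auto
    qed
  qed
  then show ?thesis
    by (metis bij_betw_def card_lessThan eq_card_imp_inj_on finite_lessThan)
qed

lemma submatrix_carrier_index:
  assumes A: "A \<in> carrier_mat nr nc" and I: "I \<subseteq> {..<nr}" "S \<subseteq> {..<nc}"
  shows "submatrix A I S \<in> carrier_mat (card I) (card S)"
    "\<And>i j. i < card I \<Longrightarrow> j < card S \<Longrightarrow> submatrix A I S $$ (i, j) = A $$ (pick I i, pick S j)"
proof -
  have eq: "{i. i < dim_row A \<and> i \<in> I} = I" "{j. j < dim_col A \<and> j \<in> S} = S"
    using A I by auto
  show "submatrix A I S \<in> carrier_mat (card I) (card S)"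
    using dim_submatrix[of A I S] unfolding eq by (auto intro: carrier_matI)
  show "submatrix A I S $$ (i, j) = A $$ (pick I i, pick S j)" if "i < card I" "j < card S" for i j
    using submatrix_index[of i A I j S] that unfolding eq by simp
qed

lemma submatrix_mult_vec_index:
  assumes A: "A \<in> carrier_mat nr nc" and I: "I \<subseteq> {..<nr}" "S \<subseteq> {..<nc}" and i: "i < card I"
  shows "(submatrix A I S *\<^sub>v vec (card S) (\<lambda>j. x (pick S j))) $ i = (\<Sum>s\<in>S. A $$ (pick I i, s) * x s)"
proof -
  have fin: "finite S" using I(2) finite_subset by blast
  have "(submatrix A I S *\<^sub>v vec (card S) (\<lambda>j. x (pick S j))) $ i
      = (\<Sum>j<card S. A $$ (pick I i, pick S j) * x (pick S j))"
    using submatrix_carrier_index[OF A I] i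
    by (auto simp: scalar_prod_def lessThan_atLeast0 intro!: sum.cong)
  also have "\<dots> = (\<Sum>s\<in>S. A $$ (pick I i, s) * x s)"
    by (rule sum.reindex_bij_betw[OF bij_betw_pick[OF fin]])
  finally show ?thesis .
qed

text \<open>
  A description of nonzero minors that is free of the order-preserving enumerations of rows and
  columns in \<^const>\<open>submatrix\<close>: the rows and columns can be addressed by their original indices.
\<close>

lemma det_submatrix_nonzero_iff:
  fixes A :: "'a::field mat"
  assumes A: "A \<in> carrier_mat nr nc" and I: "I \<subseteq> {..<nr}" "S \<subseteq> {..<nc}" "card I = card S"
  shows "det (submatrix A I S) \<noteq> 0 \<longleftrightarrow>
    (\<forall>x. (\<forall>i\<in>I. (\<Sum>s\<in>S. A $$ (i, s) * x s) = 0) \<longrightarrow> (\<forall>s\<in>S. x s = 0))"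
proof -
  have fin: "finite I" "finite S" using I finite_subset by blast+
  note N = submatrix_carrier_index[OF A I(1,2)]
  note pI = bij_betw_imp_surj_on[OF bij_betw_pick[OF fin(1)]]
  note pS = bij_betw_imp_surj_on[OF bij_betw_pick[OF fin(2)]]
  have ker: "(submatrix A I S *\<^sub>v vec (card S) (\<lambda>j. x (pick S j)) = 0\<^sub>v (card I)) \<longleftrightarrow>
      (\<forall>i\<in>I. (\<Sum>s\<in>S. A $$ (i, s) * x s) = 0)" for x
  proof -
    have "(submatrix A I S *\<^sub>v vec (card S) (\<lambda>j. x (pick S j)) = 0\<^sub>v (card I)) \<longleftrightarrow>
        (\<forall>i<card I. (\<Sum>s\<in>S. A $$ (pick I i, s) * x s) = 0)"
      using N(1) submatrix_mult_vec_index[OF A I(1,2), of _ x] by (auto simp: vec_eq_iff)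
    also have "\<dots> \<longleftrightarrow> (\<forall>i\<in>pick I ` {..<card I}. (\<Sum>s\<in>S. A $$ (i, s) * x s) = 0)"
      by auto
    finally show ?thesis unfolding pI .
  qed
  have "det (submatrix A I S) = 0 \<longleftrightarrow>
      (\<exists>v. v \<in> carrier_vec (card S) \<and> v \<noteq> 0\<^sub>v (card S) \<and> submatrix A I S *\<^sub>v v = 0\<^sub>v (card S))"
    using det_0_iff_vec_prod_zero_field N(1) I(3) by metis
  also have "\<dots> \<longleftrightarrow> (\<exists>x. (\<forall>i\<in>I. (\<Sum>s\<in>S. A $$ (i, s) * x s) = 0) \<and> (\<exists>s\<in>S. x s \<noteq> 0))"
  proof
    assume "\<exists>v. v \<in> carrier_vec (card S) \<and> v \<noteq> 0\<^sub>v (card S) \<and> submatrix A I S *\<^sub>v v = 0\<^sub>v (card S)"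
    then obtain v where v: "v \<in> carrier_vec (card S)" "v \<noteq> 0\<^sub>v (card S)"
      "submatrix A I S *\<^sub>v v = 0\<^sub>v (card S)" by blast
    define x where "x s = v $ the_inv_into {..<card S} (pick S) s" for s
    have x: "x (pick S j) = v $ j" if "j < card S" for j
      using that bij_betw_pick[OF fin(2)] unfolding x_def bij_betw_def
      by (simp add: the_inv_into_f_f)
    have "vec (card S) (\<lambda>j. x (pick S j)) = v"
      using v(1) x by auto
    then have "\<forall>i\<in>I. (\<Sum>s\<in>S. A $$ (i, s) * x s) = 0"
      using ker[of x] v(3) I(3) by simp
    moreover obtain j where "j < card S" "v $ j \<noteq> 0"
      using v(1,2) by (auto simp: vec_eq_iff)
    then have "\<exists>s\<in>S. x s \<noteq> 0"
      using x pS by (intro bexI[of _ "pick S j"]) auto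
    ultimately show "\<exists>x. (\<forall>i\<in>I. (\<Sum>s\<in>S. A $$ (i, s) * x s) = 0) \<and> (\<exists>s\<in>S. x s \<noteq> 0)" by blast
  next
    assume "\<exists>x. (\<forall>i\<in>I. (\<Sum>s\<in>S. A $$ (i, s) * x s) = 0) \<and> (\<exists>s\<in>S. x s \<noteq> 0)"
    then obtain x s where x: "\<forall>i\<in>I. (\<Sum>s\<in>S. A $$ (i, s) * x s) = 0" "s \<in> S" "x s \<noteq> 0" by blast
    then obtain j where "j < card S" "s = pick S j" using pS by auto
    then have "vec (card S) (\<lambda>j. x (pick S j)) \<noteq> 0\<^sub>v (card S)"
      using x(3) by (auto simp: vec_eq_iff)
    then show "\<exists>v. v \<in> carrier_vec (card S) \<and> v \<noteq> 0\<^sub>v (card S) \<and> submatrix A I S *\<^sub>v v = 0\<^sub>v (card S)"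
      using ker[of x] x(1) I(3) by (intro exI[of _ "vec (card S) (\<lambda>j. x (pick S j))"]) simp
  qed
  finally show ?thesis by blast
qed

lemma submatrix_solve:
  fixes A :: "'a::field mat"
  assumes A: "A \<in> carrier_mat nr nc" and I: "I \<subseteq> {..<nr}" "S \<subseteq> {..<nc}" "card I = card S"
    and nz: "det (submatrix A I S) \<noteq> 0"
  obtains c where "\<And>i. i \<in> I \<Longrightarrow> (\<Sum>s\<in>S. A $$ (i, s) * c s) = y i"
proof -
  let ?N = "submatrix A I S"
  let ?k = "card S"
  have fin: "finite I" "finite S" using I finite_subset by blast+
  have N: "?N \<in> carrier_mat ?k ?k"
    using submatrix_carrier_index(1)[OF A I(1,2)] I(3) by simp
  define u where "u = vec ?k (\<lambda>a. y (pick I a))"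
  define w where "w = (1 / det ?N) \<cdot>\<^sub>v (adj_mat ?N *\<^sub>v u)"
  have u: "u \<in> carrier_vec ?k" by (simp add: u_def)
  have "?N *\<^sub>v w = (1 / det ?N) \<cdot>\<^sub>v (?N *\<^sub>v (adj_mat ?N *\<^sub>v u))"
    unfolding w_def using N adj_mat(1)[OF N] u by (intro mult_mat_vec) auto
  also have "?N *\<^sub>v (adj_mat ?N *\<^sub>v u) = (?N * adj_mat ?N) *\<^sub>v u"
    using N adj_mat(1)[OF N] u by (simp add: assoc_mult_mat_vec)
  also have "\<dots> = (det ?N \<cdot>\<^sub>m 1\<^sub>m ?k) *\<^sub>v u"
    using adj_mat(2)[OF N] by simp
  also have "\<dots> = det ?N \<cdot>\<^sub>v u"
  proof (rule eq_vecI)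
    fix i assume "i < dim_vec (det ?N \<cdot>\<^sub>v u)"
    then have i: "i < ?k" using u by simp
    then have "((det ?N \<cdot>\<^sub>m 1\<^sub>m ?k) *\<^sub>v u) $ i = (\<Sum>a = 0..<?k. det ?N * (if a = i then 1 else 0) * u $ a)"
      using u by (auto simp: scalar_prod_def)
    also have "\<dots> = (\<Sum>a = 0..<?k. if a = i then det ?N * u $ i else 0)"
      by (rule sum.cong) auto
    finally show "((det ?N \<cdot>\<^sub>m 1\<^sub>m ?k) *\<^sub>v u) $ i = (det ?N \<cdot>\<^sub>v u) $ i"
      using i u by simp
  qed (use u in simp)
  finally have Nw: "?N *\<^sub>v w = u"
    using nz u by (simp add: smult_smult_assoc)
  define c where "c s = w $ the_inv_into {..<?k} (pick S) s" for s
  have "vec ?k (\<lambda>j. c (pick S j)) = w"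
    using N adj_mat(1)[OF N] bij_betw_pick[OF fin(2)] unfolding c_def bij_betw_def
    by (auto simp: the_inv_into_f_f w_def)
  then have *: "(\<Sum>s\<in>S. A $$ (pick I a, s) * c s) = y (pick I a)" if "a < ?k" for a
    using submatrix_mult_vec_index[OF A I(1,2), of a c] that Nw I(3) by (simp add: u_def)
  show thesis
  proof (rule that)
    fix i assume "i \<in> I"
    then obtain a where "a < ?k" "i = pick I a"
      using bij_betw_imp_surj_on[OF bij_betw_pick[OF fin(1)]] I(3) by auto
    then show "(\<Sum>s\<in>S. A $$ (i, s) * c s) = y i" using * by simp
  qed
qed

text \<open>
  The columns \<open>S\<close> have an invertible block in the rows \<open>I\<close>, so some combination of them agrees with column
  \<open>j\<close> in these rows.  If it differed from column \<open>j\<close> in a further row \<open>i\<close>, then the bordered block would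
  have trivial kernel and its minor would be nonzero.
\<close>

lemma bordered_minors_zero_imp_column_in_span:
  fixes A :: "'a::field mat"
  assumes A: "A \<in> carrier_mat nr nc" and I: "I \<subseteq> {..<nr}" "S \<subseteq> {..<nc}" "card I = card S"
    and nz: "det (submatrix A I S) \<noteq> 0"
    and j: "j < nc" "j \<notin> S"
    and border: "\<And>i. i < nr \<Longrightarrow> i \<notin> I \<Longrightarrow> det (submatrix A (insert i I) (insert j S)) = 0"
  shows "\<exists>c. \<forall>i<nr. A $$ (i, j) = (\<Sum>s\<in>S. A $$ (i, s) * c s)"
proof -
  have fin: "finite I" "finite S" using I finite_subset by blast+
  obtain c where c: "\<And>i. i \<in> I \<Longrightarrow> (\<Sum>s\<in>S. A $$ (i, s) * c s) = A $$ (i, j)"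
    by (rule submatrix_solve[OF A I nz, of "\<lambda>i. A $$ (i, j)"]) blast
  have inj: "\<forall>s\<in>S. x s = 0" if "\<forall>i\<in>I. (\<Sum>s\<in>S. A $$ (i, s) * x s) = 0" for x
    using det_submatrix_nonzero_iff[OF A I] nz that by blast
  have "A $$ (i, j) = (\<Sum>s\<in>S. A $$ (i, s) * c s)" if i: "i < nr" for i
  proof (rule ccontr)
    assume ne: "A $$ (i, j) \<noteq> (\<Sum>s\<in>S. A $$ (i, s) * c s)"
    then have iI: "i \<notin> I" using c by metis
    have "det (submatrix A (insert i I) (insert j S)) \<noteq> 0"
    proof (subst det_submatrix_nonzero_iff[OF A])
      show "\<forall>x. (\<forall>i'\<in>insert i I. (\<Sum>s\<in>insert j S. A $$ (i', s) * x s) = 0) \<longrightarrow> (\<forall>s\<in>insert j S. x s = 0)"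
      proof (intro allI impI)
        fix x assume x: "\<forall>i'\<in>insert i I. (\<Sum>s\<in>insert j S. A $$ (i', s) * x s) = 0"
        have split: "(\<Sum>s\<in>S. A $$ (i', s) * (x s + x j * c s)) =
            (\<Sum>s\<in>insert j S. A $$ (i', s) * x s) + x j * ((\<Sum>s\<in>S. A $$ (i', s) * c s) - A $$ (i', j))" for i'
          using fin j(2) by (simp add: distrib_left sum.distrib sum_distrib_left right_diff_distrib mult_ac)
        have "\<forall>i'\<in>I. (\<Sum>s\<in>S. A $$ (i', s) * (x s + x j * c s)) = 0"
          unfolding split using x c by simp
        then have xs: "x s + x j * c s = 0" if "s \<in> S" for s
          using inj[of "\<lambda>s. x s + x j * c s"] that by blast
        have "(\<Sum>s\<in>S. A $$ (i, s) * (x s + x j * c s)) = 0"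
          using xs by simp
        then have "x j * ((\<Sum>s\<in>S. A $$ (i, s) * c s) - A $$ (i, j)) = 0"
          unfolding split using x by simp
        then have "x j = 0" using ne by simp
        then show "\<forall>s\<in>insert j S. x s = 0" using xs by simp
      qed
    qed (use I i j iI fin in auto)
    then show False using border[OF i iI] by blast
  qed
  then show ?thesis by blast
qed

context vec_space
begin

lemma zero_in_span: "G \<subseteq> carrier_vec n \<Longrightarrow> 0\<^sub>v n \<in> span G"
  unfolding span_def lincomb_def by force

lemma column_combination_in_span:
  assumes A: "A \<in> carrier_mat n nc" and S: "finite S" "S \<subseteq> {..<nc}" "col A ` S \<subseteq> G" "G \<subseteq> carrier_vec n"
  shows "vec n (\<lambda>i. \<Sum>s\<in>S. A $$ (i, s) * c s) \<in> span G"
  using S(1-3)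
proof (induction S rule: finite_induct)
  case empty
  have "vec n (\<lambda>i. 0 :: 'a) = 0\<^sub>v n" by auto
  then show ?case
    using zero_in_span[OF S(4)] by simp
next
  case (insert s S)
  have "col A s \<in> span G"
    using insert.prems by (intro span_mem[OF S(4)]) auto
  then have "c s \<cdot>\<^sub>v col A s \<in> span G"
    by (rule smult_in_span[OF S(4)])
  moreover have "vec n (\<lambda>i. \<Sum>s\<in>S. A $$ (i, s) * c s) \<in> span G"
    using insert by auto
  ultimately have "c s \<cdot>\<^sub>v col A s + vec n (\<lambda>i. \<Sum>s\<in>S. A $$ (i, s) * c s) \<in> span G"
    by (rule span_add1[OF S(4)])
  also have "c s \<cdot>\<^sub>v col A s + vec n (\<lambda>i. \<Sum>s\<in>S. A $$ (i, s) * c s)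
      = vec n (\<lambda>i. \<Sum>s\<in>insert s S. A $$ (i, s) * c s)"
    using A insert by (auto simp: vec_eq_iff)
  finally show ?case .
qed

lemma rank_le_card_spanning_columns:
  assumes A: "A \<in> carrier_mat n nc" and S: "S \<subseteq> {..<nc}"
    and span: "\<And>j. j < nc \<Longrightarrow> \<exists>c. \<forall>i<n. A $$ (i, j) = (\<Sum>s\<in>S. A $$ (i, s) * c s)"
  shows "rank A \<le> card S"
proof -
  have fin: "finite S" using S finite_subset by blast
  let ?G = "col A ` S"
  have G: "?G \<subseteq> carrier_vec n" using A by auto
  obtain U where U: "finite U" "maximal U (\<lambda>T. T \<subseteq> set (cols A) \<and> lin_indpt T)"
    using maximal_exists[of "\<lambda>T. T \<subseteq> set (cols A) \<and> lin_indpt T" "card (set (cols A))" "{}"]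
    by (meson List.finite_set card_mono empty_iff empty_subsetI finite_lin_indpt2 rev_finite_subset)
  have li: "U \<subseteq> set (cols A)" "lin_indpt U"
    using U(2) by (auto simp: maximal_def)
  have "U \<subseteq> span ?G"
  proof
    fix u assume "u \<in> U"
    then obtain j where j: "j < nc" "u = col A j"
      using li(1) A by (auto simp: cols_def)
    then obtain c where "\<forall>i<n. A $$ (i, j) = (\<Sum>s\<in>S. A $$ (i, s) * c s)"
      using span by blast
    then have "u = vec n (\<lambda>i. \<Sum>s\<in>S. A $$ (i, s) * c s)"
      using A j by (auto simp: vec_eq_iff)
    then show "u \<in> span ?G"
      using column_combination_in_span[OF A fin S order_refl G] by simp
  qed
  obtain C :: "'a vec set" where "int (card C) \<le> int (card ?G) - int (card U)"
    using replacement[OF U(1) finite_imageI[OF fin] G li(2) \<open>U \<subseteq> span ?G\<close>] by auto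
  then have "card U \<le> card ?G" by linarith
  also have "\<dots> \<le> card S" using fin by (rule card_image_le)
  finally show ?thesis
    using rank_card_indpt[OF A U(2)] by simp
qed

text \<open>
  A nonzero minor of the largest possible size has only zero bordering minors, so its columns span
  the column space and their number is the rank.
\<close>

lemma rank_minor_exists:
  assumes A: "A \<in> carrier_mat n nc"
  obtains I S where "I \<subseteq> {..<n}" "S \<subseteq> {..<nc}" "card I = rank A" "card S = rank A"
    "det (submatrix A I S) \<noteq> 0"
    "\<And>j. j < nc \<Longrightarrow> \<exists>c. \<forall>i<n. A $$ (i, j) = (\<Sum>s\<in>S. A $$ (i, s) * c s)"
proof -
  define Q where "Q r \<longleftrightarrow> (\<exists>I S. I \<subseteq> {..<n} \<and> S \<subseteq> {..<nc} \<and> card I = r \<and> card S = r \<and>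
    det (submatrix A I S) \<noteq> 0)" for r
  have "det (submatrix A {} {}) \<noteq> 0"
    by (subst det_submatrix_nonzero_iff[OF A]) auto
  then have "Q 0"
    unfolding Q_def by (intro exI[of _ "{}"]) simp
  moreover have "r \<le> n" if "Q r" for r
    using that card_mono[OF finite_lessThan] unfolding Q_def by (metis card_lessThan)
  ultimately have "Q (GREATEST r. Q r)" and max: "\<And>r. Q r \<Longrightarrow> r \<le> (GREATEST r. Q r)"
    by (blast intro: GreatestI_nat Greatest_le_nat)+
  then obtain I S where I: "I \<subseteq> {..<n}" "S \<subseteq> {..<nc}" "card I = card S" "det (submatrix A I S) \<noteq> 0"
    and S: "card S = (GREATEST r. Q r)"
    unfolding Q_def by metis
  have fin: "finite I" "finite S" using I finite_subset by blast+
  have span: "\<exists>c. \<forall>i<n. A $$ (i, j) = (\<Sum>s\<in>S. A $$ (i, s) * c s)" if j: "j < nc" for j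
  proof (cases "j \<in> S")
    case True
    have "(\<Sum>s\<in>S. A $$ (i, s) * (if s = j then 1 else 0)) = (\<Sum>s\<in>S. if s = j then A $$ (i, s) else 0)" for i
      by (intro sum.cong) auto
    then show ?thesis
      using True fin by (intro exI[of _ "\<lambda>s. if s = j then 1 else 0"]) simp
  next
    case False
    have "det (submatrix A (insert i I) (insert j S)) = 0" if "i < n" "i \<notin> I" for i
    proof (rule ccontr)
      assume "det (submatrix A (insert i I) (insert j S)) \<noteq> 0"
      then have "Q (Suc (card S))"
        unfolding Q_def using I j that False fin
        by (intro exI[of _ "insert i I"] exI[of _ "insert j S"]) simp
      from max[OF this] show False
        using S by simp
    qed
    then show ?thesis
      using bordered_minors_zero_imp_column_in_span[OF A I j False] by blast
  qed
  have "rank A \<le> card S"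
    by (rule rank_le_card_spanning_columns[OF A I(2) span])
  moreover have "{j. j < nc \<and> j \<in> S} = S"
    using I(2) by auto
  then have "card S \<le> rank A"
    using rank_gt_minor[OF A I(4)] by simp
  ultimately have "card S = rank A" by simp
  then show thesis
    using that[OF I(1,2) _ _ I(4) span] I(3) by simp
qed

text \<open>
  If the last column lies in the column space of \<open>A\<close>, then the rank of \<open>M\<close> is that of \<open>A\<close>, and larger
  minors vanish.  Conversely, it suffices that the minors bordering one fixed nonzero minor of
  maximal size by the last column vanish.
\<close>

theorem augmented_minors_zero_iff:
  assumes A: "A \<in> carrier_mat n m" and M: "M \<in> carrier_mat n (m + 1)"
    and MA: "\<And>i j. i < n \<Longrightarrow> j < m \<Longrightarrow> M $$ (i, j) = A $$ (i, j)"
  shows "(\<forall>I S. I \<subseteq> {..<n} \<longrightarrow> card I = rank A + 1 \<longrightarrow> S \<subseteq> {..<m} \<longrightarrow> card S = rank A \<longrightarrow>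
      det (submatrix M I (insert m S)) = 0) \<longleftrightarrow>
    (\<exists>w. \<forall>i<n. M $$ (i, m) = (\<Sum>j<m. A $$ (i, j) * w j))"
proof -
  obtain I0 S0 where I0: "I0 \<subseteq> {..<n}" "S0 \<subseteq> {..<m}" "card I0 = rank A" "card S0 = rank A"
    "det (submatrix A I0 S0) \<noteq> 0"
    and span: "\<And>j. j < m \<Longrightarrow> \<exists>c. \<forall>i<n. A $$ (i, j) = (\<Sum>s\<in>S0. A $$ (i, s) * c s)"
    using rank_minor_exists[OF A] by metis
  have fin: "finite I0" "finite S0" using I0 finite_subset by blast+
  have S0: "S0 \<subseteq> {..<m + 1}" "m \<notin> S0" using I0(2) by auto
  have sumMA: "(\<Sum>s\<in>S. M $$ (i, s) * c s) = (\<Sum>s\<in>S. A $$ (i, s) * c s)" if "S \<subseteq> {..<m}" "i < n" for S c i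
    using that by (intro sum.cong) (auto simp: MA subset_iff)
  show ?thesis
  proof
    assume minors: "\<forall>I S. I \<subseteq> {..<n} \<longrightarrow> card I = rank A + 1 \<longrightarrow> S \<subseteq> {..<m} \<longrightarrow> card S = rank A \<longrightarrow>
      det (submatrix M I (insert m S)) = 0"
    have "card I0 = card S0" using I0 by simp
    note minor_iff = det_submatrix_nonzero_iff[OF M I0(1) S0(1) this] det_submatrix_nonzero_iff[OF A I0(1,2) this]
    have nz: "det (submatrix M I0 S0) \<noteq> 0"
      unfolding minor_iff(1)
    proof (intro allI impI)
      fix x assume "\<forall>i\<in>I0. (\<Sum>s\<in>S0. M $$ (i, s) * x s) = 0"
      then have "(\<Sum>s\<in>S0. A $$ (i, s) * x s) = 0" if "i \<in> I0" for i
        using that sumMA[OF I0(2), of i x] I0(1) by auto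
      then show "\<forall>s\<in>S0. x s = 0"
        using I0(5)[unfolded minor_iff(2), rule_format, of x] by blast
    qed
    have border: "det (submatrix M (insert i I0) (insert m S0)) = 0" if "i < n" "i \<notin> I0" for i
      using minors I0 fin that by simp
    obtain c where c: "\<And>i. i < n \<Longrightarrow> M $$ (i, m) = (\<Sum>s\<in>S0. M $$ (i, s) * c s)"
      using bordered_minors_zero_imp_column_in_span[OF M I0(1) S0(1) \<open>card I0 = card S0\<close> nz _ S0(2) border]
      by auto
    have "M $$ (i, m) = (\<Sum>j<m. A $$ (i, j) * (if j \<in> S0 then c j else 0))" if "i < n" for i
    proof -
      have "(\<Sum>j<m. A $$ (i, j) * (if j \<in> S0 then c j else 0)) = (\<Sum>j\<in>S0. A $$ (i, j) * c j)"
        using I0(2) by (intro sum.mono_neutral_cong_right) auto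
      then show ?thesis using c[OF that] sumMA[OF I0(2) that] by simp
    qed
    then show "\<exists>w. \<forall>i<n. M $$ (i, m) = (\<Sum>j<m. A $$ (i, j) * w j)"
      by (intro exI[of _ "\<lambda>j. if j \<in> S0 then c j else 0"]) simp
  next
    assume "\<exists>w. \<forall>i<n. M $$ (i, m) = (\<Sum>j<m. A $$ (i, j) * w j)"
    then obtain w where w: "\<And>i. i < n \<Longrightarrow> M $$ (i, m) = (\<Sum>j<m. A $$ (i, j) * w j)" by blast
    obtain c where c: "\<And>i j. i < n \<Longrightarrow> j < m \<Longrightarrow> A $$ (i, j) = (\<Sum>s\<in>S0. A $$ (i, s) * c j s)"
      using span by metis
    have "rank M \<le> card S0"
    proof (rule rank_le_card_spanning_columns[OF M S0(1)])
      fix j assume "j < m + 1"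
      show "\<exists>c. \<forall>i<n. M $$ (i, j) = (\<Sum>s\<in>S0. M $$ (i, s) * c s)"
      proof (cases "j = m")
        case True
        have "M $$ (i, m) = (\<Sum>s\<in>S0. M $$ (i, s) * (\<Sum>j<m. c j s * w j))" if i: "i < n" for i
        proof -
          have "M $$ (i, m) = (\<Sum>j<m. \<Sum>s\<in>S0. A $$ (i, s) * c j s * w j)"
            unfolding w[OF i] by (intro sum.cong refl) (simp add: c[OF i] flip: sum_distrib_right)
          also have "\<dots> = (\<Sum>s\<in>S0. A $$ (i, s) * (\<Sum>j<m. c j s * w j))"
            by (subst sum.swap) (simp add: sum_distrib_left mult_ac)
          finally show ?thesis using sumMA[OF I0(2) i] by simp
        qed
        then show ?thesis unfolding True by (intro exI[of _ "\<lambda>s. \<Sum>j<m. c j s * w j"]) simp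
      next
        case False
        then have "j < m" using \<open>j < m + 1\<close> by simp
        then show ?thesis
          using c sumMA[OF I0(2)] by (intro exI[of _ "c j"]) (simp add: MA)
      qed
    qed
    then have rM: "rank M \<le> rank A" using I0 by simp
    show "\<forall>I S. I \<subseteq> {..<n} \<longrightarrow> card I = rank A + 1 \<longrightarrow> S \<subseteq> {..<m} \<longrightarrow> card S = rank A \<longrightarrow>
      det (submatrix M I (insert m S)) = 0"
    proof (intro allI impI, rule ccontr)
      fix I S assume S: "S \<subseteq> {..<m}" "card S = rank A" and "det (submatrix M I (insert m S)) \<noteq> 0"
      then have "card {j. j < m + 1 \<and> j \<in> insert m S} \<le> rank M"
        using rank_gt_minor[OF M] by blast
      moreover have "{j. j < m + 1 \<and> j \<in> insert m S} = insert m S" "m \<notin> S" "finite S"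
        using S(1) finite_subset by auto
      ultimately show False using rM S(2) by simp
    qed
  qed
qed

end

section \<open>Entire functions and the matrix exponential\<close>

text \<open>
  Functions given by a power series that converges everywhere.  Two of their properties are used: they
  form a ring, so polynomials in them are of the same kind, and such a function is zero if all its
  derivatives at \<open>0\<close> are.
\<close>

definition entire :: "(complex \<Rightarrow> complex) \<Rightarrow> bool" where
  "entire f \<longleftrightarrow> (\<exists>a. \<forall>t. (\<lambda>k. a k * t ^ k) sums f t)"

lemma entire_const: "entire (\<lambda>t. c)"
  unfolding entire_def
proof (intro exI[of _ "\<lambda>k. if k = 0 then c else 0"] allI)
  fix t :: complex
  have "(\<lambda>k. if k = 0 then c else 0) sums c" by (rule sums_single)
  also have "(\<lambda>k. if k = 0 then c else 0) = (\<lambda>k. (if k = 0 then c else 0) * t ^ k)" by auto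
  finally show "(\<lambda>k. (if k = 0 then c else 0) * t ^ k) sums c" .
qed

lemma entire_add: "entire f \<Longrightarrow> entire g \<Longrightarrow> entire (\<lambda>t. f t + g t)"
  unfolding entire_def
proof (elim exE)
  fix a b assume "\<forall>t. (\<lambda>k. a k * t ^ k) sums f t" "\<forall>t. (\<lambda>k. b k * t ^ k) sums g t"
  then have "\<forall>t. (\<lambda>k. (a k + b k) * t ^ k) sums (f t + g t)"
    by (simp add: distrib_right sums_add)
  then show "\<exists>a. \<forall>t. (\<lambda>k. a k * t ^ k) sums (f t + g t)"
    by (intro exI[of _ "\<lambda>k. a k + b k"])
qed

lemma entire_mult: "entire f \<Longrightarrow> entire g \<Longrightarrow> entire (\<lambda>t. f t * g t)"
  unfolding entire_def
proof (elim exE)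
  fix a b assume a: "\<forall>t. (\<lambda>k. a k * t ^ k) sums f t" and b: "\<forall>t. (\<lambda>k. b k * t ^ k) sums g t"
  have abs: "summable (\<lambda>k. norm (c k * t ^ k))" if "\<forall>t. (\<lambda>k. c k * t ^ k) sums h t"
    for c :: "nat \<Rightarrow> complex" and h t
    using that by (intro powser_insidea[of c "of_real (norm t + 1)"]) (auto simp: sums_iff)
  have "(\<lambda>k. (\<Sum>i\<le>k. a i * b (k - i)) * t ^ k) sums (f t * g t)" for t
  proof -
    have "(\<lambda>k. \<Sum>i\<le>k. (a i * t ^ i) * (b (k - i) * t ^ (k - i))) sums (f t * g t)"
      using Cauchy_product_sums[OF abs[OF a, of t] abs[OF b, of t]] a b by (simp add: sums_iff)
    also have "(\<lambda>k. \<Sum>i\<le>k. (a i * t ^ i) * (b (k - i) * t ^ (k - i))) =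
        (\<lambda>k. (\<Sum>i\<le>k. a i * b (k - i)) * t ^ k)"
    proof
      fix k
      have "(a i * t ^ i) * (b (k - i) * t ^ (k - i)) = a i * b (k - i) * t ^ k" if "i \<le> k" for i
      proof -
        have "t ^ k = t ^ i * t ^ (k - i)" using that by (simp flip: power_add)
        then show ?thesis by (simp add: mult_ac)
      qed
      then show "(\<Sum>i\<le>k. (a i * t ^ i) * (b (k - i) * t ^ (k - i))) = (\<Sum>i\<le>k. a i * b (k - i)) * t ^ k"
        unfolding sum_distrib_right by (intro sum.cong) auto
    qed
    finally show ?thesis .
  qed
  then show "\<exists>a. \<forall>t. (\<lambda>k. a k * t ^ k) sums (f t * g t)"
    by (intro exI[of _ "\<lambda>k. \<Sum>i\<le>k. a i * b (k - i)"] allI)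
qed

lemma entire_sum: "(\<And>i. i \<in> I \<Longrightarrow> entire (f i)) \<Longrightarrow> entire (\<lambda>t. \<Sum>i\<in>I. f i t)"
proof (induction I rule: infinite_finite_induct)
  case (insert i I)
  have "entire (\<lambda>t. f i t + (\<Sum>i\<in>I. f i t))"
    using insert by (intro entire_add) auto
  then show ?case using insert.hyps by simp
qed (simp_all add: entire_const)

lemma entire_reflect: "entire f \<Longrightarrow> entire (\<lambda>t. f (- t))"
  unfolding entire_def
proof (elim exE)
  fix a assume a: "\<forall>t. (\<lambda>k. a k * t ^ k) sums f t"
  have "(\<lambda>k. (a k * (- 1) ^ k) * t ^ k) sums f (- t)" for t
    using a[rule_format, of "- t"] by (simp add: power_minus[of t] mult_ac)
  then show "\<exists>a. \<forall>t. (\<lambda>k. a k * t ^ k) sums f (- t)"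
    by (intro exI[of _ "\<lambda>k. a k * (- 1) ^ k"]) simp
qed

lemma power_series_DERIV:
  fixes a :: "nat \<Rightarrow> complex"
  assumes "\<And>t. (\<lambda>k. a k * t ^ k) sums f t"
  shows "\<exists>f'. (\<forall>t. (\<lambda>k. diffs a k * t ^ k) sums f' t) \<and> (\<forall>t. (f has_field_derivative f' t) (at t))"
proof (intro exI conjI allI)
  fix t
  have sm: "summable (\<lambda>k. a k * t ^ k)" for t
    using assms by (simp add: sums_iff)
  show "(\<lambda>k. diffs a k * t ^ k) sums suminf (\<lambda>k. diffs a k * t ^ k)"
    using termdiff_converges_all[of a] sm by (simp add: summable_sums)
  have "f = (\<lambda>t. suminf (\<lambda>k. a k * t ^ k))"
    using assms by (auto simp: sums_iff fun_eq_iff)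
  then show "(f has_field_derivative suminf (\<lambda>k. diffs a k * t ^ k)) (at t)"
    using termdiffs_strong_converges_everywhere[of a t] sm by simp
qed

lemma fact_iterated_diffs: "fact j * (diffs ^^ k) a j = (fact (k + j) * a (k + j) :: complex)"
proof (induction k arbitrary: j)
  case (Suc k)
  have "fact j * (diffs ^^ Suc k) a j = fact (Suc j) * (diffs ^^ k) a (Suc j)"
    by (simp add: diffs_def)
  also have "\<dots> = fact (k + Suc j) * a (k + Suc j)" by (rule Suc.IH)
  finally show ?case by simp
qed simp

text \<open>
  The \<open>k\<close>-th derivative at \<open>0\<close> is \<open>k!\<close> times the \<open>k\<close>-th coefficient of the power series.  The
  derivatives are given as a sequence of functions because they are known explicitly where this is
  applied.
\<close>

lemma entire_eq_0:
  assumes "entire (p 0)"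
    and deriv: "\<And>k t. (p k has_field_derivative p (Suc k) t) (at t)"
    and zero: "\<And>k. p k 0 = 0"
  shows "p 0 t = 0"
proof -
  obtain a where a: "\<And>t. (\<lambda>k. a k * t ^ k) sums p 0 t"
    using assms(1) by (auto simp: entire_def)
  have series: "\<forall>t. (\<lambda>i. (diffs ^^ k) a i * t ^ i) sums p k t" for k
  proof (induction k)
    case 0
    show ?case using a by simp
  next
    case (Suc k)
    obtain f' where f': "\<forall>t. (\<lambda>i. diffs ((diffs ^^ k) a) i * t ^ i) sums f' t"
      "\<forall>t. (p k has_field_derivative f' t) (at t)"
      using power_series_DERIV[of "(diffs ^^ k) a" "p k"] Suc.IH by blast
    have "f' t = p (Suc k) t" for t
      using DERIV_unique f'(2) deriv by blast
    then show ?case using f'(1) by simp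
  qed
  have "a k = 0" for k
  proof -
    have "p k 0 = (diffs ^^ k) a 0"
      using series[of k, rule_format, of 0] sums_unique powser_sums_zero by (metis sums_unique2)
    then show ?thesis
      using fact_iterated_diffs[of 0 k a] zero[of k] by simp
  qed
  then show ?thesis
    using a[of t] by (simp add: sums_iff)
qed

lemma mp_eval_has_field_derivative:
  assumes "mp_vars P \<subseteq> V" "finite V"
    and \<alpha>: "\<And>v. v \<in> V \<Longrightarrow> ((\<lambda>t. \<alpha> t v) has_field_derivative \<alpha>' v) (at (t :: complex))"
  shows "((\<lambda>t. mp_value (\<alpha> t) P) has_field_derivative
    (\<Sum>v\<in>V. mp_value (\<alpha> t) (mp_pderiv v P) * \<alpha>' v)) (at t)"
proof -
  note id = mp_eval_id_add mp_eval_id_mult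
  from assms(1) show ?thesis
  proof (induction P rule: mp_vars_induct)
    case (const c)
    show ?case by (simp add: mp_eval_const)
  next
    case (var v)
    have "(\<Sum>w\<in>V. mp_value (\<alpha> t) (mp_pderiv w (mp_var v)) * \<alpha>' w)
        = (\<Sum>w\<in>V. if w = v then \<alpha>' w else 0)"
      using mp_eval_const[of "\<lambda>c :: complex. c" "\<alpha> t" 1] by (intro sum.cong) (auto simp: mp_pderiv_var)
    then show ?case
      using var assms(2) \<alpha> by (simp add: mp_eval_var)
  next
    case (add P Q)
    have "((\<lambda>t. mp_value (\<alpha> t) (P + Q)) has_field_derivative
      (\<Sum>v\<in>V. mp_value (\<alpha> t) (mp_pderiv v P) * \<alpha>' v) +
      (\<Sum>v\<in>V. mp_value (\<alpha> t) (mp_pderiv v Q) * \<alpha>' v)) (at t)"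
      unfolding id by (rule DERIV_add[OF add.IH])
    then show ?case
      by (simp add: id mp_pderiv_add distrib_right sum.distrib)
  next
    case (mult P Q)
    have "((\<lambda>t. mp_value (\<alpha> t) (P * Q)) has_field_derivative
      (\<Sum>v\<in>V. mp_value (\<alpha> t) (mp_pderiv v P) * \<alpha>' v) * mp_value (\<alpha> t) Q +
      (\<Sum>v\<in>V. mp_value (\<alpha> t) (mp_pderiv v Q) * \<alpha>' v) * mp_value (\<alpha> t) P) (at t)"
      unfolding id by (rule DERIV_mult[OF mult.IH])
    then show ?case
      by (simp add: id mp_pderiv_mult distrib_right sum.distrib
          sum_distrib_left sum_distrib_right mult_ac distrib_left)
  qed
qed

lemma entire_mp_eval:
  assumes "mp_vars P \<subseteq> V" "\<And>v. v \<in> V \<Longrightarrow> entire (\<lambda>t. \<alpha> t v)"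
  shows "entire (\<lambda>t. mp_value (\<alpha> t) P)"
proof -
  note id = mp_eval_id_add mp_eval_id_mult
  from assms(1) show ?thesis
  proof (induction P rule: mp_vars_induct)
    case (const c)
    show ?case by (simp add: mp_eval_const entire_const)
  next
    case (var v)
    then show ?case by (simp add: mp_eval_var assms(2))
  next
    case (add P Q)
    show ?case unfolding id by (rule entire_add[OF add.IH])
  next
    case (mult P Q)
    show ?case unfolding id by (rule entire_mult[OF mult.IH])
  qed
qed

text \<open>
  The entries of the power \<open>M\<^sup>k\<close>, as numbers instead of matrices so that series of them can be formed.
\<close>

fun mat_power_entry :: "nat \<Rightarrow> complex mat \<Rightarrow> nat \<Rightarrow> nat \<Rightarrow> nat \<Rightarrow> complex" where
  "mat_power_entry n M 0 i j = (if i = j then 1 else 0)"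
| "mat_power_entry n M (Suc k) i j = (\<Sum>l<n. M $$ (i, l) * mat_power_entry n M k l j)"

lemma mat_power_entry_commute:
  assumes "i < n" "j < n"
  shows "mat_power_entry n M (Suc k) i j = (\<Sum>l<n. mat_power_entry n M k i l * M $$ (l, j))"
  using assms
proof (induction k arbitrary: i)
  case 0
  have "(\<Sum>l<n. M $$ (i, l) * (if l = j then 1 else 0)) = (\<Sum>l<n. if l = j then M $$ (i, l) else 0)"
    by (rule sum.cong) auto
  moreover have "(\<Sum>l<n. (if i = l then 1 else 0) * M $$ (l, j)) = (\<Sum>l<n. if l = i then M $$ (l, j) else 0)"
    by (rule sum.cong) auto
  ultimately show ?case using 0 by simp
next
  case (Suc k)
  have "mat_power_entry n M (Suc (Suc k)) i j
      = (\<Sum>l<n. M $$ (i, l) * (\<Sum>r<n. mat_power_entry n M k l r * M $$ (r, j)))"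
    unfolding mat_power_entry.simps(2)[of n M "Suc k"] using Suc by (intro sum.cong refl) simp
  also have "\<dots> = (\<Sum>r<n. \<Sum>l<n. M $$ (i, l) * (mat_power_entry n M k l r * M $$ (r, j)))"
    unfolding sum_distrib_left by (rule sum.swap)
  also have "\<dots> = (\<Sum>r<n. mat_power_entry n M (Suc k) i r * M $$ (r, j))"
    by (simp add: sum_distrib_right sum_distrib_left mult_ac)
  finally show ?case .
qed

lemma mat_power_entry_bound:
  "\<exists>K. \<forall>k. \<forall>i<n. \<forall>j<n. norm (mat_power_entry n M k i j) \<le> K ^ k"
proof -
  define c where "c = (\<Sum>i<n. \<Sum>l<n. norm (M $$ (i, l)))"
  have row: "(\<Sum>l<n. norm (M $$ (i, l))) \<le> c" if "i < n" for i
    unfolding c_def using that by (intro member_le_sum) (auto intro: sum_nonneg)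
  have "norm (mat_power_entry n M k i j) \<le> c ^ k" if "i < n" "j < n" for k i j
    using that
  proof (induction k arbitrary: i)
    case (Suc k)
    have "norm (mat_power_entry n M (Suc k) i j) \<le> (\<Sum>l<n. norm (M $$ (i, l)) * c ^ k)"
      using Suc by (auto simp: norm_mult intro!: sum_norm_le mult_left_mono)
    also have "\<dots> \<le> c * c ^ k"
      unfolding sum_distrib_right[symmetric]
      using row[OF Suc.prems(1)] by (intro mult_right_mono) (auto simp: c_def sum_nonneg)
    finally show ?case by simp
  qed simp
  then show ?thesis by blast
qed

text \<open>
  The function \<open>E(t) = exp(t M)\<close>.  That \<open>E(t) E(-t) = 1\<close> follows because both sides agree at \<open>t = 0\<close> and
  the left-hand side has derivative \<open>E(t) M E(-t) - E(t) M E(-t) = 0\<close>; this uses that \<open>M\<close> and \<open>E(t)\<close>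
  commute.
\<close>

lemma matrix_exponential:
  fixes M :: "complex mat"
  obtains E where "\<And>t. E t \<in> carrier_mat n n" "E 0 = 1\<^sub>m n"
    "\<And>i j. i < n \<Longrightarrow> j < n \<Longrightarrow> entire (\<lambda>t. E t $$ (i, j))"
    "\<And>i j t. i < n \<Longrightarrow> j < n \<Longrightarrow>
      ((\<lambda>t. E t $$ (i, j)) has_field_derivative (\<Sum>l<n. M $$ (i, l) * E t $$ (l, j))) (at t)"
    "\<And>t. E t * E (- t) = 1\<^sub>m n"
proof -
  define a where "a i j k = mat_power_entry n M k i j / fact k" for i j k
  define E where "E t = mat n n (\<lambda>(i, j). suminf (\<lambda>k. a i j k * t ^ k))" for t
  obtain K where K: "\<And>k i j. i < n \<Longrightarrow> j < n \<Longrightarrow> norm (mat_power_entry n M k i j) \<le> K ^ k"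
    using mat_power_entry_bound[of n M] by blast
  have sums: "(\<lambda>k. a i j k * t ^ k) sums (E t $$ (i, j))" if "i < n" "j < n" for i j t
  proof -
    have "norm (a i j k * t ^ k) \<le> inverse (fact k) * (K * norm t) ^ k" for k
    proof -
      have "norm (a i j k * t ^ k) = norm (mat_power_entry n M k i j) * norm t ^ k / fact k"
        by (simp add: a_def norm_mult norm_divide norm_power)
      also have "\<dots> \<le> K ^ k * norm t ^ k / fact k"
        using K[OF that] by (intro divide_right_mono mult_right_mono) auto
      finally show ?thesis by (simp add: power_mult_distrib field_simps)
    qed
    then have "summable (\<lambda>k. a i j k * t ^ k)"
      by (intro summable_comparison_test'[OF summable_exp[of "K * norm t"]]) auto
    then show ?thesis
      using that by (simp add: E_def summable_sums)
  qed
  have entire: "entire (\<lambda>t. E t $$ (i, j))" if "i < n" "j < n" for i j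
    unfolding entire_def using sums[OF that] by blast
  have carrier: "E t \<in> carrier_mat n n" for t by (simp add: E_def)
  have diffs: "diffs (a i j) k = mat_power_entry n M (Suc k) i j / fact k" for i j k
    by (simp add: diffs_def a_def fact_Suc del: mat_power_entry.simps of_nat_Suc)
  have deriv: "((\<lambda>t. E t $$ (i, j)) has_field_derivative (\<Sum>l<n. M $$ (i, l) * E t $$ (l, j))) (at t)"
    "(\<Sum>l<n. M $$ (i, l) * E t $$ (l, j)) = (\<Sum>l<n. E t $$ (i, l) * M $$ (l, j))"
    if ij: "i < n" "j < n" for i j t
  proof -
    obtain f' where f': "\<forall>t. (\<lambda>k. diffs (a i j) k * t ^ k) sums f' t"
      "\<forall>t. ((\<lambda>t. E t $$ (i, j)) has_field_derivative f' t) (at t)"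
      using power_series_DERIV[OF sums[OF ij]] by blast
    have "(\<lambda>k. \<Sum>l<n. M $$ (i, l) * (a l j k * t ^ k)) sums (\<Sum>l<n. M $$ (i, l) * E t $$ (l, j))"
      using ij by (intro sums_sum sums_mult sums) auto
    moreover have "(\<Sum>l<n. M $$ (i, l) * (a l j k * t ^ k)) = diffs (a i j) k * t ^ k" for k
      unfolding diffs mat_power_entry.simps(2) a_def sum_divide_distrib sum_distrib_right
      by (intro sum.cong refl) (simp add: mult_ac)
    ultimately have "(\<lambda>k. diffs (a i j) k * t ^ k) sums (\<Sum>l<n. M $$ (i, l) * E t $$ (l, j))"
      by (simp only:)
    then have l: "f' t = (\<Sum>l<n. M $$ (i, l) * E t $$ (l, j))"
      by (rule sums_unique2[OF f'(1)[rule_format]])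
    have "(\<lambda>k. \<Sum>l<n. (a i l k * t ^ k) * M $$ (l, j)) sums (\<Sum>l<n. E t $$ (i, l) * M $$ (l, j))"
      using ij by (intro sums_sum sums_mult2 sums) auto
    moreover have "(\<Sum>l<n. (a i l k * t ^ k) * M $$ (l, j)) = diffs (a i j) k * t ^ k" for k
      unfolding diffs mat_power_entry_commute[OF ij] a_def sum_divide_distrib sum_distrib_right
      by (intro sum.cong refl) (simp add: mult_ac)
    ultimately have "(\<lambda>k. diffs (a i j) k * t ^ k) sums (\<Sum>l<n. E t $$ (i, l) * M $$ (l, j))"
      by (simp only:)
    then have r: "f' t = (\<Sum>l<n. E t $$ (i, l) * M $$ (l, j))"
      by (rule sums_unique2[OF f'(1)[rule_format]])
    show "((\<lambda>t. E t $$ (i, j)) has_field_derivative (\<Sum>l<n. M $$ (i, l) * E t $$ (l, j))) (at t)"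
      using f'(2)[rule_format, of t] by (simp only: l)
    show "(\<Sum>l<n. M $$ (i, l) * E t $$ (l, j)) = (\<Sum>l<n. E t $$ (i, l) * M $$ (l, j))"
      using l r by (simp only:)
  qed
  have E0: "E 0 = 1\<^sub>m n"
  proof (rule eq_matI)
    fix i j assume "i < dim_row (1\<^sub>m n :: complex mat)" "j < dim_col (1\<^sub>m n :: complex mat)"
    then show "E 0 $$ (i, j) = 1\<^sub>m n $$ (i, j)"
      using sums_unique2[OF sums[of i j 0] powser_sums_zero[of "a i j"]] by (simp add: a_def)
  qed (simp_all add: E_def)
  have inv: "E t * E (- t) = 1\<^sub>m n" for t
  proof (rule eq_matI)
    fix i j assume "i < dim_row (1\<^sub>m n :: complex mat)" "j < dim_col (1\<^sub>m n :: complex mat)"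
    then have ij: "i < n" "j < n" by simp_all
    \<comment> \<open>The derivative of \<open>p 0\<close> is zero, hence so are all further terms of the sequence of derivatives.\<close>
    define p where "p k t = (if k = 0 then (\<Sum>l<n. E t $$ (i, l) * E (- t) $$ (l, j)) + - (if i = j then 1 else 0) else 0)"
      for k :: nat and t
    have "p 0 t = 0"
    proof (rule entire_eq_0[of p])
      show "entire (p 0)"
        unfolding p_def if_P[OF refl]
        by (intro entire_add entire_sum entire_mult entire[OF ij(1)] entire_const
            entire_reflect[OF entire[OF _ ij(2)]]) auto
      fix k
      have "(\<Sum>l<n. (if i = l then 1 else 0) * (if l = j then 1 else 0))
          = (\<Sum>l<n. if l = i then if i = j then 1 else 0 else (0 :: complex))"
        by (rule sum.cong) auto
      then show "p k 0 = 0"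
        using ij by (simp add: p_def E0)
      fix t
      have d: "((\<lambda>t. E (- t) $$ (l, j)) has_field_derivative
          (\<Sum>r<n. M $$ (l, r) * E (- t) $$ (r, j)) * (- 1)) (at t)" if "l < n" for l
        by (rule DERIV_chain2[OF deriv(1)[OF that ij(2)]]) (auto intro!: derivative_eq_intros)
      have d': "((\<lambda>t. E t $$ (i, l)) has_field_derivative (\<Sum>r<n. E t $$ (i, r) * M $$ (r, l))) (at t)"
        if "l < n" for l
        using deriv(1)[OF ij(1) that, of t] unfolding deriv(2)[OF ij(1) that, of t] .
      have "((\<lambda>t. \<Sum>l<n. E t $$ (i, l) * E (- t) $$ (l, j)) has_field_derivative
         (\<Sum>l<n. (\<Sum>r<n. E t $$ (i, r) * M $$ (r, l)) * E (- t) $$ (l, j) +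
            (\<Sum>r<n. M $$ (l, r) * E (- t) $$ (r, j)) * (- 1) * E t $$ (i, l))) (at t)"
        by (intro DERIV_sum DERIV_mult d d') auto
      also have "(\<Sum>l<n. (\<Sum>r<n. E t $$ (i, r) * M $$ (r, l)) * E (- t) $$ (l, j) +
            (\<Sum>r<n. M $$ (l, r) * E (- t) $$ (r, j)) * (- 1) * E t $$ (i, l)) =
          (\<Sum>l<n. \<Sum>r<n. E t $$ (i, r) * M $$ (r, l) * E (- t) $$ (l, j)) -
          (\<Sum>l<n. \<Sum>r<n. E t $$ (i, l) * M $$ (l, r) * E (- t) $$ (r, j))"
        by (simp add: sum_distrib_left sum_distrib_right mult_ac sum_subtractf sum_negf)
      also have "\<dots> = 0"
        by (subst sum.swap) simp
      finally have "((\<lambda>t. (\<Sum>l<n. E t $$ (i, l) * E (- t) $$ (l, j)) + - (if i = j then 1 else 0))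
          has_field_derivative 0 + 0) (at t)"
        by (intro DERIV_add DERIV_const)
      then show "(p k has_field_derivative p (Suc k) t) (at t)"
        unfolding p_def by (cases "k = 0") auto
    qed
    then show "(E t * E (- t)) $$ (i, j) = 1\<^sub>m n $$ (i, j)"
      using ij carrier[of t] carrier[of "- t"]
      by (simp add: p_def scalar_prod_def lessThan_atLeast0)
  qed (simp_all add: E_def)
  show thesis
    using that[OF carrier E0 entire deriv(1) inv] .
qed

section \<open>Linear vector fields and the symmetry algebra\<close>

text \<open>
  The derivative of \<open>P\<close> along the vector field \<open>y \<mapsto> M y\<close>; it is the infinitesimal action of \<open>M\<close> on
  polynomial functions.
\<close>

definition lie_deriv :: "nat \<Rightarrow> 'a::comm_ring_1 mat \<Rightarrow> (nat, 'a) mpoly \<Rightarrow> (nat, 'a) mpoly" where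
  "lie_deriv n M P = (\<Sum>i<n. \<Sum>j<n. mp_pderiv i P * (mp_const (M $$ (i, j)) * mp_var j))"

definition vanishing :: "nat \<Rightarrow> complex vec set \<Rightarrow> (nat, complex) mpoly set" where
  "vanishing n S = {P. mp_vars P \<subseteq> {..<n} \<and> (\<forall>x\<in>S. mp_value (($) x) P = 0)}"

lemma mp_vars_lie_deriv:
  assumes "mp_vars P \<subseteq> {..<n}"
  shows "mp_vars (lie_deriv n M P) \<subseteq> {..<n}"
  unfolding lie_deriv_def
  by (intro mp_vars_sum mp_vars_mult mp_vars_pderiv assms) auto

lemma mp_eval_lie_deriv:
  assumes "comm_semiring_hom \<iota>"
  shows "mp_eval \<iota> \<alpha> (lie_deriv n M P) =
    (\<Sum>i<n. mp_eval \<iota> \<alpha> (mp_pderiv i P) * (\<Sum>j<n. \<iota> (M $$ (i, j)) * \<alpha> j))"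
proof -
  interpret i: comm_semiring_hom \<iota> by fact
  show ?thesis
    by (simp add: lie_deriv_def i.mp_eval_sum i.mp_eval_mult mp_eval_const mp_eval_var sum_distrib_left)
qed

text \<open>
  For fixed \<open>x \<in> X\<close>, the polynomial \<open>Q(g) = P(g x)\<close> in the entries of \<open>g\<close> vanishes on the symmetry group,
  so its differential at the identity vanishes on \<open>M\<close>.  By the chain rule, this differential is the Lie
  derivative of \<open>P\<close> at \<open>x\<close>.
\<close>

lemma symmetry_algebra_imp_lie_deriv_vanishing:
  assumes M: "M \<in> symmetry_algebra n X" and P: "P \<in> vanishing n X" and X: "X \<subseteq> carrier_vec n"
  shows "lie_deriv n M P \<in> vanishing n X"
proof -
  let ?N = "{..<n} \<times> {..<n}"
  have Pv: "mp_vars P \<subseteq> {..<n}" using P by (simp add: vanishing_def)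
  have "mp_value (($) x) (lie_deriv n M P) = 0" if x: "x \<in> X" for x
  proof -
    have xc: "x \<in> carrier_vec n" using X x by blast
    \<comment> \<open>The components of \<open>g x\<close> as polynomials in the entries of \<open>g\<close>.\<close>
    define \<beta> :: "nat \<Rightarrow> (nat \<times> nat, complex) mpoly"
      where "\<beta> i = (\<Sum>j<n. mp_var (i, j) * mp_const (x $ j))" for i
    define Q where "Q = mp_eval mp_const \<beta> P"
    have Q_eval: "mp_value (($$) g) (mp_eval mp_const \<beta> p) = mp_value (($) (g *\<^sub>v x)) p"
      if g: "g \<in> carrier_mat n n" and p: "mp_vars p \<subseteq> {..<n}" for g p
    proof (rule mp_eval_mp_eval[OF mp_const_hom ident_hom _ p])
      show "comm_semiring_hom (mp_value (($$) g))"
        by (rule comm_semiring_hom.mp_eval_hom[OF ident_hom])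
      show "mp_value (($$) g) (\<beta> i) = (g *\<^sub>v x) $ i" if "i \<in> {..<n}" for i
        using that g xc
        by (simp add: \<beta>_def mp_eval_id_sum mp_eval_id_mult mp_eval_var mp_eval_const scalar_prod_def
            lessThan_atLeast0)
    qed (simp add: mp_eval_const)
    have Qv: "mp_vars Q \<subseteq> ?N"
    proof -
      have "Q \<in> {Q. mp_vars Q \<subseteq> ?N}"
        unfolding Q_def
      proof (rule mp_eval_in_subring[OF mp_const_hom _ Pv])
        show "subring_set {Q :: (nat \<times> nat, complex) mpoly. mp_vars Q \<subseteq> ?N}"
          by (simp add: subring_set_def mp_vars_add mp_vars_mult)
        show "\<beta> i \<in> {Q. mp_vars Q \<subseteq> ?N}" if "i \<in> {..<n}" for i
          unfolding \<beta>_def mem_Collect_eq by (intro mp_vars_sum mp_vars_mult) (use that in auto)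
      qed simp
      then show ?thesis by simp
    qed
    have "mp_value (($$) g) Q = 0" if g: "g \<in> symmetry_group n X" for g
    proof -
      have "g *\<^sub>v x \<in> X" "g \<in> carrier_mat n n"
        using g x by (auto simp: symmetry_group_def)
      then show ?thesis
        unfolding Q_def using P by (simp add: Q_eval Pv vanishing_def)
    qed
    then have zero: "(\<Sum>ij\<in>?N. mp_value (($$) (1\<^sub>m n)) (mp_pderiv ij Q) * M $$ ij) = 0"
      using M Qv by (simp add: symmetry_algebra_def lie_algebra_def)
    have d: "mp_value (($$) (1\<^sub>m n)) (mp_pderiv (i, j) Q)
        = mp_value (($) x) (mp_pderiv i P) * x $ j" if "i < n" "j < n" for i j
    proof -
      have pd: "mp_pderiv (i, j) (\<beta> k) = (if k = i then mp_const (x $ j) else 0)" for k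
      proof -
        have "derivation_on UNIV (mp_pderiv (i, j) :: _ \<Rightarrow> (nat \<times> nat, complex) mpoly)"
          by (simp add: derivation_on_def mp_pderiv_add mp_pderiv_mult)
        then have "mp_pderiv (i, j) (\<beta> k) = (\<Sum>l<n. mp_pderiv (i, j) (mp_var (k, l) * mp_const (x $ l)))"
          unfolding \<beta>_def by (intro derivation_on_sum[of UNIV]) (auto simp: subring_set_def)
        also have "\<dots> = (\<Sum>l<n. if l = j then if k = i then mp_const (x $ j) else 0 else 0)"
          by (intro sum.cong refl) (auto simp: mp_pderiv_mult mp_pderiv_var)
        finally show ?thesis using that by simp
      qed
      have "mp_pderiv (i, j) Q = (\<Sum>k<n. mp_eval mp_const \<beta> (mp_pderiv k P) * mp_pderiv (i, j) (\<beta> k))"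
        unfolding Q_def
        by (rule derivation_mp_eval[OF mp_const_hom _ _ Pv, of UNIV])
           (auto simp: subring_set_def derivation_on_def mp_pderiv_add mp_pderiv_mult)
      also have "\<dots> = (\<Sum>k<n. if k = i then mp_eval mp_const \<beta> (mp_pderiv k P) * mp_const (x $ j) else 0)"
        unfolding pd by (intro sum.cong) auto
      finally have "mp_pderiv (i, j) Q = mp_eval mp_const \<beta> (mp_pderiv i P) * mp_const (x $ j)"
        using that by simp
      moreover have "1\<^sub>m n *\<^sub>v x = x" using xc by simp
      ultimately show ?thesis
        by (simp add: mp_eval_id_mult mp_eval_const Q_eval mp_vars_pderiv Pv)
    qed
    have "mp_value (($) x) (lie_deriv n M P)
        = (\<Sum>i<n. \<Sum>j<n. mp_value (($) x) (mp_pderiv i P) * x $ j * M $$ (i, j))"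
      by (simp add: mp_eval_lie_deriv[OF ident_hom] sum_distrib_left mult_ac)
    also have "\<dots> = (\<Sum>i<n. \<Sum>j<n. mp_value (($$) (1\<^sub>m n)) (mp_pderiv (i, j) Q) * M $$ (i, j))"
      by (intro sum.cong refl) (simp add: d)
    also have "\<dots> = 0"
      using zero by (simp add: sum.cartesian_product)
    finally show ?thesis .
  qed
  then show ?thesis
    by (simp add: vanishing_def mp_vars_lie_deriv Pv)
qed

text \<open>
  Along the curve \<open>t \<mapsto> exp(t M) x\<close>, differentiating a polynomial in \<open>t\<close> means applying the Lie derivative
  to it.  So all derivatives of \<open>P(exp(t M) x)\<close> at \<open>0\<close> vanish, and \<open>exp(t M)\<close> maps \<open>X\<close> into itself for all
  \<open>t\<close>; using \<open>-t\<close> as well, it is a symmetry of \<open>X\<close>.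
\<close>

lemma lie_deriv_vanishing_imp_symmetry_algebra:
  assumes M: "M \<in> carrier_mat n n"
    and inv: "\<And>P. P \<in> vanishing n X \<Longrightarrow> lie_deriv n M P \<in> vanishing n X"
    and X: "X \<subseteq> carrier_vec n"
      "\<And>x. x \<in> carrier_vec n \<Longrightarrow> (\<And>P. P \<in> vanishing n X \<Longrightarrow> mp_value (($) x) P = 0) \<Longrightarrow> x \<in> X"
  shows "M \<in> symmetry_algebra n X"
proof (rule matrix_exponential[of n M])
  fix E assume E: "\<And>t. E t \<in> carrier_mat n n" "E 0 = 1\<^sub>m n"
    "\<And>i j. i < n \<Longrightarrow> j < n \<Longrightarrow> entire (\<lambda>t. E t $$ (i, j))"
    "\<And>i j t. i < n \<Longrightarrow> j < n \<Longrightarrow>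
      ((\<lambda>t. E t $$ (i, j)) has_field_derivative (\<Sum>l<n. M $$ (i, l) * E t $$ (l, j))) (at t)"
    "\<And>t. E t * E (- t) = 1\<^sub>m n"
  have flow: "E t *\<^sub>v x \<in> X" if x: "x \<in> X" for t x
  proof (rule X(2))
    have xc: "x \<in> carrier_vec n" using X x by blast
    show "E t *\<^sub>v x \<in> carrier_vec n" by (rule mult_mat_vec_carrier[OF E(1) xc])
    have y: "(E t *\<^sub>v x) $ i = (\<Sum>j<n. E t $$ (i, j) * x $ j)" if "i < n" for i t
      using that E(1)[of t] xc by (simp add: scalar_prod_def lessThan_atLeast0)
    have dy: "((\<lambda>t. (E t *\<^sub>v x) $ i) has_field_derivative (\<Sum>j<n. M $$ (i, j) * (E t *\<^sub>v x) $ j)) (at t)"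
      if i: "i < n" for i t
    proof -
      have "((\<lambda>t. \<Sum>j<n. E t $$ (i, j) * x $ j) has_field_derivative
          (\<Sum>j<n. (\<Sum>l<n. M $$ (i, l) * E t $$ (l, j)) * x $ j)) (at t)"
        using i by (intro DERIV_sum DERIV_cmult_right E(4)) auto
      also have "(\<Sum>j<n. (\<Sum>l<n. M $$ (i, l) * E t $$ (l, j)) * x $ j) =
          (\<Sum>l<n. \<Sum>j<n. M $$ (i, l) * (E t $$ (l, j) * x $ j))"
        unfolding sum_distrib_right mult.assoc by (rule sum.swap)
      also have "\<dots> = (\<Sum>j<n. M $$ (i, j) * (E t *\<^sub>v x) $ j)"
        by (intro sum.cong refl) (simp add: y sum_distrib_left)
      finally show ?thesis using i by (simp add: y)
    qed
    fix P assume P: "P \<in> vanishing n X"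
    define p where "p k t = mp_value (($) (E t *\<^sub>v x)) ((lie_deriv n M ^^ k) P)" for k t
    have Pk: "(lie_deriv n M ^^ k) P \<in> vanishing n X" for k
      by (induction k) (simp_all add: P inv)
    then have Pkv: "mp_vars ((lie_deriv n M ^^ k) P) \<subseteq> {..<n}" for k
      by (simp add: vanishing_def)
    have "p 0 t = 0"
    proof (rule entire_eq_0[of p])
      have "entire (\<lambda>t. (E t *\<^sub>v x) $ i)" if "i \<in> {..<n}" for i
        using that by (simp add: y) (intro entire_sum entire_mult entire_const E(3), auto)
      then show "entire (p 0)"
        unfolding p_def by (intro entire_mp_eval[OF Pkv])
      fix k
      have "1\<^sub>m n *\<^sub>v x = x" using xc by simp
      then show "p k 0 = 0"
        using Pk[of k] x by (simp add: p_def E(2) vanishing_def)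
      fix t
      have "(p k has_field_derivative (\<Sum>i<n. mp_value (($) (E t *\<^sub>v x)) (mp_pderiv i ((lie_deriv n M ^^ k) P)) *
          (\<Sum>j<n. M $$ (i, j) * (E t *\<^sub>v x) $ j))) (at t)"
        unfolding p_def by (rule mp_eval_has_field_derivative[OF Pkv]) (simp_all add: dy)
      then show "(p k has_field_derivative p (Suc k) t) (at t)"
        by (simp add: p_def mp_eval_lie_deriv[OF ident_hom])
    qed
    then show "mp_value (($) (E t *\<^sub>v x)) P = 0"
      by (simp add: p_def)
  qed
  have group: "E t \<in> symmetry_group n X" for t
  proof -
    have "E (- t) * E t = 1\<^sub>m n" using E(5)[of "- t"] by simp
    then have "invertible_mat (E t)"
      using E(1)[of t] E(1)[of "- t"] E(5)[of t]
      by (auto simp: invertible_mat_def inverts_mat_def square_mat.simps intro!: exI[of _ "E (- t)"])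
    moreover have "X \<subseteq> (\<lambda>x. E t *\<^sub>v x) ` X"
    proof
      fix x assume x: "x \<in> X"
      then have "x \<in> carrier_vec n" using X by blast
      then have "E t *\<^sub>v (E (- t) *\<^sub>v x) = x"
        using E(1)[of t] E(1)[of "- t"] E(5)[of t] by (simp add: assoc_mult_mat_vec[symmetric])
      then show "x \<in> (\<lambda>x. E t *\<^sub>v x) ` X"
        using flow[OF x, of "- t"] by (intro image_eqI[of _ _ "E (- t) *\<^sub>v x"]) simp_all
    qed
    ultimately show ?thesis
      using E(1) flow by (auto simp: symmetry_group_def)
  qed
  show "M \<in> symmetry_algebra n X"
    unfolding symmetry_algebra_def lie_algebra_def
  proof (intro CollectI conjI allI impI M)
    fix Q :: "(nat \<times> nat, complex) mpoly"
    assume Q: "mp_vars Q \<subseteq> {..<n} \<times> {..<n}" "\<forall>g\<in>symmetry_group n X. mp_value (($$) g) Q = 0"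
    have "((\<lambda>t. mp_value (($$) (E t)) Q) has_field_derivative
      (\<Sum>ij\<in>{..<n} \<times> {..<n}. mp_value (($$) (E 0)) (mp_pderiv ij Q) *
        (\<Sum>l<n. M $$ (fst ij, l) * E 0 $$ (l, snd ij)))) (at 0)"
      by (rule mp_eval_has_field_derivative[OF Q(1)]) (use E(4) in auto)
    moreover have "(\<lambda>t. mp_value (($$) (E t)) Q) = (\<lambda>t. 0)"
      using Q(2) group by auto
    ultimately have "((\<lambda>t. 0) has_field_derivative
      (\<Sum>ij\<in>{..<n} \<times> {..<n}. mp_value (($$) (E 0)) (mp_pderiv ij Q) *
        (\<Sum>l<n. M $$ (fst ij, l) * E 0 $$ (l, snd ij)))) (at 0)"
      by (simp only:)
    from DERIV_unique[OF this DERIV_const]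
    have zero: "(\<Sum>ij\<in>{..<n} \<times> {..<n}. mp_value (($$) (E 0)) (mp_pderiv ij Q) *
        (\<Sum>l<n. M $$ (fst ij, l) * E 0 $$ (l, snd ij))) = 0" .
    have "(\<Sum>l<n. M $$ (i, l) * E 0 $$ (l, j)) = M $$ (i, j)" if "i < n" "j < n" for i j
    proof -
      have "(\<Sum>l<n. M $$ (i, l) * E 0 $$ (l, j)) = (\<Sum>l<n. if l = j then M $$ (i, l) else 0)"
        using that E(2) by (intro sum.cong) auto
      then show ?thesis using that by simp
    qed
    then have "(\<Sum>ij\<in>{..<n} \<times> {..<n}. mp_value (($$) (E 0)) (mp_pderiv ij Q) *
        (\<Sum>l<n. M $$ (fst ij, l) * E 0 $$ (l, snd ij))) =
      (\<Sum>ij\<in>{..<n} \<times> {..<n}. mp_value (($$) (1\<^sub>m n)) (mp_pderiv ij Q) * M $$ ij)"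
      by (intro sum.cong refl) (auto simp: E(2))
    with zero show "(\<Sum>ij\<in>{..<n} \<times> {..<n}. mp_value (($$) (1\<^sub>m n)) (mp_pderiv ij Q) * M $$ ij) = 0"
      by (simp only:)
  qed
qed

section \<open>Descent from complex to rational matrices\<close>

text \<open>
  Coordinates with respect to a basis of \<open>\<complex>\<close> as a vector space over \<open>\<rat>\<close>.  They are indexed by the
  elements \<open>b\<close> of the basis and are zero for all other complex numbers \<open>b\<close>.
\<close>

lemma rational_coordinates:
  obtains \<pi> :: "complex \<Rightarrow> complex \<Rightarrow> rat" where
    "\<And>b z w. \<pi> b (z + w) = \<pi> b z + \<pi> b w"
    "\<And>b r z. \<pi> b (of_rat r * z) = r * \<pi> b z"
    "\<And>z. finite {b. \<pi> b z \<noteq> 0}"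
    "\<And>z. z = (\<Sum>b | \<pi> b z \<noteq> 0. of_rat (\<pi> b z) * b)"
proof -
  interpret Q: vector_space "\<lambda>(r :: rat) (z :: complex). of_rat r * z"
    by unfold_locales (simp_all add: distrib_left distrib_right of_rat_add of_rat_mult)
  define B where "B = Q.extend_basis {}"
  have B: "Q.independent B" "Q.span B = UNIV"
    using Q.independent_extend_basis[OF Q.independent_empty] Q.span_extend_basis[OF Q.independent_empty]
    by (simp_all add: B_def)
  show thesis
  proof (rule that[of "\<lambda>b z. Q.representation B z b"])
    show "Q.representation B (z + w) b = Q.representation B z b + Q.representation B w b" for b z w
      using Q.representation_add[OF B(1), of w z] B(2) by simp
    show "Q.representation B (of_rat r * z) b = r * Q.representation B z b" for b r z
      using Q.representation_scale[OF B(1), of z r] B(2) by simp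
    show "finite {b. Q.representation B z b \<noteq> 0}" for z
      by (rule Q.finite_representation)
    show "z = (\<Sum>b | Q.representation B z b \<noteq> 0. of_rat (Q.representation B z b) * b)" for z
      using Q.sum_nonzero_representation_eq[OF B(1), of z] B(2) by simp
  qed
qed

definition mp_of_rat :: "('v, rat) mpoly \<Rightarrow> ('v, complex) mpoly" where
  "mp_of_rat = mp_eval (\<lambda>c. mp_const (of_rat c)) mp_var"

lemma mp_const_of_rat_hom: "comm_semiring_hom (\<lambda>c. mp_const (of_rat c :: complex))"
  by unfold_locales (simp_all add: mp_const_add mp_const_mult of_rat_add of_rat_mult)

lemma mp_eval_mp_of_rat: "mp_value \<alpha> (mp_of_rat P) = mp_eval of_rat \<alpha> P"
  unfolding mp_of_rat_def
  by (rule mp_eval_mp_eval[OF mp_const_of_rat_hom of_rat_semiring_hom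
        comm_semiring_hom.mp_eval_hom[OF ident_hom], of P UNIV])
     (simp_all add: mp_eval_const mp_eval_var)

lemma mp_vars_mp_of_rat:
  assumes "mp_vars P \<subseteq> V"
  shows "mp_vars (mp_of_rat P) \<subseteq> V"
proof -
  have "mp_of_rat P \<in> {p. mp_vars p \<subseteq> V}"
    unfolding mp_of_rat_def
    by (rule mp_eval_in_subring[OF mp_const_of_rat_hom _ assms])
       (auto simp: subring_set_def mp_vars_add mp_vars_mult)
  then show ?thesis by simp
qed

lemma mp_pderiv_mp_of_rat: 
  fixes P :: "(nat, rat) mpoly"
  assumes "mp_vars P \<subseteq> {..<n}"
  shows "mp_pderiv i (mp_of_rat P) = mp_of_rat (mp_pderiv i P)"
proof -
  interpret h: comm_semiring_hom "\<lambda>c. mp_const (of_rat c :: complex)"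
    by (rule mp_const_of_rat_hom)
  have v: "mp_vars P \<subseteq> insert i {..<n}" using assms by blast
  have "mp_pderiv i (mp_of_rat P) = (\<Sum>v\<in>insert i {..<n}. mp_of_rat (mp_pderiv v P) * mp_pderiv i (mp_var v))"
    unfolding mp_of_rat_def
    by (rule derivation_mp_eval[OF mp_const_of_rat_hom _ _ v, of UNIV])
       (auto simp: subring_set_def derivation_on_def mp_pderiv_add mp_pderiv_mult)
  also have "\<dots> = (\<Sum>v\<in>insert i {..<n}. if v = i then mp_of_rat (mp_pderiv v P) else 0)"
    by (intro sum.cong) (auto simp: mp_pderiv_var)
  finally show ?thesis by simp
qed

lemma mp_monom_var: "mp_monom mp_var \<mu> = (Poly_Mapping.single \<mu> 1 :: ('v, 'a::comm_semiring_1) mpoly)"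
proof -
  have "mp_eval mp_const mp_var (Poly_Mapping.single \<mu> (1 :: 'a)) = mp_monom mp_var \<mu>"
    by (simp add: mp_eval_single)
  then show ?thesis by (simp add: mp_eval_generic)
qed

lemma mp_of_rat_single: "mp_of_rat (Poly_Mapping.single \<mu> c) = Poly_Mapping.single \<mu> (of_rat c)"
  by (simp add: mp_of_rat_def mp_eval_single mp_monom_var mp_const_def mult_single)

lemma mp_of_rat_sum: "mp_of_rat (\<Sum>i\<in>I. p i) = (\<Sum>i\<in>I. mp_of_rat (p i))"
  unfolding mp_of_rat_def by (rule comm_semiring_hom.mp_eval_sum[OF mp_const_of_rat_hom])

lemma mp_eval_lie_deriv_of_rat:
  assumes "mp_vars P \<subseteq> {..<n}" "N \<in> carrier_mat n n"
  shows "mp_value \<alpha> (lie_deriv n (map_mat of_rat N) (mp_of_rat P)) = mp_eval of_rat \<alpha> (lie_deriv n N P)"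
  unfolding mp_eval_lie_deriv[OF ident_hom] mp_eval_lie_deriv[OF of_rat_semiring_hom]
    mp_pderiv_mp_of_rat[OF assms(1)] mp_eval_mp_of_rat
  using assms(2) by (intro sum.cong refl arg_cong2[of _ _ _ _ "(*)"]) auto

lemma lie_deriv_sum: "lie_deriv n M (\<Sum>i\<in>I. p i) = (\<Sum>i\<in>I. lie_deriv n M (p i))"
proof (induction I rule: infinite_finite_induct)
  case (insert i I)
  have "lie_deriv n M (p + q) = lie_deriv n M p + lie_deriv n M q" for p q
    by (simp add: lie_deriv_def mp_pderiv_add distrib_right sum.distrib)
  then show ?case using insert by simp
qed (simp_all add: lie_deriv_def mp_pderiv_def)

lemma lie_deriv_const_mult: "lie_deriv n M (mp_const c * p) = mp_const c * lie_deriv n M p"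
  by (simp add: lie_deriv_def mp_pderiv_mult sum_distrib_left mult_ac)

text \<open>
  This condition links the geometry of \<open>X\<close> to the column space of the Jacobian.
\<close>

definition preserves_relations :: "nat \<Rightarrow> ratfun vec \<Rightarrow> rat mat set" where
  "preserves_relations n \<phi> = {N \<in> carrier_mat n n. \<forall>P. mp_vars P \<subseteq> {..<n} \<longrightarrow>
     rf_eval (($) \<phi>) P = 0 \<longrightarrow> rf_eval (($) \<phi>) (lie_deriv n N P) = 0}"

locale rational_parametrization =
  fixes m n :: nat and \<phi> :: "ratfun vec" and X :: "complex vec set"
  assumes \<phi>: "\<phi> \<in> carrier_vec n" "\<And>i. i < n \<Longrightarrow> \<phi> $ i \<in> rat_functions m"
    and X: "X = zariski_closure n (rat_map_image m n \<phi>)"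
begin

abbreviation im where "im \<equiv> rat_map_image m n \<phi>"

lemma vanishing_closure: "vanishing n X = vanishing n im"
proof -
  have "im \<subseteq> X" 
    by (auto simp: X zariski_closure_def rat_map_image_def)
  then show ?thesis
    by (auto simp: vanishing_def X zariski_closure_def)
qed

lemma X_carrier: "X \<subseteq> carrier_vec n"
  by (auto simp: X zariski_closure_def)

lemma X_closed:
  assumes "x \<in> carrier_vec n" "\<And>P. P \<in> vanishing n X \<Longrightarrow> mp_value (($) x) P = 0"
  shows "x \<in> X"
  using assms unfolding vanishing_closure by (auto simp: X zariski_closure_def vanishing_def)

lemma relation_iff_vanishing:
  assumes "mp_vars P \<subseteq> {..<n}"
  shows "rf_eval (($) \<phi>) P = 0 \<longleftrightarrow> (\<forall>y\<in>im. mp_eval of_rat (($) y) P = 0)"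
proof
  assume "rf_eval (($) \<phi>) P = 0"
  then show "\<forall>y\<in>im. mp_eval of_rat (($) y) P = 0"
    using relation_vanishes_on_image assms by blast
next
  assume van: "\<forall>y\<in>im. mp_eval of_rat (($) y) P = 0"
  show "rf_eval (($) \<phi>) P = 0"
  proof (rule ccontr)
    assume "rf_eval (($) \<phi>) P \<noteq> 0"
    then obtain y where y: "vec n (\<lambda>i. of_rat (y i)) \<in> im" "mp_value y P \<noteq> 0"
      using nonrelation_nonzero_at_rational_point[OF \<phi>(2) _ assms] by blast
    have "mp_eval of_rat (($) (vec n (\<lambda>i. of_rat (y i) :: complex))) P = of_rat (mp_value y P)"
      by (rule mp_eval_mp_eval[OF ident_hom of_rat_semiring_hom of_rat_semiring_hom,
            symmetric, of P "{..<n}"]) (use assms in auto)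
    then show False using van y by auto
  qed
qed

text \<open>
  For a rational relation \<open>P\<close> and a rational point \<open>y\<close> of the image, \<open>(D\<^sub>M P)(y) = 0\<close> is a linear equation
  in the entries of \<open>M\<close> with rational coefficients, so every \<open>\<rat>\<close>-linear functional \<open>\<pi>\<close> on \<open>\<complex>\<close> can be
  applied to it.  The resulting equations at all rational points make \<open>D\<^bsub>\<pi>(M)\<^esub> P\<close> a relation.
\<close>

lemma coordinates_of_symmetry_preserve_relations:
  assumes M: "M \<in> symmetry_algebra n X"
    and \<pi>: "\<And>z w. \<pi> (z + w) = \<pi> z + \<pi> w" "\<And>r z. \<pi> (of_rat r * z) = r * (\<pi> z :: rat)"
  shows "map_mat \<pi> M \<in> preserves_relations n \<phi>"
proof -
  have Mc: "M \<in> carrier_mat n n"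
    using M by (simp add: symmetry_algebra_def lie_algebra_def)
  have \<pi>0: "\<pi> 0 = 0" using \<pi>(1)[of 0 0] by simp
  have \<pi>_sum: "\<pi> (\<Sum>i\<in>I. f i) = (\<Sum>i\<in>I. \<pi> (f i))" for f :: "nat \<Rightarrow> complex" and I
    by (induction I rule: infinite_finite_induct) (simp_all add: \<pi>0 \<pi>(1))
  have \<pi>2: "\<pi> (z * of_rat r) = \<pi> z * r" for z r
    using \<pi>(2)[of r z] by (simp add: mult.commute)
  have "rf_eval (($) \<phi>) (lie_deriv n (map_mat \<pi> M) P) = 0"
    if P: "mp_vars P \<subseteq> {..<n}" "rf_eval (($) \<phi>) P = 0" for P
  proof (rule ccontr)
    assume "rf_eval (($) \<phi>) (lie_deriv n (map_mat \<pi> M) P) \<noteq> 0"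
    then obtain y where y: "vec n (\<lambda>i. of_rat (y i)) \<in> im"
      "mp_value y (lie_deriv n (map_mat \<pi> M) P) \<noteq> 0"
      using nonrelation_nonzero_at_rational_point[OF \<phi>(2) _ mp_vars_lie_deriv[OF P(1)]] by blast
    let ?y = "vec n (\<lambda>i. of_rat (y i) :: complex)"
    have ev: "mp_eval of_rat (($) ?y) p = of_rat (mp_value y p)" if "mp_vars p \<subseteq> {..<n}" for p
      by (rule mp_eval_mp_eval[OF ident_hom of_rat_semiring_hom of_rat_semiring_hom,
            symmetric, OF that]) auto
    have "mp_of_rat P \<in> vanishing n im"
      using relation_iff_vanishing[OF P(1)] P(2)
      by (simp add: vanishing_def mp_vars_mp_of_rat P(1) mp_eval_mp_of_rat)
    then have "lie_deriv n M (mp_of_rat P) \<in> vanishing n im"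
      using symmetry_algebra_imp_lie_deriv_vanishing[OF M _ X_carrier, of "mp_of_rat P"]
      unfolding vanishing_closure by blast
    then have "mp_value (($) ?y) (lie_deriv n M (mp_of_rat P)) = 0"
      using y(1) by (simp add: vanishing_def)
    then have "(\<Sum>i<n. of_rat (mp_value y (mp_pderiv i P)) * (\<Sum>j<n. M $$ (i, j) * of_rat (y j))) = 0"
      by (simp add: mp_eval_lie_deriv[OF ident_hom] mp_pderiv_mp_of_rat[OF P(1)]
          mp_eval_mp_of_rat ev mp_vars_pderiv[OF P(1)])
    then have "\<pi> (\<Sum>i<n. of_rat (mp_value y (mp_pderiv i P)) * (\<Sum>j<n. M $$ (i, j) * of_rat (y j))) = 0"
      by (simp only: \<pi>0)
    then have "(\<Sum>i<n. mp_value y (mp_pderiv i P) * (\<Sum>j<n. \<pi> (M $$ (i, j)) * y j)) = 0"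
      by (simp only: \<pi>_sum \<pi>(2) \<pi>2)
    then have "mp_value y (lie_deriv n (map_mat \<pi> M) P) = 0"
      using Mc by (simp add: mp_eval_lie_deriv[OF ident_hom])
    then show False using y(2) by simp
  qed
  then show ?thesis
    using Mc by (simp add: preserves_relations_def)
qed

text \<open>
  A complex polynomial that vanishes on \<open>X\<close> is a complex combination of rational relations: its
  coordinates over \<open>\<rat>\<close> vanish at the rational points of the image, hence are relations.  So it
  suffices that the Lie derivative preserves rational relations.
\<close>

lemma preserves_relations_imp_symmetry:
  assumes N: "N \<in> preserves_relations n \<phi>"
  shows "map_mat of_rat N \<in> symmetry_algebra n X"
proof (rule lie_deriv_vanishing_imp_symmetry_algebra[OF _ _ X_carrier X_closed])
  have Nc: "N \<in> carrier_mat n n" using N by (simp add: preserves_relations_def)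
  then show "map_mat of_rat N \<in> carrier_mat n n" by simp
  fix P assume P: "P \<in> vanishing n X"
  then have Pv: "mp_vars P \<subseteq> {..<n}" by (simp add: vanishing_def)
  obtain \<pi> :: "complex \<Rightarrow> complex \<Rightarrow> rat" where \<pi>: "\<And>b z w. \<pi> b (z + w) = \<pi> b z + \<pi> b w"
    "\<And>b r z. \<pi> b (of_rat r * z) = r * \<pi> b z"
    "\<And>z. finite {b. \<pi> b z \<noteq> 0}"
    "\<And>z. z = (\<Sum>b | \<pi> b z \<noteq> 0. of_rat (\<pi> b z) * b)"
    by (rule rational_coordinates) blast
  have \<pi>0: "\<pi> b 0 = 0" for b using \<pi>(1)[of b 0 0] by simp
  have \<pi>_sum: "\<pi> b (\<Sum>i\<in>I. f i) = (\<Sum>i\<in>I. \<pi> b (f i))" for b and f :: "(nat \<Rightarrow>\<^sub>0 nat) \<Rightarrow> complex" and I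
    by (induction I rule: infinite_finite_induct) (simp_all add: \<pi>0 \<pi>(1))
  let ?K = "Poly_Mapping.keys P"
  \<comment> \<open>The polynomial of the \<open>b\<close>-th coordinates of the coefficients of \<open>P\<close>.\<close>
  define C where "C b = (\<Sum>\<mu>\<in>?K. Poly_Mapping.single \<mu> (\<pi> b (Poly_Mapping.lookup P \<mu>)))" for b
  have Cv: "mp_vars (C b) \<subseteq> {..<n}" for b
    unfolding C_def
  proof (rule mp_vars_sum)
    fix \<mu> assume "\<mu> \<in> ?K"
    then show "mp_vars (Poly_Mapping.single \<mu> (\<pi> b (Poly_Mapping.lookup P \<mu>))) \<subseteq> {..<n}"
      using Pv by (auto simp: mp_vars_def)
  qed
  define F where "F = (\<Union>\<mu>\<in>?K. {b. \<pi> b (Poly_Mapping.lookup P \<mu>) \<noteq> 0})"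
  have F: "finite F" by (simp add: F_def \<pi>(3))
  have decomp: "P = (\<Sum>b\<in>F. mp_const b * mp_of_rat (C b))"
  proof -
    have "Poly_Mapping.single \<mu> (Poly_Mapping.lookup P \<mu>) =
        (\<Sum>b\<in>F. mp_const b * Poly_Mapping.single \<mu> (of_rat (\<pi> b (Poly_Mapping.lookup P \<mu>))))"
      if "\<mu> \<in> ?K" for \<mu>
    proof -
      let ?c = "Poly_Mapping.lookup P \<mu>"
      have "?c = (\<Sum>b\<in>F. of_rat (\<pi> b ?c) * b)"
        by (subst \<pi>(4), rule sum.mono_neutral_left) (use F that in \<open>auto simp: F_def\<close>)
      then have "Poly_Mapping.single \<mu> ?c = Poly_Mapping.single \<mu> (\<Sum>b\<in>F. of_rat (\<pi> b ?c) * b)"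
        by (rule arg_cong)
      also have "\<dots> = (\<Sum>b\<in>F. Poly_Mapping.single \<mu> (of_rat (\<pi> b ?c) * b))"
        by (rule poly_mapping_eqI) (simp add: lookup_sum lookup_single when_def)
      finally show ?thesis
        by (simp add: mp_const_def mult_single mult.commute)
    qed
    then have "(\<Sum>\<mu>\<in>?K. Poly_Mapping.single \<mu> (Poly_Mapping.lookup P \<mu>)) =
        (\<Sum>\<mu>\<in>?K. \<Sum>b\<in>F. mp_const b * Poly_Mapping.single \<mu> (of_rat (\<pi> b (Poly_Mapping.lookup P \<mu>))))"
      by (intro sum.cong refl)
    also have "\<dots> = (\<Sum>b\<in>F. mp_const b * mp_of_rat (C b))"
      unfolding C_def mp_of_rat_sum mp_of_rat_single sum_distrib_left by (rule sum.swap)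
    finally show ?thesis unfolding mp_sum_monomials[symmetric] .
  qed
  have rel: "rf_eval (($) \<phi>) (C b) = 0" for b
  proof (rule ccontr)
    assume "rf_eval (($) \<phi>) (C b) \<noteq> 0"
    then obtain y where y: "vec n (\<lambda>i. of_rat (y i)) \<in> im" "mp_value y (C b) \<noteq> 0"
      using nonrelation_nonzero_at_rational_point[OF \<phi>(2) _ Cv] by blast
    have "mp_value (($) (vec n (\<lambda>i. of_rat (y i)))) P = 0"
      using P y(1) unfolding vanishing_closure by (simp add: vanishing_def)
    also have "mp_value (($) (vec n (\<lambda>i. of_rat (y i)))) P = mp_value (\<lambda>i. of_rat (y i)) P"
      by (rule mp_eval_cong) (use Pv in auto)
    also have "\<dots> = (\<Sum>\<mu>\<in>?K. of_rat (mp_monom y \<mu>) * Poly_Mapping.lookup P \<mu>)"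
      by (simp add: mp_eval_superset[of _ ?K] mp_monom_def of_rat_prod of_rat_power mult.commute)
    finally have "\<pi> b (\<Sum>\<mu>\<in>?K. of_rat (mp_monom y \<mu>) * Poly_Mapping.lookup P \<mu>) = 0"
      by (simp only: \<pi>0)
    then have "(\<Sum>\<mu>\<in>?K. mp_monom y \<mu> * \<pi> b (Poly_Mapping.lookup P \<mu>)) = 0"
      by (simp only: \<pi>_sum \<pi>(2))
    then have "mp_value y (C b) = 0"
      by (simp add: C_def mp_eval_id_sum mp_eval_single mult.commute)
    then show False using y(2) by simp
  qed
  have "mp_value (($) x) (lie_deriv n (map_mat of_rat N) P) = 0" if x: "x \<in> im" for x
  proof -
    have "rf_eval (($) \<phi>) (lie_deriv n N (C b)) = 0" for b
      using N rel Cv by (simp add: preserves_relations_def)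
    then have "mp_eval of_rat (($) x) (lie_deriv n N (C b)) = 0" for b
      using relation_vanishes_on_image[OF _ mp_vars_lie_deriv[OF Cv] x] by blast
    then have "mp_value (($) x) (lie_deriv n (map_mat of_rat N) (mp_of_rat (C b))) = 0" for b
      by (simp add: mp_eval_lie_deriv_of_rat[OF Cv Nc])
    then show ?thesis
      by (subst decomp) (simp add: lie_deriv_sum lie_deriv_const_mult mp_eval_id_sum mp_eval_id_mult)
  qed
  then show "lie_deriv n (map_mat of_rat N) P \<in> vanishing n X"
    unfolding vanishing_closure by (simp add: vanishing_def mp_vars_lie_deriv Pv)
qed

lemma preserves_relations_iff_tangent:
  "preserves_relations n \<phi> = {N \<in> carrier_mat n n.
     \<exists>w. \<forall>i<n. (\<Sum>j<n. rf_const (N $$ (i, j)) * \<phi> $ j) = (\<Sum>j<m. jacobian m n \<phi> $$ (i, j) * w j)}"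
proof -
  have J: "(\<exists>w. \<forall>i<n. v i = (\<Sum>j<m. jacobian m n \<phi> $$ (i, j) * w j)) \<longleftrightarrow>
      (\<forall>P. mp_vars P \<subseteq> {..<n} \<longrightarrow> rf_eval (($) \<phi>) P = 0 \<longrightarrow>
        (\<Sum>i<n. rf_eval (($) \<phi>) (mp_pderiv i P) * v i) = 0)" for v
  proof -
    have "(\<exists>w. \<forall>i<n. v i = (\<Sum>j<m. jacobian m n \<phi> $$ (i, j) * w j)) \<longleftrightarrow>
      (\<exists>w. \<forall>i<n. v i = (\<Sum>j<m. rf_pderiv j (\<phi> $ i) * w j))"
      by (simp add: jacobian_def)
    also have "\<dots> \<longleftrightarrow> (\<forall>P. mp_vars P \<subseteq> {..<n} \<longrightarrow> rf_eval (($) \<phi>) P = 0 \<longrightarrow>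
        (\<Sum>i<n. rf_eval (($) \<phi>) (mp_pderiv i P) * v i) = 0)"
      by (rule jacobian_image_iff_annihilates_relations) (rule \<phi>(2))
    finally show ?thesis .
  qed
  show ?thesis
    unfolding preserves_relations_def J mp_eval_lie_deriv[OF rf_const_hom] by (rule refl)
qed

end

section \<open>The linear forms of the algorithm\<close>

lemma Fract_eq_0_iff: "b \<noteq> 0 \<Longrightarrow> Fract a b = 0 \<longleftrightarrow> a = 0"
  by (simp add: Zero_fract_def eq_fract)

lemma lookup_mult_const:
  "Poly_Mapping.lookup (p * mp_const c) \<mu> = Poly_Mapping.lookup p \<mu> * (c :: 'a::comm_semiring_1)"
  by (induction p rule: mp_induct)
     (simp_all add: mp_const_def mult_single lookup_single when_def lookup_add distrib_right)

lemma lookup_x_coeff: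
  "Poly_Mapping.lookup (x_coeff \<mu> e') \<nu> = Poly_Mapping.lookup (Poly_Mapping.lookup e' \<nu>) \<mu>"
  by (simp add: x_coeff_def Poly_Mapping.map.rep_eq when_def)

lemma mp_monom_rf_const: "mp_monom (\<lambda>v. rf_const (\<alpha> v)) \<nu> = rf_const (mp_monom \<alpha> \<nu>)"
proof -
  have "rf_const (mp_value \<alpha> (Poly_Mapping.single \<nu> 1)) =
      rf_eval (\<lambda>v. rf_const (\<alpha> v)) (Poly_Mapping.single \<nu> 1)"
    by (rule mp_eval_mp_eval[OF ident_hom rf_const_hom rf_const_hom, of _ UNIV]) auto
  then show ?thesis by (simp add: mp_eval_single)
qed

text \<open>
  Specialising the variables \<open>a\<^bsub>ij\<^esub>\<close> to rational numbers turns the numerator into a polynomial in the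
  \<open>x\<^sub>i\<close> over \<open>\<rat>\<close>, whose coefficients are the specialisations of the forms \<^const>\<open>x_coeff\<close>.
\<close>

lemma numerator_vanishes_iff:
  assumes "is_numerator m e e'"
  shows "mp_value (\<lambda>ij. rf_const (\<alpha> ij)) e = 0 \<longleftrightarrow>
    (\<forall>\<mu>. mp_value \<alpha> (x_coeff \<mu> e') = 0)"
proof -
  obtain h where h: "h \<noteq> 0" "\<And>\<nu>. Poly_Mapping.lookup e \<nu> = Fract (Poly_Mapping.lookup e' \<nu>) h"
    using assms by (auto simp: is_numerator_def)
  define K where "K = Poly_Mapping.keys e \<union> Poly_Mapping.keys e'"
  have K: "finite K" "Poly_Mapping.keys e \<subseteq> K" "Poly_Mapping.keys e' \<subseteq> K"
    by (simp_all add: K_def)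
  define G where "G = (\<Sum>\<nu>\<in>K. Poly_Mapping.lookup e' \<nu> * mp_const (mp_monom \<alpha> \<nu>))"
  interpret F: comm_semiring_hom "\<lambda>p. Fract p 1 :: ratfun" by (rule Fract_1_hom)
  have "mp_value (\<lambda>ij. rf_const (\<alpha> ij)) e
      = (\<Sum>\<nu>\<in>K. Fract (Poly_Mapping.lookup e' \<nu> * mp_const (mp_monom \<alpha> \<nu>)) 1 * Fract 1 h)"
    unfolding mp_eval_superset[where \<iota> = "\<lambda>c. c", OF refl K(1,2)] mp_monom_rf_const h(2)
    by (intro sum.cong refl) (simp add: rf_const_def)
  also have "\<dots> = Fract G 1 * Fract 1 h"
    by (simp only: G_def F.hom_sum sum_distrib_right)
  finally have "mp_value (\<lambda>ij. rf_const (\<alpha> ij)) e = 0 \<longleftrightarrow> Fract G h = 0"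
    by simp
  also have "\<dots> \<longleftrightarrow> G = 0"
    by (rule Fract_eq_0_iff[OF h(1)])
  also have "\<dots> \<longleftrightarrow> (\<forall>\<mu>. Poly_Mapping.lookup G \<mu> = 0)"
    by (simp add: poly_mapping_eq_iff fun_eq_iff)
  also have "\<dots> \<longleftrightarrow> (\<forall>\<mu>. mp_value \<alpha> (x_coeff \<mu> e') = 0)"
  proof -
    have "Poly_Mapping.lookup G \<mu> = mp_value \<alpha> (x_coeff \<mu> e')" for \<mu>
    proof -
      have "Poly_Mapping.keys (x_coeff \<mu> e') \<subseteq> K"
      proof
        fix \<nu> assume "\<nu> \<in> Poly_Mapping.keys (x_coeff \<mu> e')"
        then have "Poly_Mapping.lookup e' \<nu> \<noteq> 0"
          unfolding in_keys_iff lookup_x_coeff by (metis lookup_zero)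
        then show "\<nu> \<in> K"
          using K(3) by (auto simp: in_keys_iff)
      qed
      then show ?thesis
        by (simp add: mp_eval_superset[OF _ K(1)] G_def lookup_sum lookup_mult_const lookup_x_coeff)
    qed
    then show ?thesis by simp
  qed
  finally show ?thesis .
qed

lemma common_denominator:
  assumes "finite T" "T \<subseteq> rat_functions m"
  shows "\<exists>h\<in>polys_in m. h \<noteq> 0 \<and> (\<forall>f\<in>T. \<exists>p\<in>polys_in m. f = Fract p h)"
  using assms
proof (induction T rule: finite_induct)
  case empty
  show ?case by (intro bexI[of _ 1]) (simp_all add: polys_in_closed)
next
  case (insert f T)
  then obtain h where h: "h \<in> polys_in m" "h \<noteq> 0" "\<forall>g\<in>T. \<exists>p\<in>polys_in m. g = Fract p h"
    by auto
  obtain a b where ab: "f = Fract a b" "a \<in> polys_in m" "b \<in> polys_in m" "b \<noteq> 0"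
    using insert.prems by (auto elim: rat_functionsE)
  show ?case
  proof (rule bexI[of _ "h * b"], intro conjI ballI)
    show "h * b \<in> polys_in m" "h * b \<noteq> 0"
      using h ab by (simp_all add: polys_in_closed)
    fix g assume "g \<in> insert f T"
    then consider "g = f" | "g \<in> T" by blast
    then show "\<exists>p\<in>polys_in m. g = Fract p (h * b)"
    proof cases
      case 1
      then show ?thesis
        using h ab by (intro bexI[of _ "h * a"]) (simp_all add: eq_fract polys_in_closed mult_ac)
    next
      case 2
      then obtain p where "p \<in> polys_in m" "g = Fract p h" using h by blast
      then show ?thesis
        using h ab by (intro bexI[of _ "p * b"]) (simp_all add: eq_fract polys_in_closed mult_ac)
    qed
  qed
qed

lemma numerator_exists:
  assumes "\<And>\<nu>. Poly_Mapping.lookup e \<nu> \<in> rat_functions m"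
  shows "\<exists>e'. is_numerator m e e'"
proof -
  let ?T = "Poly_Mapping.lookup e ` Poly_Mapping.keys e"
  have "finite ?T" "?T \<subseteq> rat_functions m" using assms by auto
  then obtain h where h: "h \<in> polys_in m" "h \<noteq> 0" "\<forall>f\<in>?T. \<exists>p\<in>polys_in m. f = Fract p h"
    using common_denominator by meson
  then obtain p where p: "\<And>f. f \<in> ?T \<Longrightarrow> p f \<in> polys_in m" "\<And>f. f \<in> ?T \<Longrightarrow> f = Fract (p f) h"
    by metis
  define e' where "e' = (\<Sum>\<nu>\<in>Poly_Mapping.keys e. Poly_Mapping.single \<nu> (p (Poly_Mapping.lookup e \<nu>)))"
  have look: "Poly_Mapping.lookup e' \<nu> = (if \<nu> \<in> Poly_Mapping.keys e then p (Poly_Mapping.lookup e \<nu>) else 0)" for \<nu>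
    by (simp add: e'_def lookup_sum lookup_single when_def)
  have "is_numerator m e e'"
    unfolding is_numerator_def
  proof (intro bexI[of _ h] conjI allI h)
    fix \<nu>
    show "Poly_Mapping.lookup e' \<nu> \<in> polys_in m"
      using p(1) by (simp add: look polys_in_closed)
    show "Poly_Mapping.lookup e \<nu> = Fract (Poly_Mapping.lookup e' \<nu>) h"
    proof (cases "\<nu> \<in> Poly_Mapping.keys e")
      case True
      then show ?thesis using p(2)[of "Poly_Mapping.lookup e \<nu>"] by (simp add: look)
    next
      case False
      then show ?thesis using h(2) by (simp add: look in_keys_iff Zero_fract_def eq_fract)
    qed
  qed
  then show ?thesis by blast
qed

lemma subring_coefficients:
  assumes R: "subring_set (R :: 'a::comm_ring_1 set)"
  shows "subring_set {p :: ('v, 'a) mpoly. \<forall>\<nu>. Poly_Mapping.lookup p \<nu> \<in> R}"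
  unfolding subring_set_def
proof (intro conjI ballI)
  let ?C = "{p :: ('v, 'a) mpoly. \<forall>\<nu>. Poly_Mapping.lookup p \<nu> \<in> R}"
  have zero: "0 \<in> R" by (rule subring_set_0[OF R])
  have single: "Poly_Mapping.single \<mu> c \<in> ?C" if "c \<in> R" for \<mu> :: "'v \<Rightarrow>\<^sub>0 nat" and c
    using that zero by (auto simp: lookup_single when_def)
  have sums: "(\<Sum>i\<in>I. f i) \<in> ?C" if "\<And>i. i \<in> I \<Longrightarrow> f i \<in> ?C" for I :: "('v \<Rightarrow>\<^sub>0 nat) set" and f
    using that by (auto simp: lookup_sum intro!: subring_set_sum[OF R])
  show "1 \<in> ?C"
    using single[OF subring_setD(1)[OF R], of 0] by simp
  fix p q assume pq: "p \<in> ?C" "q \<in> ?C"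
  then show "p + q \<in> ?C"
    using subring_setD(2)[OF R] by (auto simp: lookup_add)
  have "p * q = (\<Sum>\<mu>\<in>Poly_Mapping.keys p. \<Sum>\<nu>\<in>Poly_Mapping.keys q.
      Poly_Mapping.single \<mu> (Poly_Mapping.lookup p \<mu>) * Poly_Mapping.single \<nu> (Poly_Mapping.lookup q \<nu>))"
    unfolding sum_product[symmetric] by (simp only: mp_sum_monomials[symmetric])
  also have "\<dots> \<in> ?C"
    unfolding mult_single using pq subring_setD(3)[OF R] by (intro sums single) auto
  finally show "p * q \<in> ?C" .
next
  fix p :: "('v, 'a) mpoly" assume "p \<in> {p. \<forall>\<nu>. Poly_Mapping.lookup p \<nu> \<in> R}"
  then show "- p \<in> {p. \<forall>\<nu>. Poly_Mapping.lookup p \<nu> \<in> R}"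
    using subring_setD(4)[OF R] by auto
qed

lemma subring_set_prod: "subring_set R \<Longrightarrow> (\<And>i. i \<in> I \<Longrightarrow> f i \<in> R) \<Longrightarrow> (\<Prod>i\<in>I. f i) \<in> R"
  by (induction I rule: infinite_finite_induct) (auto simp: subring_setD)

lemma det_in_subring:
  assumes R: "subring_set R" and A: "A \<in> carrier_mat k k"
    and entries: "\<And>i j. i < k \<Longrightarrow> j < k \<Longrightarrow> A $$ (i, j) \<in> R"
  shows "det A \<in> R"
  unfolding det_def'[OF A]
proof (rule subring_set_sum[OF R])
  fix p assume p: "p \<in> {p. p permutes {0..<k}}"
  have "(\<Prod>i = 0..<k. A $$ (i, p i)) \<in> R"
  proof (rule subring_set_prod[OF R])
    fix i assume "i \<in> {0..<k}"
    then show "A $$ (i, p i) \<in> R"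
      using p permutes_in_image[of p "{0..<k}" i] by (intro entries) auto
  qed
  then show "signof p * (\<Prod>i = 0..<k. A $$ (i, p i)) \<in> R"
    using subring_setD(4)[OF R] by (simp add: sign_def)
qed

lemma augmented_jacobian_carrier: "augmented_jacobian m n \<phi> \<in> carrier_mat n (m + 1)"
  by (simp add: augmented_jacobian_def)

lemma augmented_jacobian_index:
  assumes "\<phi> \<in> carrier_vec n" "i < n"
  shows "j < m \<Longrightarrow> augmented_jacobian m n \<phi> $$ (i, j) = mp_const (jacobian m n \<phi> $$ (i, j))"
    "augmented_jacobian m n \<phi> $$ (i, m) = (\<Sum>j<n. mp_var (i, j) * mp_const (\<phi> $ j))"
  using assms
  by (auto simp: augmented_jacobian_def variable_matrix_def scalar_prod_def lessThan_atLeast0)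

lemma alg_minors_coefficients:
  assumes \<phi>: "\<phi> \<in> carrier_vec n" "\<And>i. i < n \<Longrightarrow> \<phi> $ i \<in> rat_functions m"
    and e: "e \<in> alg_minors m n \<phi>"
  shows "Poly_Mapping.lookup e \<nu> \<in> rat_functions m"
proof -
  let ?C = "{p :: (nat \<times> nat, ratfun) mpoly. \<forall>\<nu>. Poly_Mapping.lookup p \<nu> \<in> rat_functions m}"
  note C = subring_coefficients[OF subring_rat_functions[of m], where 'v = "nat \<times> nat"]
  have const: "mp_const c \<in> ?C" if "c \<in> rat_functions m" for c
    using that subring_set_0[OF subring_rat_functions] by (auto simp: mp_const_def lookup_single when_def)
  have var: "mp_var v \<in> ?C" for v
    using subring_set_0[OF subring_rat_functions] subring_setD(1)[OF subring_rat_functions]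
    by (auto simp: mp_var_def lookup_single when_def)
  obtain I S where I: "I \<subseteq> {..<n}" "card I = jacobian_rank m n \<phi> + 1" "S \<subseteq> {..<m}"
    "card S = jacobian_rank m n \<phi>" "e = det (submatrix (augmented_jacobian m n \<phi>) I (insert m S))"
    using e by (auto simp: alg_minors_def Let_def)
  have S: "insert m S \<subseteq> {..<m + 1}" "card (insert m S) = card I"
  proof -
    have "finite S" "m \<notin> S" using I(3) finite_subset by auto
    then show "card (insert m S) = card I" using I by simp
  qed (use I(3) in auto)
  have fin: "finite I" "finite (insert m S)" using I finite_subset by auto
  have entry: "augmented_jacobian m n \<phi> $$ (i, j) \<in> ?C" if "i < n" "j < m + 1" for i j
  proof (cases "j < m")
    case True
    then have "jacobian m n \<phi> $$ (i, j) \<in> rat_functions m"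
      using that \<phi>(2) by (simp add: jacobian_def rf_pderiv_in)
    then show ?thesis
      using const augmented_jacobian_index(1)[OF \<phi>(1) that(1) True] by (simp only:)
  next
    case False
    then have j: "j = m" using that by simp
    have "(\<Sum>j<n. mp_var (i, j) * mp_const (\<phi> $ j)) \<in> ?C"
      using \<phi>(2) by (intro subring_set_sum[OF C] subring_setD(3)[OF C] var const) auto
    then show ?thesis
      using augmented_jacobian_index(2)[OF \<phi>(1) that(1)] j by (simp only:)
  qed
  note sub = submatrix_carrier_index[OF augmented_jacobian_carrier[of m n \<phi>] I(1) S(1)]
  have "e \<in> ?C"
    unfolding I(5)
  proof (rule det_in_subring[OF C])
    show "submatrix (augmented_jacobian m n \<phi>) I (insert m S) \<in> carrier_mat (card I) (card I)"
      using sub(1) S(2) by simp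
    fix i j assume ij: "i < card I" "j < card I"
    then have "pick I i \<in> I" "pick (insert m S) j \<in> insert m S"
      using S(2) pick_in_set_le[of i I] pick_in_set_le[of j "insert m S"] ij by simp_all
    then have "pick I i < n" "pick (insert m S) j < m + 1"
      using I(1) S(1) by auto
    then show "submatrix (augmented_jacobian m n \<phi>) I (insert m S) $$ (i, j) \<in> ?C"
      using sub(2)[of i j] ij S(2) entry by simp
  qed
  then show ?thesis by simp
qed

text \<open>
  Specialising \<open>A\<close> to \<open>N\<close> is a ring homomorphism, so it maps the minors of \<open>(J | A.\<phi>)\<close> to those of
  \<open>(J | N \<phi>)\<close>, and these vanish exactly if \<open>N \<phi>\<close> lies in the column space of \<open>J\<close>.
\<close>

lemma common_zeros_eq_tangent:
  assumes \<phi>: "\<phi> \<in> carrier_vec n"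
    and num: "\<forall>e\<in>alg_minors m n \<phi>. is_numerator m e (num e)"
  shows "common_zeros n {x_coeff \<mu> (num e) | \<mu> e. e \<in> alg_minors m n \<phi>} =
    {N \<in> carrier_mat n n. \<exists>w. \<forall>i<n. (\<Sum>j<n. rf_const (N $$ (i, j)) * \<phi> $ j) =
       (\<Sum>j<m. jacobian m n \<phi> $$ (i, j) * w j)}"
proof -
  have "(\<forall>f\<in>{x_coeff \<mu> (num e) | \<mu> e. e \<in> alg_minors m n \<phi>}. mp_value (($$) N) f = 0) \<longleftrightarrow>
    (\<exists>w. \<forall>i<n. (\<Sum>j<n. rf_const (N $$ (i, j)) * \<phi> $ j) = (\<Sum>j<m. jacobian m n \<phi> $$ (i, j) * w j))"
    if N: "N \<in> carrier_mat n n" for N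
  proof -
    let ?ev = "mp_value (\<lambda>ij. rf_const (N $$ ij)) :: (nat \<times> nat, ratfun) mpoly \<Rightarrow> ratfun"
    let ?A = "augmented_jacobian m n \<phi>"
    let ?J = "jacobian m n \<phi>"
    let ?k = "jacobian_rank m n \<phi>"
    define L where "L = map_mat ?ev ?A"
    have ev: "comm_semiring_hom ?ev"
      by (rule comm_semiring_hom.mp_eval_hom[OF ident_hom])
    then interpret ev: comm_ring_hom ?ev
      by (simp add: comm_ring_hom_def comm_semiring_hom_def ring_hom_def)
    have L: "L \<in> carrier_mat n (m + 1)"
      by (simp add: L_def augmented_jacobian_def)
    have LJ: "L $$ (i, j) = ?J $$ (i, j)" if "i < n" "j < m" for i j
      using that augmented_jacobian_carrier[of m n \<phi>]
      by (simp add: L_def augmented_jacobian_index(1)[OF \<phi>] mp_eval_const)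
    have Lm: "L $$ (i, m) = (\<Sum>j<n. rf_const (N $$ (i, j)) * \<phi> $ j)" if "i < n" for i
      using that augmented_jacobian_carrier[of m n \<phi>]
      by (simp add: L_def augmented_jacobian_index(2)[OF \<phi>] mp_eval_id_sum mp_eval_id_mult mp_eval_const mp_eval_var)
    have minor: "?ev (det (submatrix ?A I S)) = det (submatrix L I S)" if "I \<subseteq> {..<n}" "S \<subseteq> {..<m + 1}" for I S
    proof -
      note a = submatrix_carrier_index[OF augmented_jacobian_carrier[of m n \<phi>] that]
      note l = submatrix_carrier_index[OF L that]
      have "map_mat ?ev (submatrix ?A I S) = submatrix L I S"
      proof (rule eq_matI)
        fix i j assume "i < dim_row (submatrix L I S)" "j < dim_col (submatrix L I S)"
        then have ij: "i < card I" "j < card S" using l(1) by auto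
        then have "pick I i \<in> I" "pick S j \<in> S"
          by (simp_all add: pick_in_set_le)
        then have "pick I i < n" "pick S j < m + 1" using that by auto
        then show "map_mat ?ev (submatrix ?A I S) $$ (i, j) = submatrix L I S $$ (i, j)"
          using a l ij augmented_jacobian_carrier[of m n \<phi>] by (simp add: L_def)
      qed (use a(1) l(1) in auto)
      then show ?thesis using ev.hom_det[of "submatrix ?A I S"] by simp
    qed
    have "(\<forall>f\<in>{x_coeff \<mu> (num e) | \<mu> e. e \<in> alg_minors m n \<phi>}. mp_value (($$) N) f = 0) \<longleftrightarrow>
        (\<forall>e\<in>alg_minors m n \<phi>. \<forall>\<mu>. mp_value (($$) N) (x_coeff \<mu> (num e)) = 0)"
      by auto
    also have "\<dots> \<longleftrightarrow> (\<forall>e\<in>alg_minors m n \<phi>. ?ev e = 0)"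
    proof (intro ball_cong refl)
      fix e assume "e \<in> alg_minors m n \<phi>"
      then show "(\<forall>\<mu>. mp_value (($$) N) (x_coeff \<mu> (num e)) = 0) = (?ev e = 0)"
        using numerator_vanishes_iff[of m e "num e" "($$) N"] num by blast
    qed
    also have "\<dots> \<longleftrightarrow> (\<forall>I S. I \<subseteq> {..<n} \<longrightarrow> card I = ?k + 1 \<longrightarrow> S \<subseteq> {..<m} \<longrightarrow> card S = ?k \<longrightarrow>
        ?ev (det (submatrix ?A I (insert m S))) = 0)"
      unfolding alg_minors_def Let_def by blast
    also have "\<dots> \<longleftrightarrow> (\<forall>I S. I \<subseteq> {..<n} \<longrightarrow> card I = ?k + 1 \<longrightarrow> S \<subseteq> {..<m} \<longrightarrow> card S = ?k \<longrightarrow>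
        det (submatrix L I (insert m S)) = 0)"
    proof -
      have "insert m S \<subseteq> {..<m + 1}" if "S \<subseteq> {..<m}" for S using that by auto
      then show ?thesis using minor by simp
    qed
    also have "\<dots> \<longleftrightarrow> (\<exists>w. \<forall>i<n. L $$ (i, m) = (\<Sum>j<m. ?J $$ (i, j) * w j))"
      unfolding jacobian_rank_def
      by (rule vec_space.augmented_minors_zero_iff[OF _ L LJ]) (simp_all add: jacobian_def)
    finally show ?thesis by (simp add: Lm)
  qed
  then show ?thesis
    unfolding common_zeros_def by (intro Collect_cong conj_cong refl)
qed

section \<open>Bases of matrix spaces and extension of scalars\<close>

context matrix_vs
begin

lemma lincomb_carrier: "finite A \<Longrightarrow> A \<subseteq> carrier_mat nr nc \<Longrightarrow> lincomb a A \<in> carrier_mat nr nc"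
  by (rule lincomb_closed) auto

lemma lincomb_index:
  assumes "finite A" "A \<subseteq> carrier_mat nr nc" "i < nr" "j < nc"
  shows "lincomb a A $$ (i, j) = (\<Sum>v\<in>A. a v * v $$ (i, j))"
  using assms(1,2)
proof (induction A rule: finite_induct)
  case empty
  then show ?case using assms by (simp add: lincomb_def)
next
  case (insert v A)
  have c: "lincomb a A \<in> carrier_mat nr nc" "v \<in> carrier_mat nr nc"
    using insert lincomb_carrier by blast+
  have "lincomb a (insert v A) = a v \<cdot>\<^sub>m v + lincomb a A"
    unfolding lincomb_def using insert by (subst finsum_insert) auto
  then show ?case
    using insert assms c carrier_matD[OF c(1)] carrier_matD[OF c(2)] by simp
qed

lemma lin_indpt_iff:
  assumes B: "B \<subseteq> carrier_mat nr nc"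
  shows "lin_indpt B \<longleftrightarrow> (\<forall>A a. finite A \<longrightarrow> A \<subseteq> B \<longrightarrow>
    (\<forall>i<nr. \<forall>j<nc. (\<Sum>v\<in>A. a v * v $$ (i, j)) = 0) \<longrightarrow> (\<forall>v\<in>A. a v = 0))"
proof -
  have "lincomb a A = 0\<^sub>m nr nc \<longleftrightarrow> (\<forall>i<nr. \<forall>j<nc. (\<Sum>v\<in>A. a v * v $$ (i, j)) = 0)"
    if "finite A" "A \<subseteq> B" for A a
  proof -
    have A: "A \<subseteq> carrier_mat nr nc" using that B by blast
    show ?thesis
      using lincomb_carrier[OF that(1) A, of a] lincomb_index[OF that(1) A, of _ _ a]
      by (simp add: mat_eq_iff)
  qed
  then show ?thesis
    unfolding lin_dep_def by blast
qed

lemma mem_span_iff: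
  assumes B: "B \<subseteq> carrier_mat nr nc"
  shows "M \<in> span B \<longleftrightarrow> M \<in> carrier_mat nr nc \<and> (\<exists>A a. finite A \<and> A \<subseteq> B \<and>
    (\<forall>i<nr. \<forall>j<nc. M $$ (i, j) = (\<Sum>v\<in>A. a v * v $$ (i, j))))"
proof -
  have "M = lincomb a A \<longleftrightarrow> M \<in> carrier_mat nr nc \<and> (\<forall>i<nr. \<forall>j<nc. M $$ (i, j) = (\<Sum>v\<in>A. a v * v $$ (i, j)))"
    if "finite A" "A \<subseteq> B" for A a
  proof -
    have A: "A \<subseteq> carrier_mat nr nc" using that B by blast
    note L = lincomb_carrier[OF that(1) A, of a]
    show ?thesis
    proof
      assume "M = lincomb a A"
      then show "M \<in> carrier_mat nr nc \<and> (\<forall>i<nr. \<forall>j<nc. M $$ (i, j) = (\<Sum>v\<in>A. a v * v $$ (i, j)))"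
        using L lincomb_index[OF that(1) A, of _ _ a] by simp
    next
      assume "M \<in> carrier_mat nr nc \<and> (\<forall>i<nr. \<forall>j<nc. M $$ (i, j) = (\<Sum>v\<in>A. a v * v $$ (i, j)))"
      then show "M = lincomb a A"
        using carrier_matD[OF L] lincomb_index[OF that(1) A, of _ _ a] by (auto simp: mat_eq_iff)
    qed
  qed
  then show ?thesis
    unfolding span_def by blast
qed

lemma fin_dim: "fin_dim"
  unfolding fin_dim_def
proof (intro exI conjI)
  \<comment> \<open>The elementary matrices generate.\<close>
  let ?E = "\<lambda>ij. mat nr nc (\<lambda>kl. if kl = ij then 1 else (0 :: 'a))"
  let ?B = "?E ` ({..<nr} \<times> {..<nc})"
  show "finite ?B" by simp
  show B: "?B \<subseteq> carrier_mat nr nc" by auto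
  have inj: "inj_on ?E ({..<nr} \<times> {..<nc})"
  proof (rule inj_onI)
    fix x y assume xy: "x \<in> {..<nr} \<times> {..<nc}" "y \<in> {..<nr} \<times> {..<nc}" "?E x = ?E y"
    obtain k l where x: "x = (k, l)" "k < nr" "l < nc" using xy(1) by auto
    have "?E x $$ (k, l) = ?E y $$ (k, l)" by (simp only: xy(3))
    then show "x = y" using x by (simp split: if_splits)
  qed
  have "M \<in> span ?B" if M: "M \<in> carrier_mat nr nc" for M
    unfolding mem_span_iff[OF B]
  proof (intro conjI exI allI impI)
    fix i j assume ij: "i < nr" "j < nc"
    have "(\<Sum>v\<in>?B. M $$ the_inv_into ({..<nr} \<times> {..<nc}) ?E v * v $$ (i, j))
        = (\<Sum>kl\<in>{..<nr} \<times> {..<nc}. M $$ kl * ?E kl $$ (i, j))"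
      unfolding sum.reindex[OF inj] o_def by (intro sum.cong refl) (simp add: the_inv_into_f_f[OF inj])
    also have "\<dots> = (\<Sum>kl\<in>{..<nr} \<times> {..<nc}. if kl = (i, j) then M $$ kl else 0)"
      using ij by (intro sum.cong refl) auto
    finally show "M $$ (i, j) = (\<Sum>v\<in>?B. M $$ the_inv_into ({..<nr} \<times> {..<nc}) ?E v * v $$ (i, j))"
      using ij by simp
  qed (use M in auto)
  then show "span ?B = carrier_mat nr nc"
    using mem_span_iff[OF B] by blast
qed

end

text \<open>
  Spans and linear dependence in terms of matrix entries, where coefficients can be compared across
  the fields \<open>\<rat>\<close> and \<open>\<complex>\<close>.
\<close>

lemma is_basis_of_iff:
  fixes W :: "'a::field mat set"
  shows "is_basis_of n W B \<longleftrightarrow>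
    W \<subseteq> carrier_mat n n \<and> 0\<^sub>m n n \<in> W \<and> (\<forall>x\<in>W. \<forall>y\<in>W. x + y \<in> W) \<and> (\<forall>c. \<forall>x\<in>W. c \<cdot>\<^sub>m x \<in> W) \<and>
    B \<subseteq> W \<and>
    (\<forall>A a. finite A \<longrightarrow> A \<subseteq> B \<longrightarrow>
      (\<forall>i<n. \<forall>j<n. (\<Sum>v\<in>A. a v * v $$ (i, j)) = 0) \<longrightarrow> (\<forall>v\<in>A. a v = 0)) \<and>
    (\<forall>M\<in>W. \<exists>A a. finite A \<and> A \<subseteq> B \<and> (\<forall>i<n. \<forall>j<n. M $$ (i, j) = (\<Sum>v\<in>A. a v * v $$ (i, j))))"
    (is "_ \<longleftrightarrow> ?R")
proof -
  interpret V: matrix_vs n n "TYPE('a)" .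
  have sub: "VectorSpace.subspace class_ring W V.V \<longleftrightarrow>
      W \<subseteq> carrier_mat n n \<and> 0\<^sub>m n n \<in> W \<and> (\<forall>x\<in>W. \<forall>y\<in>W. x + y \<in> W) \<and> (\<forall>c. \<forall>x\<in>W. c \<cdot>\<^sub>m x \<in> W)"
    using V.vectorspace_axioms V.module_axioms
    by (auto simp: VectorSpace.subspace_def submodule_def matrix_vs_simps)
  show ?thesis
  proof (cases "VectorSpace.subspace class_ring W V.V")
    case False
    then show ?thesis
      unfolding is_basis_of_def sub by blast
  next
    case True
    then have W: "W \<subseteq> carrier_mat n n" "submodule class_ring W V.V"
      using sub by (auto simp: VectorSpace.subspace_def)
    have vs: "vectorspace class_ring (V.V\<lparr>carrier := W\<rparr>)"
      by (rule V.subspace_is_vs[OF True])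
    have "vectorspace.basis class_ring (V.V\<lparr>carrier := W\<rparr>) B \<longleftrightarrow> B \<subseteq> W \<and> V.lin_indpt B \<and> V.span B = W"
      unfolding vectorspace.basis_def[OF vs]
      using V.span_li_not_depend[OF _ W(2), of B] by auto
    moreover have "V.span B = W \<longleftrightarrow> W \<subseteq> V.span B" if "B \<subseteq> W"
      using V.span_is_subset[OF that] True by (auto simp: VectorSpace.subspace_def)
    ultimately have "vectorspace.basis class_ring (V.V\<lparr>carrier := W\<rparr>) B \<longleftrightarrow>
        B \<subseteq> W \<and> V.lin_indpt B \<and> W \<subseteq> V.span B" by blast
    also have "\<dots> \<longleftrightarrow> B \<subseteq> W \<and>
      (\<forall>A a. finite A \<longrightarrow> A \<subseteq> B \<longrightarrow>
        (\<forall>i<n. \<forall>j<n. (\<Sum>v\<in>A. a v * v $$ (i, j)) = 0) \<longrightarrow> (\<forall>v\<in>A. a v = 0)) \<and>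
      (\<forall>M\<in>W. \<exists>A a. finite A \<and> A \<subseteq> B \<and> (\<forall>i<n. \<forall>j<n. M $$ (i, j) = (\<Sum>v\<in>A. a v * v $$ (i, j))))"
    proof (intro conj_cong refl)
      assume "B \<subseteq> W"
      then have B: "B \<subseteq> carrier_mat n n" using W by blast
      show "V.lin_indpt B = (\<forall>A a. finite A \<longrightarrow> A \<subseteq> B \<longrightarrow>
        (\<forall>i<n. \<forall>j<n. (\<Sum>v\<in>A. a v * v $$ (i, j)) = 0) \<longrightarrow> (\<forall>v\<in>A. a v = 0))"
        by (rule V.lin_indpt_iff[OF B])
      show "(W \<subseteq> V.span B) = (\<forall>M\<in>W. \<exists>A a. finite A \<and> A \<subseteq> B \<and>
          (\<forall>i<n. \<forall>j<n. M $$ (i, j) = (\<Sum>v\<in>A. a v * v $$ (i, j))))"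
        unfolding subset_eq[of W] V.mem_span_iff[OF B] using W(1)
        by (intro ball_cong refl) (simp add: subset_iff)
    qed
    finally have basis: "vectorspace.basis class_ring (V.V\<lparr>carrier := W\<rparr>) B \<longleftrightarrow> B \<subseteq> W \<and>
      (\<forall>A a. finite A \<longrightarrow> A \<subseteq> B \<longrightarrow>
        (\<forall>i<n. \<forall>j<n. (\<Sum>v\<in>A. a v * v $$ (i, j)) = 0) \<longrightarrow> (\<forall>v\<in>A. a v = 0)) \<and>
      (\<forall>M\<in>W. \<exists>A a. finite A \<and> A \<subseteq> B \<and> (\<forall>i<n. \<forall>j<n. M $$ (i, j) = (\<Sum>v\<in>A. a v * v $$ (i, j))))" .
    show ?thesis
      unfolding is_basis_of_def basis sub conj_assoc by (rule refl)
  qed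
qed

lemma is_basis_ofD:
  assumes "is_basis_of n W B"
  shows "W \<subseteq> carrier_mat n n" "B \<subseteq> W"
    "finite A \<Longrightarrow> A \<subseteq> B \<Longrightarrow> (\<And>i j. i < n \<Longrightarrow> j < n \<Longrightarrow> (\<Sum>v\<in>A. a v * v $$ (i, j)) = 0) \<Longrightarrow>
      v \<in> A \<Longrightarrow> a v = 0"
    "M \<in> W \<Longrightarrow> \<exists>A a. finite A \<and> A \<subseteq> B \<and> (\<forall>i<n. \<forall>j<n. M $$ (i, j) = (\<Sum>v\<in>A. a v * v $$ (i, j)))"
proof -
  note D = assms[unfolded is_basis_of_iff]
  show "W \<subseteq> carrier_mat n n" by (rule D[THEN conjunct1])
  note D = D[THEN conjunct2, THEN conjunct2, THEN conjunct2, THEN conjunct2]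
  show "B \<subseteq> W" by (rule D[THEN conjunct1])
  show "a v = 0" if "finite A" "A \<subseteq> B" "\<And>i j. i < n \<Longrightarrow> j < n \<Longrightarrow> (\<Sum>v\<in>A. a v * v $$ (i, j)) = 0" "v \<in> A"
    by (rule D[THEN conjunct2, THEN conjunct1, rule_format, OF that(1-3) that(4)])
  show "\<exists>A a. finite A \<and> A \<subseteq> B \<and> (\<forall>i<n. \<forall>j<n. M $$ (i, j) = (\<Sum>v\<in>A. a v * v $$ (i, j)))" if "M \<in> W"
    by (rule D[THEN conjunct2, THEN conjunct2, rule_format, OF that])
qed

lemma is_basis_of_exists:
  fixes W :: "'a::field mat set"
  assumes W: "W \<subseteq> carrier_mat n n" "0\<^sub>m n n \<in> W" "\<And>x y. x \<in> W \<Longrightarrow> y \<in> W \<Longrightarrow> x + y \<in> W"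
    "\<And>c x. x \<in> W \<Longrightarrow> c \<cdot>\<^sub>m x \<in> W"
  shows "\<exists>B. is_basis_of n W B"
proof -
  interpret V: matrix_vs n n "TYPE('a)" .
  have sub: "VectorSpace.subspace class_ring W V.V"
    using V.vectorspace_axioms V.module_axioms W
    by (auto simp: VectorSpace.subspace_def submodule_def matrix_vs_simps)
  then have subm: "submodule class_ring W V.V"
    by (simp add: VectorSpace.subspace_def)
  have vs: "vectorspace class_ring (V.V\<lparr>carrier := W\<rparr>)"
    by (rule V.subspace_is_vs[OF sub])
  have "\<exists>B. finite B \<and> maximal B (\<lambda>S. S \<subseteq> W \<and> V.lin_indpt S)"
  proof (rule maximal_exists[where N = V.dim])
    show "finite A \<and> card A \<le> V.dim" if "A \<subseteq> W \<and> V.lin_indpt A" for A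
      using V.li_le_dim[OF V.fin_dim] that W(1) by blast
    show "{} \<subseteq> W \<and> V.lin_indpt {}"
      by (auto simp: V.lin_dep_def)
  qed
  then obtain B where B: "maximal B (\<lambda>S. S \<subseteq> W \<and> V.lin_indpt S)" by blast
  have eq: "(S \<subseteq> carrier (V.V\<lparr>carrier := W\<rparr>) \<and>
      \<not> LinearCombinations.module.lin_dep class_ring (V.V\<lparr>carrier := W\<rparr>) S) = (S \<subseteq> W \<and> V.lin_indpt S)" for S
    using V.span_li_not_depend(2)[OF _ subm, of S] by auto
  have "vectorspace.basis class_ring (V.V\<lparr>carrier := W\<rparr>) B"
  proof -
    have "maximal B (\<lambda>S. S \<subseteq> carrier (V.V\<lparr>carrier := W\<rparr>) \<and>
      \<not> LinearCombinations.module.lin_dep class_ring (V.V\<lparr>carrier := W\<rparr>) S)"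
      unfolding eq by (rule B)
    then have "LinearCombinations.module.gen_set class_ring (V.V\<lparr>carrier := W\<rparr>) B"
      by (rule vectorspace.max_li_is_gen[OF vs])
    then show ?thesis
      using B eq[of B] unfolding vectorspace.basis_def[OF vs] maximal_def by blast
  qed
  then show ?thesis
    using sub by (auto simp: is_basis_of_def)
qed

text \<open>
  Let \<open>V\<close> be a complex space of matrices such that applying \<open>\<rat>\<close>-linear functionals \<open>\<complex> \<rightarrow> \<rat>\<close> entrywise
  leads from \<open>V\<close> to \<open>W\<close>.  A linear relation over \<open>\<complex>\<close> between rational matrices then splits into
  relations over \<open>\<rat>\<close>, and a matrix in \<open>V\<close> is a complex combination of its coordinate matrices, which
  are in \<open>W\<close>.
\<close>

lemma is_basis_of_extension_of_scalars:
  fixes W :: "rat mat set" and V :: "complex mat set"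
  assumes B: "is_basis_of n W B"
    and V: "V \<subseteq> carrier_mat n n" "0\<^sub>m n n \<in> V" "\<And>x y. x \<in> V \<Longrightarrow> y \<in> V \<Longrightarrow> x + y \<in> V"
      "\<And>c x. x \<in> V \<Longrightarrow> c \<cdot>\<^sub>m x \<in> V"
    and WV: "\<And>N. N \<in> W \<Longrightarrow> map_mat of_rat N \<in> V"
    and VW: "\<And>M \<pi>. M \<in> V \<Longrightarrow> (\<And>z w. \<pi> (z + w) = \<pi> z + \<pi> w) \<Longrightarrow>
      (\<And>r z. \<pi> (of_rat r * z) = r * (\<pi> z :: rat)) \<Longrightarrow> map_mat \<pi> M \<in> W"
  shows "is_basis_of n V (map_mat of_rat ` B)"
proof -
  let ?c = "map_mat of_rat :: rat mat \<Rightarrow> complex mat"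
  note W = is_basis_ofD(1,2)[OF B] and indep = is_basis_ofD(3)[OF B] and gen = is_basis_ofD(4)[OF B]
  have Bc: "v \<in> carrier_mat n n" if "v \<in> B" for v using W that by blast
  have inj: "inj_on ?c A" for A
    by (rule inj_onI) (auto simp: mat_eq_iff)
  have idx: "?c v $$ (i, j) = of_rat (v $$ (i, j))" if "v \<in> B" "i < n" "j < n" for v i j
    using Bc[OF that(1)] that by simp
  obtain \<pi> :: "complex \<Rightarrow> complex \<Rightarrow> rat" where \<pi>: "\<And>b z w. \<pi> b (z + w) = \<pi> b z + \<pi> b w"
    "\<And>b r z. \<pi> b (of_rat r * z) = r * \<pi> b z"
    "\<And>z. finite {b. \<pi> b z \<noteq> 0}"
    "\<And>z. z = (\<Sum>b | \<pi> b z \<noteq> 0. of_rat (\<pi> b z) * b)"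
    by (rule rational_coordinates) blast
  have \<pi>0: "\<pi> b 0 = 0" for b using \<pi>(1)[of b 0 0] by simp
  have \<pi>2: "\<pi> b (z * of_rat r) = \<pi> b z * r" for b z r
    using \<pi>(2)[of b r z] by (simp add: mult.commute)
  have \<pi>_sum: "\<pi> b (\<Sum>i\<in>I. f i) = (\<Sum>i\<in>I. \<pi> b (f i))" for b and f :: "rat mat \<Rightarrow> complex" and I
    by (induction I rule: infinite_finite_induct) (simp_all add: \<pi>0 \<pi>(1))
  have indep': "\<forall>v\<in>A. a v = 0"
    if A: "finite A" "A \<subseteq> ?c ` B" "\<forall>i<n. \<forall>j<n. (\<Sum>v\<in>A. a v * v $$ (i, j)) = 0" for A a
  proof -
    obtain A' where A': "A' \<subseteq> B" "A = ?c ` A'" "finite A'"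
      using A finite_subset_image[OF A(1,2)] by metis
    have "\<pi> b (a (?c v)) = 0" if "v \<in> A'" for b v
    proof -
      have zero: "(\<Sum>v\<in>A'. \<pi> b (a (?c v)) * v $$ (i, j)) = 0" if ij: "i < n" "j < n" for i j
      proof -
        have "(\<Sum>v\<in>A'. a (?c v) * of_rat (v $$ (i, j))) = (\<Sum>v\<in>A. a v * v $$ (i, j))"
          unfolding A'(2) sum.reindex[OF inj] o_def using A'(1) ij idx by (intro sum.cong refl) auto
        also have "\<dots> = 0" using A(3) ij by blast
        finally have "\<pi> b (\<Sum>v\<in>A'. a (?c v) * of_rat (v $$ (i, j))) = 0" by (simp only: \<pi>0)
        then show ?thesis by (simp only: \<pi>_sum \<pi>2)
      qed
      show ?thesis
        by (rule indep[where a = "\<lambda>v. \<pi> b (a (?c v))", OF A'(3,1) zero that])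
    qed
    then have "a (?c v) = 0" if "v \<in> A'" for v
      using \<pi>(4)[of "a (?c v)"] that by simp
    then show ?thesis using A'(2) by (simp add: ball_simps)
  qed
  have gen': "\<exists>A a. finite A \<and> A \<subseteq> ?c ` B \<and> (\<forall>i<n. \<forall>j<n. M $$ (i, j) = (\<Sum>v\<in>A. a v * v $$ (i, j)))"
    if M: "M \<in> V" for M
  proof -
    have Mc: "M \<in> carrier_mat n n" using M V by blast
    have "\<exists>A a. finite A \<and> A \<subseteq> B \<and> (\<forall>i<n. \<forall>j<n. \<pi> b (M $$ (i, j)) = (\<Sum>v\<in>A. a v * v $$ (i, j)))" for b
    proof -
      have "map_mat (\<pi> b) M \<in> W"
        by (rule VW[OF M]) (simp_all add: \<pi>(1,2))
      from gen[OF this] show ?thesis using Mc by auto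
    qed
    then obtain A a where A: "\<And>b. finite (A b)" "\<And>b. A b \<subseteq> B"
      "\<And>b i j. i < n \<Longrightarrow> j < n \<Longrightarrow> \<pi> b (M $$ (i, j)) = (\<Sum>v\<in>A b. a b v * v $$ (i, j))"
      by metis
    define F where "F = (\<Union>i<n. \<Union>j<n. {b. \<pi> b (M $$ (i, j)) \<noteq> 0})"
    define C where "C = (\<Union>b\<in>F. A b)"
    have F: "finite F" by (simp add: F_def \<pi>(3))
    then have C: "finite C" "C \<subseteq> B" using A by (auto simp: C_def)
    \<comment> \<open>The combinations for the different \<open>b\<close> are extended by zero to the common support \<open>C\<close>.\<close>
    define a' where "a' b v = (if v \<in> A b then a b v else 0)" for b v
    define d where "d v = (\<Sum>b\<in>F. of_rat (a' b v) * b)" for v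
    have "M $$ (i, j) = (\<Sum>v\<in>?c ` C. d (the_inv_into C ?c v) * v $$ (i, j))" if ij: "i < n" "j < n" for i j
    proof -
      have Ma: "\<pi> b (M $$ (i, j)) = (\<Sum>v\<in>C. a' b v * v $$ (i, j))" if "b \<in> F" for b
        unfolding A(3)[OF ij] a'_def using that C A(1)
        by (intro sum.mono_neutral_cong_left) (auto simp: C_def)
      have "M $$ (i, j) = (\<Sum>b\<in>F. of_rat (\<pi> b (M $$ (i, j))) * b)"
        by (subst \<pi>(4), rule sum.mono_neutral_left) (use F ij in \<open>auto simp: F_def\<close>)
      also have "\<dots> = (\<Sum>b\<in>F. \<Sum>v\<in>C. of_rat (a' b v) * b * of_rat (v $$ (i, j)))"
        by (intro sum.cong refl) (simp add: Ma of_rat_sum of_rat_mult sum_distrib_left sum_distrib_right mult_ac)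
      also have "\<dots> = (\<Sum>v\<in>C. d v * of_rat (v $$ (i, j)))"
        unfolding d_def sum_distrib_right by (rule sum.swap)
      also have "\<dots> = (\<Sum>v\<in>?c ` C. d (the_inv_into C ?c v) * v $$ (i, j))"
        unfolding sum.reindex[OF inj] o_def using C ij idx
        by (intro sum.cong refl) (auto simp: the_inv_into_f_f[OF inj])
      finally show ?thesis .
    qed
    then show ?thesis
      using C by (intro exI[of _ "?c ` C"] exI[of _ "\<lambda>v. d (the_inv_into C ?c v)"]) auto
  qed
  show ?thesis
    unfolding is_basis_of_iff
  proof (intro conjI)
    show "?c ` B \<subseteq> V" using WV W by blast
    show "\<forall>x\<in>V. \<forall>y\<in>V. x + y \<in> V" "\<forall>c. \<forall>x\<in>V. c \<cdot>\<^sub>m x \<in> V"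
      using V(3,4) by simp_all
    show "\<forall>A a. finite A \<longrightarrow> A \<subseteq> ?c ` B \<longrightarrow>
        (\<forall>i<n. \<forall>j<n. (\<Sum>v\<in>A. a v * v $$ (i, j)) = 0) \<longrightarrow> (\<forall>v\<in>A. a v = 0)"
      by (intro allI impI) (rule indep')
    show "\<forall>M\<in>V. \<exists>A a. finite A \<and> A \<subseteq> ?c ` B \<and>
        (\<forall>i<n. \<forall>j<n. M $$ (i, j) = (\<Sum>v\<in>A. a v * v $$ (i, j)))"
      by (rule ballI) (rule gen')
  qed (rule V)+
qed

section \<open>Correctness of the algorithm\<close>

lemma lie_algebra_closed:
  "lie_algebra n G \<subseteq> carrier_mat n n"
  "0\<^sub>m n n \<in> lie_algebra n G"
  "M \<in> lie_algebra n G \<Longrightarrow> N \<in> lie_algebra n G \<Longrightarrow> M + N \<in> lie_algebra n G"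
  "M \<in> lie_algebra n G \<Longrightarrow> c \<cdot>\<^sub>m M \<in> lie_algebra n G"
proof -
  show "lie_algebra n G \<subseteq> carrier_mat n n" by (auto simp: lie_algebra_def)
  show "0\<^sub>m n n \<in> lie_algebra n G"
    unfolding lie_algebra_def by (auto intro!: sum.neutral)
  let ?d = "\<lambda>P M. \<Sum>ij\<in>{..<n} \<times> {..<n}. mp_value (($$) (1\<^sub>m n)) (mp_pderiv ij P) * M $$ ij"
  have add: "?d P (M + N) = ?d P M + ?d P N" if "M \<in> carrier_mat n n" "N \<in> carrier_mat n n" for P M N
    unfolding sum.distrib[symmetric] using that by (intro sum.cong refl) (auto simp: distrib_left)
  have smult: "?d P (c \<cdot>\<^sub>m M) = c * ?d P M" if "M \<in> carrier_mat n n" for P M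
    unfolding sum_distrib_left using that by (intro sum.cong refl) auto
  show "M + N \<in> lie_algebra n G" if "M \<in> lie_algebra n G" "N \<in> lie_algebra n G"
    using that unfolding lie_algebra_def by (simp add: add)
  show "c \<cdot>\<^sub>m M \<in> lie_algebra n G" if "M \<in> lie_algebra n G"
    using that unfolding lie_algebra_def by (simp add: smult)
qed

text \<open>
  A rational symmetry is recovered from itself by a \<open>\<rat>\<close>-linear functional that is the identity on \<open>\<rat>\<close>,
  so it is among the coordinates of a complex symmetry.
\<close>

lemma (in rational_parametrization) rational_symmetry_algebra_eq:
  "rational_symmetry_algebra n X = preserves_relations n \<phi>"
proof
  show "preserves_relations n \<phi> \<subseteq> rational_symmetry_algebra n X"
    using preserves_relations_imp_symmetry
    by (auto simp: rational_symmetry_algebra_def preserves_relations_def)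
  show "rational_symmetry_algebra n X \<subseteq> preserves_relations n \<phi>"
  proof
    fix N assume "N \<in> rational_symmetry_algebra n X"
    then have N: "N \<in> carrier_mat n n" "map_mat of_rat N \<in> symmetry_algebra n X"
      by (simp_all add: rational_symmetry_algebra_def)
    obtain \<pi> :: "complex \<Rightarrow> complex \<Rightarrow> rat" where \<pi>: "\<And>b z w. \<pi> b (z + w) = \<pi> b z + \<pi> b w"
      "\<And>b r z. \<pi> b (of_rat r * z) = r * \<pi> b z"
      "\<And>z. z = (\<Sum>b | \<pi> b z \<noteq> 0. of_rat (\<pi> b z) * b)"
      by (rule rational_coordinates) blast
    have "\<exists>b. \<pi> b 1 \<noteq> 0"
    proof (rule ccontr)
      assume "\<nexists>b. \<pi> b 1 \<noteq> 0"
      then show False using \<pi>(3)[of 1] by simp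
    qed
    then obtain b where b: "\<pi> b 1 \<noteq> 0" by blast
    define \<rho> where "\<rho> z = \<pi> b z / \<pi> b 1" for z
    have "\<rho> (of_rat r) = r" for r
      using \<pi>(2)[of b r 1] b by (simp add: \<rho>_def)
    then have "map_mat \<rho> (map_mat of_rat N) = N"
      using N(1) by (intro eq_matI) auto
    moreover have "map_mat \<rho> (map_mat of_rat N) \<in> preserves_relations n \<phi>"
      by (rule coordinates_of_symmetry_preserve_relations[OF N(2)])
         (simp_all add: \<rho>_def \<pi>(1,2) add_divide_distrib)
    ultimately show "N \<in> preserves_relations n \<phi>" by simp
  qed
qed

lemma rational_symmetry_algebra_closed:
  "rational_symmetry_algebra n X \<subseteq> carrier_mat n n"
  "0\<^sub>m n n \<in> rational_symmetry_algebra n X"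
  "M \<in> rational_symmetry_algebra n X \<Longrightarrow> N \<in> rational_symmetry_algebra n X \<Longrightarrow>
     M + N \<in> rational_symmetry_algebra n X"
  "M \<in> rational_symmetry_algebra n X \<Longrightarrow> r \<cdot>\<^sub>m M \<in> rational_symmetry_algebra n X"
proof -
  let ?c = "map_mat of_rat :: rat mat \<Rightarrow> complex mat"
  note V = lie_algebra_closed[where n = n and G = "symmetry_group n X", folded symmetry_algebra_def]
  show "rational_symmetry_algebra n X \<subseteq> carrier_mat n n"
    by (auto simp: rational_symmetry_algebra_def)
  have "?c (0\<^sub>m n n) = 0\<^sub>m n n" by (rule eq_matI) auto
  then show "0\<^sub>m n n \<in> rational_symmetry_algebra n X"
    using V(2) by (simp add: rational_symmetry_algebra_def)
  have "?c (M + N) = ?c M + ?c N" if "M \<in> carrier_mat n n" "N \<in> carrier_mat n n"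
    using that by (intro eq_matI) (auto simp: of_rat_add)
  then show "M + N \<in> rational_symmetry_algebra n X"
    if "M \<in> rational_symmetry_algebra n X" "N \<in> rational_symmetry_algebra n X"
    using that V(3) by (simp add: rational_symmetry_algebra_def)
  have "?c (r \<cdot>\<^sub>m M) = of_rat r \<cdot>\<^sub>m ?c M" if "M \<in> carrier_mat n n"
    using that by (intro eq_matI) (auto simp: of_rat_mult)
  then show "r \<cdot>\<^sub>m M \<in> rational_symmetry_algebra n X" if "M \<in> rational_symmetry_algebra n X"
    using that V(4) by (simp add: rational_symmetry_algebra_def)
qed

theorem proposition5p1:
  fixes m n :: nat and \<phi> :: "ratfun vec" and X :: "complex vec set"
  assumes "\<phi> \<in> carrier_vec n"
    and "\<And>i. i < n \<Longrightarrow> \<phi> $ i \<in> rat_functions m"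
    and "X = zariski_closure n (rat_map_image m n \<phi>)"
  shows "(\<exists>B. symbolic_algorithm_returns m n \<phi> B) \<and>
    (\<forall>B. symbolic_algorithm_returns m n \<phi> B \<longrightarrow>
       is_basis_of n (rational_symmetry_algebra n X) B \<and>
       is_basis_of n (symmetry_algebra n X) (map_mat of_rat ` B))"
proof (intro conjI allI impI)
  interpret rational_parametrization m n \<phi> X
    using assms by unfold_locales
  note V = lie_algebra_closed[where n = n and G = "symmetry_group n X", folded symmetry_algebra_def]
  have zeros: "common_zeros n {x_coeff \<mu> (num e) | \<mu> e. e \<in> alg_minors m n \<phi>} = rational_symmetry_algebra n X"
    if "\<forall>e\<in>alg_minors m n \<phi>. is_numerator m e (num e)" for num
    unfolding common_zeros_eq_tangent[OF assms(1) that] rational_symmetry_algebra_eq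
      preserves_relations_iff_tangent by (rule refl)
  show "\<exists>B. symbolic_algorithm_returns m n \<phi> B"
  proof -
    have "\<forall>e\<in>alg_minors m n \<phi>. \<exists>e'. is_numerator m e e'"
      using numerator_exists alg_minors_coefficients[OF assms(1,2)] by blast
    then obtain num where num: "\<forall>e\<in>alg_minors m n \<phi>. is_numerator m e (num e)"
      by metis
    obtain B where B: "is_basis_of n (rational_symmetry_algebra n X) B"
      using is_basis_of_exists[OF rational_symmetry_algebra_closed] by blast
    show ?thesis
      unfolding symbolic_algorithm_returns_def
      by (rule exI[of _ B], rule exI[of _ num], rule conjI[OF num]) (simp only: zeros[OF num] B)
  qed
  fix B assume "symbolic_algorithm_returns m n \<phi> B"
  then obtain num where num: "\<forall>e\<in>alg_minors m n \<phi>. is_numerator m e (num e)"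
    and B: "is_basis_of n (common_zeros n {x_coeff \<mu> (num e) | \<mu> e. e \<in> alg_minors m n \<phi>}) B"
    unfolding symbolic_algorithm_returns_def by blast
  then show basis: "is_basis_of n (rational_symmetry_algebra n X) B"
    unfolding zeros[OF num] by simp
  show "is_basis_of n (symmetry_algebra n X) (map_mat of_rat ` B)"
  proof (rule is_basis_of_extension_of_scalars[OF basis V])
    show "map_mat of_rat N \<in> symmetry_algebra n X" if "N \<in> rational_symmetry_algebra n X" for N
      using that by (simp add: rational_symmetry_algebra_def)
    show "map_mat \<pi> M \<in> rational_symmetry_algebra n X"
      if "M \<in> symmetry_algebra n X" "\<And>z w. \<pi> (z + w) = \<pi> z + \<pi> w"
        "\<And>r z. \<pi> (of_rat r * z) = r * (\<pi> z :: rat)" for M \<pi>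
      unfolding rational_symmetry_algebra_eq
      by (rule coordinates_of_symmetry_preserve_relations[OF that])
  qed
qed

end
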